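(* Let $G$ be a group that admits a finite $2$-dimensional model for $K(G,1)$, i.e. a $2$-dimensional $K(G,1)$ CW-complex with finitely many cells, and let $R=\mathbb{Q}$, $\mathbb{R}$ or $\mathbb{C}$ with the standard absolute value norm. Let $f_1$ be the homological $1$-isoperimetric function of $G$ over $R$. Then $f_1$ takes only finite values if and only if $G$ is (Gromov) hyperbolic.
   Context: All modules are left modules; $RG$ is the group ring. A free $RG$-module with fixed $RG$-basis $\Lambda$ is regarded as a free $R$-module with basis $\Lambda\times G$ and given the $\ell^1$-norm $\left|\sum_{x\in\Lambda\times G} a_x x\right|=\sum_x |a_x|$. A projective resolution $(C_k,\partial_k)$ of the trivial $RG$-module $R$ is $1$-admissible if $C_1$ and $C_2$ are finitely generated free $RG$-modules equipped with fixed free bases. On $\operatorname{Im}(\partial_2)\subseteq C_1$ consider the filling norm $\|b\|=\inf\{|c| : c\in C_2,\ \partial_2(c)=b\}$. The $1$-isoperimetric function of the resolution is $$f_1(l)=\sup\{\|b\| : b\in\operatorname{Im}(\partial_2),\ |b|\le l\}\in\mathbb{R}_{\ge 0}\cup\{\infty\},\qquad l\in\mathbb{R}_{\ge 0}.$$ The homological $1$-isoperimetric function of $G$ over $R$ is the $1$-isoperimetric function of a $1$-admissible projective resolution of the trivial $RG$-module $R$. It takes only finite values if $f_1(l)<\infty$ for every $l\in\mathbb{R}_{\ge 0}$; this property does not depend on the chosen $1$-admissible resolution. *)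

theory Defs
  imports "HOL-Analysis.Analysis" "HOL-Algebra.Module" "HOL-Algebra.Generated_Groups"
begin

section \<open>CW complexes\<close>

definition disc :: "nat \<Rightarrow> (nat \<Rightarrow> real) topology" where
  "disc n = subtopology (Euclidean_space n) {x. (\<Sum>i<n. (x i)\<^sup>2) \<le> 1}"

definition open_disc :: "nat \<Rightarrow> (nat \<Rightarrow> real) set" where
  "open_disc n = {x \<in> topspace (Euclidean_space n). (\<Sum>i<n. (x i)\<^sup>2) < 1}"

definition disc_boundary :: "nat \<Rightarrow> (nat \<Rightarrow> real) set" where
  "disc_boundary n = {x \<in> topspace (Euclidean_space n). (\<Sum>i<n. (x i)\<^sup>2) = 1}"

text \<open>The cells of the complex are indexed by \<open>I\<close>; the cell \<open>i\<close> has dimension \<open>dm i\<close> and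
  characteristic map \<open>char_map i\<close>, defined on the closed disc.\<close>

locale CW_complex =
  fixes Y :: "'x topology" and I :: "'i set" and dm :: "'i \<Rightarrow> nat"
    and char_map :: "'i \<Rightarrow> (nat \<Rightarrow> real) \<Rightarrow> 'x"
  assumes hausdorff: "Hausdorff_space Y"
    and continuous: "i \<in> I \<Longrightarrow> continuous_map (disc (dm i)) Y (char_map i)"
    and embedding: "i \<in> I \<Longrightarrow> embedding_map (subtopology (disc (dm i)) (open_disc (dm i))) Y (char_map i)"
    and cover: "topspace Y = (\<Union>i\<in>I. char_map i ` open_disc (dm i))"
    and disjoint: "disjoint_family_on (\<lambda>i. char_map i ` open_disc (dm i)) I"
    and closure_finite: "i \<in> I \<Longrightarrow> \<exists>J\<subseteq>{j \<in> I. dm j < dm i}. finite J \<and>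
          char_map i ` disc_boundary (dm i) \<subseteq> (\<Union>j\<in>J. char_map j ` open_disc (dm j))"
    and weak_topology: "\<lbrakk>T \<subseteq> topspace Y;
          \<And>i. i \<in> I \<Longrightarrow> closedin (disc (dm i)) {x \<in> topspace (disc (dm i)). char_map i x \<in> T}\<rbrakk>
          \<Longrightarrow> closedin Y T"

text \<open>Exactly two-dimensional: a 2-cell is present.\<close>

definition finite_2dim_CW_complex ::
    "'x topology \<Rightarrow> 'i set \<Rightarrow> ('i \<Rightarrow> nat) \<Rightarrow> ('i \<Rightarrow> (nat \<Rightarrow> real) \<Rightarrow> 'x) \<Rightarrow> bool" where
  "finite_2dim_CW_complex Y I dm char_map \<longleftrightarrow>
     CW_complex Y I dm char_map \<and> finite I \<and> (\<forall>i\<in>I. dm i \<le> 2) \<and> (\<exists>i\<in>I. dm i = 2)"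


section \<open>Homotopy groups and Eilenberg--MacLane spaces\<close>

definition loops :: "'x topology \<Rightarrow> 'x \<Rightarrow> (real \<Rightarrow> 'x) set" where
  "loops Y x0 = {f. pathin Y f \<and> f 0 = x0 \<and> f 1 = x0}"

definition loop_homotopic :: "'x topology \<Rightarrow> 'x \<Rightarrow> (real \<Rightarrow> 'x) \<Rightarrow> (real \<Rightarrow> 'x) \<Rightarrow> bool" where
  "loop_homotopic Y x0 f g \<longleftrightarrow>
     homotopic_with (\<lambda>h. h 0 = x0 \<and> h 1 = x0) (top_of_set {0..1}) Y f g"

definition loop_class :: "'x topology \<Rightarrow> 'x \<Rightarrow> (real \<Rightarrow> 'x) \<Rightarrow> (real \<Rightarrow> 'x) set" where
  "loop_class Y x0 f = {g \<in> loops Y x0. loop_homotopic Y x0 f g}"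

text \<open>The library operation \<open>+++\<close> needs a target type of class \<open>topological_space\<close>, so it does
  not apply to paths in a general abstract topology.\<close>

definition loop_concat :: "(real \<Rightarrow> 'x) \<Rightarrow> (real \<Rightarrow> 'x) \<Rightarrow> real \<Rightarrow> 'x" where
  "loop_concat f g = (\<lambda>t. if t \<le> 1/2 then f (2 * t) else g (2 * t - 1))"

definition fundamental_group :: "'x topology \<Rightarrow> 'x \<Rightarrow> (real \<Rightarrow> 'x) set monoid" where
  "fundamental_group Y x0 =
     \<lparr>carrier = loop_class Y x0 ` loops Y x0,
      mult = (\<lambda>A B. \<Union>f\<in>A. \<Union>g\<in>B. loop_class Y x0 (loop_concat f g)),
      one = loop_class Y x0 (\<lambda>_. x0)\<rparr>"

definition sphere_base :: "nat \<Rightarrow> real" where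
  "sphere_base = (\<lambda>i. if i = 0 then 1 else 0)"

definition trivial_homotopy_group :: "nat \<Rightarrow> 'x topology \<Rightarrow> 'x \<Rightarrow> bool" where
  "trivial_homotopy_group n Y x0 \<longleftrightarrow>
     (\<forall>f. continuous_map (nsphere n) Y f \<and> f sphere_base = x0 \<longrightarrow>
        homotopic_with (\<lambda>h. h sphere_base = x0) (nsphere n) Y f (\<lambda>_. x0))"

text \<open>By path-connectedness the choice of the base point is immaterial.\<close>

definition K_G_1 :: "'x topology \<Rightarrow> ('g, 'b) monoid_scheme \<Rightarrow> bool" where
  "K_G_1 Y G \<longleftrightarrow> path_connected_space Y \<and>
     (\<exists>x0\<in>topspace Y. fundamental_group Y x0 \<cong> G \<and> (\<forall>n\<ge>2. trivial_homotopy_group n Y x0))"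


section \<open>Hyperbolic groups\<close>

definition word_length :: "('g, 'b) monoid_scheme \<Rightarrow> 'g set \<Rightarrow> 'g \<Rightarrow> nat" where
  "word_length G S g = (LEAST n. \<exists>ws. length ws = n \<and> set ws \<subseteq> S \<union> m_inv G ` S \<and>
     foldr (\<lambda>x y. x \<otimes>\<^bsub>G\<^esub> y) ws \<one>\<^bsub>G\<^esub> = g)"

text \<open>The library locale \<^locale>\<open>Metric_space\<close> demands symmetry also outside the carrier, whence the
  default value.\<close>

definition word_metric :: "('g, 'b) monoid_scheme \<Rightarrow> 'g set \<Rightarrow> 'g \<Rightarrow> 'g \<Rightarrow> real" where
  "word_metric G S x y = (if x \<in> carrier G \<and> y \<in> carrier G
     then real (word_length G S (inv\<^bsub>G\<^esub> x \<otimes>\<^bsub>G\<^esub> y)) else 0)"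

definition Gromov_product :: "('a \<Rightarrow> 'a \<Rightarrow> real) \<Rightarrow> 'a \<Rightarrow> 'a \<Rightarrow> 'a \<Rightarrow> real" where
  "Gromov_product d w x y = (d x w + d y w - d x y) / 2"

definition Gromov_hyperbolic_space :: "'a set \<Rightarrow> ('a \<Rightarrow> 'a \<Rightarrow> real) \<Rightarrow> bool" where
  "Gromov_hyperbolic_space M d \<longleftrightarrow> Metric_space M d \<and>
     (\<exists>\<delta>\<ge>0. \<forall>x\<in>M. \<forall>y\<in>M. \<forall>z\<in>M. \<forall>w\<in>M.
        min (Gromov_product d w x y) (Gromov_product d w y z) - \<delta> \<le> Gromov_product d w x z)"

definition hyperbolic_group :: "('g, 'b) monoid_scheme \<Rightarrow> bool" where
  "hyperbolic_group G \<longleftrightarrow> group G \<and>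
     (\<exists>S\<subseteq>carrier G. finite S \<and> generate G S = carrier G \<and>
        Gromov_hyperbolic_space (carrier G) (word_metric G S))"


section \<open>Left modules\<close>

text \<open>The locale \<^locale>\<open>module\<close> requires a commutative ring of scalars.  The record type
  \<open>module\<close> extends that of rings; the fields \<open>mult\<close> and \<open>one\<close> of a module play no role.\<close>

locale left_module = A?: ring A + M?: abelian_group M for A (structure) and M (structure) +
  assumes smult_closed:
      "\<lbrakk>a \<in> carrier A; x \<in> carrier M\<rbrakk> \<Longrightarrow> a \<odot>\<^bsub>M\<^esub> x \<in> carrier M"
    and smult_l_distr:
      "\<lbrakk>a \<in> carrier A; b \<in> carrier A; x \<in> carrier M\<rbrakk> \<Longrightarrow>
        (a \<oplus> b) \<odot>\<^bsub>M\<^esub> x = a \<odot>\<^bsub>M\<^esub> x \<oplus>\<^bsub>M\<^esub> b \<odot>\<^bsub>M\<^esub> x"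
    and smult_r_distr:
      "\<lbrakk>a \<in> carrier A; x \<in> carrier M; y \<in> carrier M\<rbrakk> \<Longrightarrow>
        a \<odot>\<^bsub>M\<^esub> (x \<oplus>\<^bsub>M\<^esub> y) = a \<odot>\<^bsub>M\<^esub> x \<oplus>\<^bsub>M\<^esub> a \<odot>\<^bsub>M\<^esub> y"
    and smult_assoc:
      "\<lbrakk>a \<in> carrier A; b \<in> carrier A; x \<in> carrier M\<rbrakk> \<Longrightarrow>
        (a \<otimes> b) \<odot>\<^bsub>M\<^esub> x = a \<odot>\<^bsub>M\<^esub> (b \<odot>\<^bsub>M\<^esub> x)"
    and smult_one: "x \<in> carrier M \<Longrightarrow> \<one> \<odot>\<^bsub>M\<^esub> x = x"

definition left_module_hom ::
    "('a, 'c) ring_scheme \<Rightarrow> ('a, 'm) module \<Rightarrow> ('a, 'n) module \<Rightarrow> ('m \<Rightarrow> 'n) set" where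
  "left_module_hom A M N = {h \<in> carrier M \<rightarrow> carrier N.
     (\<forall>x\<in>carrier M. \<forall>y\<in>carrier M. h (x \<oplus>\<^bsub>M\<^esub> y) = h x \<oplus>\<^bsub>N\<^esub> h y) \<and>
     (\<forall>a\<in>carrier A. \<forall>x\<in>carrier M. h (a \<odot>\<^bsub>M\<^esub> x) = a \<odot>\<^bsub>N\<^esub> h x)}"

definition module_kernel :: "('a, 'm) module \<Rightarrow> ('a, 'n) module \<Rightarrow> ('m \<Rightarrow> 'n) \<Rightarrow> 'm set" where
  "module_kernel M N h = {x \<in> carrier M. h x = \<zero>\<^bsub>N\<^esub>}"

definition free_module :: "('a, 'c) ring_scheme \<Rightarrow> 'x set \<Rightarrow> ('a, 'x \<Rightarrow> 'a) module" where
  "free_module A B =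
     \<lparr>carrier = {c. (\<forall>x. c x \<in> carrier A) \<and> (\<forall>x. x \<notin> B \<longrightarrow> c x = \<zero>\<^bsub>A\<^esub>) \<and>
                   finite {x. c x \<noteq> \<zero>\<^bsub>A\<^esub>}},
      mult = undefined, one = undefined,
      zero = (\<lambda>_. \<zero>\<^bsub>A\<^esub>), add = (\<lambda>c e x. c x \<oplus>\<^bsub>A\<^esub> e x),
      smult = (\<lambda>a c x. a \<otimes>\<^bsub>A\<^esub> c x)\<rparr>"

text \<open>A module is projective if it is a direct summand of a free module.  Every module \<open>P\<close> is a
  quotient of the free module on its own carrier, so it suffices to allow bases
  consisting of elements of the type underlying \<open>P\<close>.\<close>

definition projective_module :: "('a, 'c) ring_scheme \<Rightarrow> ('a, 'm) module \<Rightarrow> bool" where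
  "projective_module A P \<longleftrightarrow> left_module A P \<and>
     (\<exists>(B :: 'm set) i p. i \<in> left_module_hom A P (free_module A B) \<and>
        p \<in> left_module_hom A (free_module A B) P \<and> (\<forall>x\<in>carrier P. p (i x) = x))"

definition lincomb :: "('a, 'c) ring_scheme \<Rightarrow> ('a, 'm) module \<Rightarrow> ('m \<Rightarrow> 'a) \<Rightarrow> 'm" where
  "lincomb A M c = (\<Oplus>\<^bsub>M\<^esub>x\<in>{x. c x \<noteq> \<zero>\<^bsub>A\<^esub>}. c x \<odot>\<^bsub>M\<^esub> x)"

definition free_basis :: "('a, 'c) ring_scheme \<Rightarrow> ('a, 'm) module \<Rightarrow> 'm set \<Rightarrow> bool" where
  "free_basis A M B \<longleftrightarrow> left_module A M \<and> B \<subseteq> carrier M \<and>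
     (\<forall>m\<in>carrier M. \<exists>!c. c \<in> carrier (free_module A B) \<and> lincomb A M c = m)"

definition coords :: "('a, 'c) ring_scheme \<Rightarrow> ('a, 'm) module \<Rightarrow> 'm set \<Rightarrow> 'm \<Rightarrow> 'm \<Rightarrow> 'a" where
  "coords A M B m = (THE c. c \<in> carrier (free_module A B) \<and> lincomb A M c = m)"


section \<open>Group rings and resolutions of the trivial module\<close>

text \<open>The ring of coefficients is a subring \<open>R\<close> of the complex numbers, with the restriction of the
  complex absolute value as its norm.  The function \<open>a\<close> stands for the formal sum
  \<open>\<Sum>g. a g \<cdot> g\<close>.\<close>

definition group_ring :: "complex set \<Rightarrow> ('g, 'b) monoid_scheme \<Rightarrow> ('g \<Rightarrow> complex) ring" where
  "group_ring R G =
     \<lparr>carrier = {a. (\<forall>g. a g \<in> R) \<and> (\<forall>g. g \<notin> carrier G \<longrightarrow> a g = 0) \<and> finite {g. a g \<noteq> 0}},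
      mult = (\<lambda>a b g. if g \<in> carrier G
                then \<Sum>h | a h \<noteq> 0. a h * b (inv\<^bsub>G\<^esub> h \<otimes>\<^bsub>G\<^esub> g) else 0),
      one = (\<lambda>g. if g = \<one>\<^bsub>G\<^esub> then 1 else 0),
      zero = (\<lambda>_. 0), add = (\<lambda>a b g. a g + b g)\<rparr>"

text \<open>Each group element acts trivially on \<open>R\<close>, so \<open>a\<close> acts as its augmentation.\<close>

definition trivial_module :: "complex set \<Rightarrow> ('g \<Rightarrow> complex, complex) module" where
  "trivial_module R =
     \<lparr>carrier = R, mult = undefined, one = undefined, zero = 0, add = (+),
      smult = (\<lambda>a x. (\<Sum>g | a g \<noteq> 0. a g) * x)\<rparr>"

text \<open>The resolution is \<open>\<dots> \<rightarrow> C 2 \<rightarrow> C 1 \<rightarrow> C 0 \<rightarrow> N \<rightarrow> 0\<close> with \<open>d (Suc k) : C (Suc k) \<rightarrow> C k\<close> and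
  augmentation \<open>\<epsilon> : C 0 \<rightarrow> N\<close>; \<open>d 0\<close> is not used.\<close>

definition projective_resolution ::
    "('a, 'c) ring_scheme \<Rightarrow> ('a, 'n) module \<Rightarrow> (nat \<Rightarrow> ('a, 'm) module) \<Rightarrow> (nat \<Rightarrow> 'm \<Rightarrow> 'm) \<Rightarrow>
     ('m \<Rightarrow> 'n) \<Rightarrow> bool" where
  "projective_resolution A N C d \<epsilon> \<longleftrightarrow>
     left_module A N \<and>
     (\<forall>k. projective_module A (C k)) \<and>
     (\<forall>k. d (Suc k) \<in> left_module_hom A (C (Suc k)) (C k)) \<and>
     \<epsilon> \<in> left_module_hom A (C 0) N \<and>
     \<epsilon> ` carrier (C 0) = carrier N \<and>
     d 1 ` carrier (C 1) = module_kernel (C 0) N \<epsilon> \<and>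
     (\<forall>k. d (Suc (Suc k)) ` carrier (C (Suc (Suc k))) =
          module_kernel (C (Suc k)) (C k) (d (Suc k)))"

definition one_admissible_resolution ::
    "complex set \<Rightarrow> ('g, 'b) monoid_scheme \<Rightarrow> (nat \<Rightarrow> ('g \<Rightarrow> complex, 'm) module) \<Rightarrow>
     (nat \<Rightarrow> 'm \<Rightarrow> 'm) \<Rightarrow> ('m \<Rightarrow> complex) \<Rightarrow> 'm set \<Rightarrow> 'm set \<Rightarrow> bool" where
  "one_admissible_resolution R G C d \<epsilon> \<Lambda>1 \<Lambda>2 \<longleftrightarrow>
     projective_resolution (group_ring R G) (trivial_module R) C d \<epsilon> \<and>
     finite \<Lambda>1 \<and> free_basis (group_ring R G) (C 1) \<Lambda>1 \<and>
     finite \<Lambda>2 \<and> free_basis (group_ring R G) (C 2) \<Lambda>2"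


section \<open>The homological isoperimetric function\<close>

text \<open>The \<open>R\<close>-basis \<open>\<Lambda> \<times> G\<close> of the free module consists of the elements \<open>g \<cdot> x\<close>; the coefficient
  of \<open>m\<close> at \<open>g \<cdot> x\<close> is the coefficient at \<open>g\<close> of its \<open>x\<close>-coordinate.\<close>

definition l1_norm ::
    "complex set \<Rightarrow> ('g, 'b) monoid_scheme \<Rightarrow> ('g \<Rightarrow> complex, 'm) module \<Rightarrow> 'm set \<Rightarrow> 'm \<Rightarrow> real"
  where
  "l1_norm R G M \<Lambda> m =
     (\<Sum>(x, g) \<in> {(x, g) \<in> \<Lambda> \<times> carrier G. coords (group_ring R G) M \<Lambda> m x g \<noteq> 0}.
        cmod (coords (group_ring R G) M \<Lambda> m x g))"

definition filling_norm ::
    "complex set \<Rightarrow> ('g, 'b) monoid_scheme \<Rightarrow> (nat \<Rightarrow> ('g \<Rightarrow> complex, 'm) module) \<Rightarrow>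
     (nat \<Rightarrow> 'm \<Rightarrow> 'm) \<Rightarrow> 'm set \<Rightarrow> 'm \<Rightarrow> real" where
  "filling_norm R G C d \<Lambda>2 b =
     Inf {l1_norm R G (C 2) \<Lambda>2 c | c. c \<in> carrier (C 2) \<and> d 2 c = b}"

definition isoperimetric_function ::
    "complex set \<Rightarrow> ('g, 'b) monoid_scheme \<Rightarrow> (nat \<Rightarrow> ('g \<Rightarrow> complex, 'm) module) \<Rightarrow>
     (nat \<Rightarrow> 'm \<Rightarrow> 'm) \<Rightarrow> 'm set \<Rightarrow> 'm set \<Rightarrow> real \<Rightarrow> ennreal" where
  "isoperimetric_function R G C d \<Lambda>1 \<Lambda>2 l =
     (SUP b \<in> {b \<in> d 2 ` carrier (C 2). l1_norm R G (C 1) \<Lambda>1 b \<le> l}.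
        ennreal (filling_norm R G C d \<Lambda>2 b))"

end

theory Submission
  imports Defs
begin

text \<open>As the coefficients contain the rationals, the filling norm is homogeneous, so that the
  isoperimetric function is finite iff it is bounded by a linear function.

  Linear filling implies hyperbolicity: lifting the augmentation to \<open>\<phi> : C 0 \<rightarrow> RG\<close> exhibits a finite
  generating set and, for functions \<open>f\<close> and \<open>k\<close> that are 1-Lipschitz for its word metric, a cochain
  \<open>f dk\<close> on \<open>C 1\<close> whose values on the boundaries \<open>d 2 (g \<cdot> z)\<close> of the translated basis elements are
  bounded uniformly in \<open>g\<close>, \<open>f\<close> and \<open>k\<close>.  Hence the integral of \<open>f dk\<close>
  along a closed walk is at most a constant times the length of the walk.  Let \<open>p\<close> be a point of a
  side of a geodesic triangle at the maximal distance \<open>T\<close> from the other two sides.  Truncating the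
  triangle near \<open>p\<close> gives a loop of length \<open>O(T)\<close> that, inside the ball of radius \<open>T\<close> about \<open>p\<close>, is a
  geodesic; with \<open>f = max 0 (T - dist p)\<close> and \<open>k\<close> the distance along the geodesic, the integral is of
  order \<open>T\<^sup>2\<close>, so \<open>T\<close> is bounded.

  Conversely, every cycle of \<open>C 1\<close> differs by a boundary of controlled norm from a flow on a Cayley
  graph.  A flow is a positive combination of closed walks without cancellation, and Dehn's
  algorithm, which is available by the four-point condition, fills a closed walk with linearly many
  loops of bounded length.\<close>

section \<open>Integral inequalities and thin triangles\<close>

text \<open>What forces thin triangles is a mismatch of orders. For 1-Lipschitz \<open>f\<close> and
  \<open>k\<close> the discrete 1-form \<open>f dk\<close> has a bounded differential, so a linear
  filling bounds its integral by the length of the loop, while following a geodesic through the ball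
  of radius \<open>T\<close> about \<open>p\<close> yields a quadratic amount. The maximality of
  \<open>T\<close> is used twice: \<open>p\<close> is far from the other sides, and all triangles of
  the same size are \<open>T\<close>-thin, which provides the return path of length
  \<open>O(T)\<close>.

  The resolution is arbitrary, and \<open>C0\<close> is only projective, so it contains no Cayley
  graph to work in. The comparison goes through \<open>phi\<close> towards the group ring, the base
  vertex \<open>e0\<close> back into \<open>C0\<close>, chains \<open>psi g\<close> joining
  \<open>e0\<close> to its translates, and a homotopy from the identity to
  \<open>m \<mapsto> phi m \<cdot> e0\<close>. Uniform constants always come from the finiteness of
  the bases of \<open>C1\<close> and \<open>C2\<close> together with invariance under translation.

  The rational case admits no limits. This is why cycles are decomposed by a finite procedure that
  only subtracts weights already in \<open>R\<close>, and why norms are scaled by rational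
  factors.\<close>

fun walk_integral :: "('a \<Rightarrow> 'b::comm_ring_1) \<Rightarrow> ('a \<Rightarrow> 'b) \<Rightarrow> 'a list \<Rightarrow> 'b" where
  "walk_integral f k (x # y # zs) = f x * (k y - k x) + walk_integral f k (y # zs)"
| "walk_integral f k _ = 0"

lemma walk_integral_append:
  "walk_integral f k (xs @ v # ys) = walk_integral f k (xs @ [v]) + walk_integral f k (v # ys)"
proof (induction xs)
  case (Cons x xs)
  then show ?case by (cases xs) auto
qed simp

lemma walk_integral_eq_0:
  "(\<And>x. x \<in> set xs \<Longrightarrow> f x = 0) \<Longrightarrow> walk_integral f k xs = 0"
  by (induction f k xs rule: walk_integral.induct) auto

lemma walk_integral_map_upt:
  "walk_integral f k (map \<alpha> [i..<Suc (i + n)]) = (\<Sum>j<n. f (\<alpha> (i + j)) * (k (\<alpha> (i + Suc j)) - k (\<alpha> (i + j))))"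
proof (induction n arbitrary: i)
  case (Suc n)
  have "map \<alpha> [i..<Suc (i + Suc n)] = \<alpha> i # \<alpha> (Suc i) # map \<alpha> [Suc (Suc i)..<Suc (Suc i + n)]"
    by (simp add: upt_conv_Cons del: upt_Suc)
  moreover have "map \<alpha> [Suc i..<Suc (Suc i + n)] = \<alpha> (Suc i) # map \<alpha> [Suc (Suc i)..<Suc (Suc i + n)]"
    by (simp add: upt_conv_Cons del: upt_Suc)
  ultimately have "walk_integral f k (map \<alpha> [i..<Suc (i + Suc n)]) =
      f (\<alpha> i) * (k (\<alpha> (Suc i)) - k (\<alpha> i)) + walk_integral f k (map \<alpha> [Suc i..<Suc (Suc i + n)])"
    by simp
  also have "\<dots> = (\<Sum>j<Suc n. f (\<alpha> (i + j)) * (k (\<alpha> (i + Suc j)) - k (\<alpha> (i + j))))"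
    unfolding Suc.IH by (subst sum.lessThan_Suc_shift) simp
  finally show ?case .
qed simp

lemma walk_integral_of_real:
  "walk_integral (\<lambda>x. of_real (f x) :: complex) (\<lambda>x. of_real (k x)) xs = of_real (walk_integral f k xs)"
  by (induction f k xs rule: walk_integral.induct) auto

text \<open>Summation by parts: the integral of \<open>f de\<close> and an integral of
  \<open>e df\<close> add up to a telescoping sum, and each edge contributes at most
  \<open>U\<close> to the latter. On a closed walk the end terms cancel, so changing
  \<open>k\<close> by a bounded function changes the integral of \<open>f dk\<close> by at most a
  multiple of the length.\<close>

lemma walk_integral_by_parts:
  fixes f e :: "'a \<Rightarrow> complex"
  assumes "xs \<noteq> []" "successively (\<lambda>x y. cmod (f y - f x) \<le> 1) xs"
    and "\<And>x. x \<in> set xs \<Longrightarrow> cmod (e x) \<le> U" and "U \<ge> 0"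
  shows "cmod (walk_integral f e xs - (f (last xs) * e (last xs) - f (hd xs) * e (hd xs))) \<le> U * real (length xs)"
  using assms
proof (induction f e xs rule: walk_integral.induct)
  case (1 f e x y zs)
  have "walk_integral f e (x # y # zs) - (f (last (x # y # zs)) * e (last (x # y # zs)) - f x * e x)
     = (walk_integral f e (y # zs) - (f (last (y # zs)) * e (last (y # zs)) - f y * e y)) - (f y - f x) * e y"
    by (simp add: algebra_simps)
  also have "cmod \<dots> \<le> cmod (walk_integral f e (y # zs) - (f (last (y # zs)) * e (last (y # zs)) - f y * e y)) +
      cmod ((f y - f x) * e y)" by (rule norm_triangle_ineq4)
  also have "cmod (walk_integral f e (y # zs) - (f (last (y # zs)) * e (last (y # zs)) - f y * e y))
      \<le> U * real (length (y # zs))"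
    using 1 by simp
  also have "cmod ((f y - f x) * e y) \<le> 1 * U"
    unfolding norm_mult using 1 by (intro mult_mono) auto
  finally show ?case by (simp add: algebra_simps)
qed auto

section \<open>Graph metrics: geodesic segments, short connections inside a set, thin
  triangles\<close>

locale graph_metric =
  fixes V :: "'a set" and d :: "'a \<Rightarrow> 'a \<Rightarrow> nat"
  assumes d_eq_0: "\<lbrakk>x \<in> V; y \<in> V\<rbrakk> \<Longrightarrow> d x y = 0 \<longleftrightarrow> x = y"
    and d_sym: "\<lbrakk>x \<in> V; y \<in> V\<rbrakk> \<Longrightarrow> d x y = d y x"
    and d_triangle: "\<lbrakk>x \<in> V; y \<in> V; z \<in> V\<rbrakk> \<Longrightarrow> d x z \<le> d x y + d y z"
    and geodesic_exists: "\<lbrakk>x \<in> V; y \<in> V\<rbrakk> \<Longrightarrow> \<exists>\<gamma>. \<gamma> 0 = x \<and> \<gamma> (d x y) = y \<and>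
          (\<forall>i\<le>d x y. \<gamma> i \<in> V) \<and> (\<forall>i j. i \<le> j \<and> j \<le> d x y \<longrightarrow> d (\<gamma> i) (\<gamma> j) = j - i)"
begin

definition seg :: "(nat \<Rightarrow> 'a) \<Rightarrow> 'a \<Rightarrow> 'a \<Rightarrow> bool" where
  "seg \<gamma> x y \<longleftrightarrow> \<gamma> 0 = x \<and> \<gamma> (d x y) = y \<and> (\<forall>i\<le>d x y. \<gamma> i \<in> V) \<and>
     (\<forall>i j. i \<le> j \<and> j \<le> d x y \<longrightarrow> d (\<gamma> i) (\<gamma> j) = j - i)"

text \<open>The number of steps is recorded because the loop fed into the integral estimate has to
  be short. Steps of length 0 are allowed, which spares case distinctions.\<close>

definition conn :: "'a set \<Rightarrow> nat \<Rightarrow> 'a \<Rightarrow> 'a \<Rightarrow> bool" where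
  "conn Z n x y \<longleftrightarrow> (\<exists>xs. xs \<noteq> [] \<and> hd xs = x \<and> last xs = y \<and> set xs \<subseteq> Z \<and>
     successively (\<lambda>u v. d u v \<le> 1) xs \<and> length xs \<le> Suc n)"

definition closed_walk :: "'a list \<Rightarrow> bool" where
  "closed_walk xs \<longleftrightarrow> xs \<noteq> [] \<and> hd xs = last xs \<and> set xs \<subseteq> V \<and> successively (\<lambda>u v. d u v \<le> 1) xs"

text \<open>The bound \<open>N\<close> on the perimeter guarantees that some \<open>T\<close> works,
  namely \<open>N\<close> itself, so that a least one exists; the point is to bound it independently
  of \<open>N\<close>. Both \<open>\<beta>\<close> and \<open>\<gamma>\<close> start at the vertex
  \<open>z\<close> opposite the tested side \<open>\<alpha>\<close>, so each of their points is the
  end of a geodesic from \<open>z\<close>.\<close>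

definition thin :: "nat \<Rightarrow> nat \<Rightarrow> bool" where
  "thin N T \<longleftrightarrow> (\<forall>x y z \<alpha> \<beta> \<gamma>. seg \<alpha> x y \<and> seg \<beta> z x \<and> seg \<gamma> z y \<and> d x y + d z x + d z y \<le> N \<longrightarrow>
     (\<forall>i\<le>d x y. \<exists>q \<in> \<beta> ` {..d z x} \<union> \<gamma> ` {..d z y}. d (\<alpha> i) q \<le> T))"

lemma thinD:
  "\<lbrakk>thin N T; seg \<alpha> x y; seg \<beta> z x; seg \<gamma> z y; d x y + d z x + d z y \<le> N; i \<le> d x y\<rbrakk> \<Longrightarrow>
     \<exists>q \<in> \<beta> ` {..d z x} \<union> \<gamma> ` {..d z y}. d (\<alpha> i) q \<le> T"
  unfolding thin_def by blast

lemma seg_exists: "\<lbrakk>x \<in> V; y \<in> V\<rbrakk> \<Longrightarrow> \<exists>\<gamma>. seg \<gamma> x y"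
  unfolding seg_def by (rule geodesic_exists)

lemma seg_in: "seg \<gamma> x y \<Longrightarrow> i \<le> d x y \<Longrightarrow> \<gamma> i \<in> V"
  by (auto simp: seg_def)

lemma seg_0: "seg \<gamma> x y \<Longrightarrow> \<gamma> 0 = x" and seg_end: "seg \<gamma> x y \<Longrightarrow> \<gamma> (d x y) = y"
  by (auto simp: seg_def)

lemma seg_ends: assumes "seg \<gamma> x y" shows "x \<in> V" "y \<in> V"
  using assms seg_in[OF assms, of 0] seg_in[OF assms, of "d x y"] by (auto simp: seg_def)

lemma seg_dist: "seg \<gamma> x y \<Longrightarrow> i \<le> j \<Longrightarrow> j \<le> d x y \<Longrightarrow> d (\<gamma> i) (\<gamma> j) = j - i"
  by (auto simp: seg_def)

lemma seg_dist': "seg \<gamma> x y \<Longrightarrow> i \<le> j \<Longrightarrow> j \<le> d x y \<Longrightarrow> d (\<gamma> j) (\<gamma> i) = j - i"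
  using seg_dist[of \<gamma> x y i j] d_sym[of "\<gamma> i" "\<gamma> j"] seg_in[of \<gamma> x y] by auto

lemma seg_prefix: "seg \<gamma> x y \<Longrightarrow> i \<le> d x y \<Longrightarrow> seg \<gamma> x (\<gamma> i)"
  using seg_dist[of \<gamma> x y 0 i] by (auto simp: seg_def)

lemma seg_rev: assumes "seg \<gamma> x y" shows "seg (\<lambda>i. \<gamma> (d x y - i)) y x"
proof -
  have "d y x = d x y" using d_sym seg_ends[OF assms] by blast
  moreover have "d (\<gamma> (d x y - i)) (\<gamma> (d x y - j)) = j - i" if "i \<le> j" "j \<le> d x y" for i j
    using seg_dist'[OF assms, of "d x y - j" "d x y - i"] that by simp
  ultimately show ?thesis using assms by (auto simp: seg_def)
qed

lemma conn_trans:
  assumes "conn Z n x y" "conn Z m y w" shows "conn Z (n + m) x w"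
proof -
  obtain xs where xs: "xs \<noteq> []" "hd xs = x" "last xs = y" "set xs \<subseteq> Z"
     "successively (\<lambda>u v. d u v \<le> 1) xs" "length xs \<le> Suc n"
    using assms(1) unfolding conn_def by blast
  obtain ys where ys: "ys \<noteq> []" "hd ys = y" "last ys = w" "set ys \<subseteq> Z"
     "successively (\<lambda>u v. d u v \<le> 1) ys" "length ys \<le> Suc m"
    using assms(2) unfolding conn_def by blast
  obtain zs where zs: "ys = y # zs" using ys by (cases ys) auto
  have "successively (\<lambda>u v. d u v \<le> 1) (xs @ zs)"
    using xs ys zs by (cases zs) (auto simp: successively_append_iff)
  moreover have "last (xs @ zs) = w" using xs ys zs by (cases zs) auto
  ultimately show ?thesis unfolding conn_def
    using xs ys zs by (intro exI[of _ "xs @ zs"]) auto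
qed

lemma conn_sym:
  assumes "conn Z n x y" "Z \<subseteq> V" shows "conn Z n y x"
proof -
  obtain xs where xs: "xs \<noteq> []" "hd xs = x" "last xs = y" "set xs \<subseteq> Z"
     "successively (\<lambda>u v. d u v \<le> 1) xs" "length xs \<le> Suc n"
    using assms(1) unfolding conn_def by blast
  have "successively (\<lambda>u v. d u v \<le> 1) (rev xs)"
    using xs(5) unfolding successively_rev
    by (rule successively_mono) (use xs(4) assms(2) d_sym in \<open>metis subsetD\<close>)
  then show ?thesis unfolding conn_def
    using xs by (intro exI[of _ "rev xs"]) (auto simp: hd_rev last_rev)
qed

lemma conn_mono: "conn Z n x y \<Longrightarrow> n \<le> m \<Longrightarrow> conn Z m x y"
  unfolding conn_def using le_trans[of _ "Suc n" "Suc m"] Suc_le_mono by blast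

lemma conn_refl: "x \<in> Z \<Longrightarrow> conn Z n x x"
  unfolding conn_def by (intro exI[of _ "[x]"]) auto

lemma successively_seg:
  assumes "seg \<gamma> x y" "i \<le> j" "j \<le> d x y"
  shows "successively (\<lambda>u v. d u v \<le> 1) (map \<gamma> [i..<Suc j])"
  unfolding successively_map successively_conv_nth
  using assms seg_dist[OF assms(1)] by (auto simp del: upt_Suc)

lemma seg_conn:
  assumes "seg \<gamma> x y" "i \<le> j" "j \<le> d x y" "\<And>l. i \<le> l \<Longrightarrow> l \<le> j \<Longrightarrow> \<gamma> l \<in> Z"
  shows "conn Z (j - i) (\<gamma> i) (\<gamma> j)"
  unfolding conn_def
proof (intro exI[of _ "map \<gamma> [i..<Suc j]"] conjI)
  show "successively (\<lambda>u v. d u v \<le> 1) (map \<gamma> [i..<Suc j])"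
    using successively_seg assms by blast
  show "hd (map \<gamma> [i..<Suc j]) = \<gamma> i" using assms(2) by (simp add: hd_map del: upt_Suc)
  show "set (map \<gamma> [i..<Suc j]) \<subseteq> Z" using assms by (auto simp del: upt_Suc)
  show "length (map \<gamma> [i..<Suc j]) \<le> Suc (j - i)" by simp
qed (use assms in auto)

lemma geodesic_conn:
  assumes "a \<in> V" "b \<in> V" "\<And>q. q \<in> V \<Longrightarrow> d a q \<le> d a b \<Longrightarrow> q \<in> Z"
  shows "conn Z (d a b) a b"
proof -
  obtain \<gamma> where g: "seg \<gamma> a b" using seg_exists assms by blast
  have "\<gamma> l \<in> Z" if "l \<le> d a b" for l
  proof (rule assms(3))
    show "\<gamma> l \<in> V" using seg_in g that by blast
    show "d a (\<gamma> l) \<le> d a b" using seg_dist[OF g, of 0 l] seg_0[OF g] that by simp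
  qed
  then show ?thesis using seg_conn[OF g, of 0 "d a b" Z] seg_0[OF g] seg_end[OF g] by simp
qed

text \<open>The path leaves the first geodesic \<open>30 T\<close> before its end, where thinness provides a nearby
  point of the second one that is far away from \<open>a\<close> and \<open>b\<close>.\<close>

lemma bridge:
  assumes thin: "thin N T" and T: "T > 0"
    and \<sigma>: "seg \<sigma> z a" and \<tau>: "seg \<tau> z b"
    and per: "d z a + d z b + d a b \<le> N" and ab: "d a b \<le> 8 * T"
    and \<sigma>Z: "\<And>i. i \<le> d z a \<Longrightarrow> \<sigma> i \<in> Z" and \<tau>Z: "\<And>i. i \<le> d z b \<Longrightarrow> \<tau> i \<in> Z"
    and far: "\<And>q. q \<in> V \<Longrightarrow> d a q \<ge> 29 * T \<Longrightarrow> q \<in> Z" and Z: "Z \<subseteq> V"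
  shows "conn Z (70 * T) a b"
proof -
  note V = seg_ends[OF \<sigma>] seg_ends[OF \<tau>]
  \<comment> \<open>Truncated subtraction: if \<open>\<sigma>\<close> is shorter than
    \<open>30 * T\<close>, then \<open>s = 0\<close> and the path passes through
    \<open>z\<close>.\<close>
  define s where "s = d z a - 30 * T"
  have 1: "conn Z (30 * T) a (\<sigma> s)"
    using conn_mono[OF conn_sym[OF seg_conn[OF \<sigma>, of s "d z a" Z] Z], of "30 * T"] seg_end[OF \<sigma>] \<sigma>Z
    by (auto simp: s_def)
  obtain j where j: "j \<le> d z b" "conn Z T (\<sigma> s) (\<tau> j)" "d (\<sigma> s) (\<tau> j) \<le> T"
  proof (cases "d z a \<le> 30 * T")
    case True
    then have "\<sigma> s = \<tau> 0" "s = 0" using seg_0[OF \<sigma>] seg_0[OF \<tau>] by (auto simp: s_def)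
    then show ?thesis using that[of 0] conn_refl[of "\<sigma> s" Z] \<sigma>Z[of s] d_eq_0[OF V(1) V(1)] seg_0[OF \<tau>] by auto
  next
    case False
    have s: "s \<le> d z a" "d (\<sigma> s) a = 30 * T"
      using False seg_dist[OF \<sigma>, of s "d z a"] seg_end[OF \<sigma>] by (auto simp: s_def)
    have sV: "\<sigma> s \<in> V" using seg_in[OF \<sigma>] s by blast
    obtain \<gamma> where g: "seg \<gamma> b a" using seg_exists V by blast
    have eq: "d b z = d z b" "d b a = d a b" using d_sym V by auto
    \<comment> \<open>Here \<open>\<sigma>\<close> is the tested side and \<open>b\<close> the
      opposite vertex, so \<open>\<tau>\<close> has to run backwards.\<close>
    have "\<exists>q \<in> (\<lambda>i. \<tau> (d z b - i)) ` {..d b z} \<union> \<gamma> ` {..d b a}. d (\<sigma> s) q \<le> T"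
      using thin[unfolded thin_def, rule_format, OF _ s(1), OF conjI, OF \<sigma> conjI, OF seg_rev[OF \<tau>] conjI, OF g]
        per eq by simp
    then consider i where "i \<le> d z b" "d (\<sigma> s) (\<tau> i) \<le> T" | i where "i \<le> d b a" "d (\<sigma> s) (\<gamma> i) \<le> T"
      using eq by (auto intro: diff_le_self)
    then show ?thesis
    proof cases
      case (1 i)
      have tV: "\<tau> i \<in> V" using seg_in[OF \<tau>] 1 by blast
      \<comment> \<open>This geodesic has length at most \<open>T\<close> and starts at distance
        \<open>30 * T\<close> from \<open>a\<close>, so it keeps distance \<open>29 * T\<close> from
        \<open>a\<close>.\<close>
      have "conn Z (d (\<sigma> s) (\<tau> i)) (\<sigma> s) (\<tau> i)"
      proof (rule geodesic_conn[OF sV tV])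
        fix q assume q: "q \<in> V" "d (\<sigma> s) q \<le> d (\<sigma> s) (\<tau> i)"
        have "30 * T \<le> d (\<sigma> s) q + d q a" using s d_triangle[OF sV q(1) V(2)] by simp
        then have "29 * T \<le> d a q" using q 1 d_sym[OF q(1) V(2)] by linarith
        then show "q \<in> Z" using far q by blast
      qed
      then show ?thesis using that[of i] 1 conn_mono by blast
    next
      case (2 i)
      \<comment> \<open>The nearby point cannot lie on the short side: \<open>\<gamma>\<close> stays
        within \<open>8 * T\<close> of \<open>a\<close>, whereas \<open>\<sigma> s\<close> is
        \<open>30 * T\<close> away.\<close>
      have gV: "\<gamma> i \<in> V" using seg_in[OF g] 2 by blast
      have "d (\<gamma> i) a \<le> 8 * T" using seg_dist[OF g, of i "d b a"] seg_end[OF g] 2 eq ab by simp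
      then have "d (\<sigma> s) a \<le> T + 8 * T" using d_triangle[OF sV gV V(2)] 2 by linarith
      then show ?thesis using s T by simp
    qed
  qed
  have sV: "\<sigma> s \<in> V" "\<tau> j \<in> V" using seg_in[OF \<sigma>, of s] seg_in[OF \<tau>] j by (auto simp: s_def)
  have das: "d a (\<sigma> s) \<le> 30 * T" using seg_dist'[OF \<sigma>, of s "d z a"] seg_end[OF \<sigma>] by (auto simp: s_def)
  \<comment> \<open>The way from \<open>\<tau> j\<close> to \<open>b\<close> via
    \<open>\<sigma> s\<close> and \<open>a\<close> gives \<open>1 + 30 + 8 = 39\<close>; the three
    pieces of the path then add up to \<open>30 + 1 + 39 = 70\<close>.\<close>
  have "d (\<tau> j) b \<le> d (\<tau> j) (\<sigma> s) + d (\<sigma> s) a + d a b"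
    using d_triangle[of "\<tau> j" "\<sigma> s" b] d_triangle[of "\<sigma> s" a b] sV V by force
  also have "\<dots> \<le> T + 30 * T + 8 * T" using das d_sym sV V j(3) ab by (metis add_mono)
  finally have "d z b - j \<le> 39 * T" using seg_dist[OF \<tau>, of j "d z b"] seg_end[OF \<tau>] j by simp
  then have "conn Z (39 * T) (\<tau> j) b"
    using conn_mono[OF seg_conn[OF \<tau>, of j "d z b" Z]] seg_end[OF \<tau>] \<tau>Z j by auto
  from conn_trans[OF conn_trans[OF 1 j(2)] this] show ?thesis by (rule conn_mono) simp
qed


section \<open>Lipschitz functions, the integral estimate, and the four-point condition\<close>

definition lip :: "('a \<Rightarrow> real) \<Rightarrow> bool" where
  "lip f \<longleftrightarrow> (\<forall>x\<in>V. \<forall>y\<in>V. \<bar>f x - f y\<bar> \<le> real (d x y))"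

lemma lip_dist: assumes "p \<in> V" shows "lip (\<lambda>x. real (d p x))"
proof -
  have "\<bar>real (d p x) - real (d p y)\<bar> \<le> real (d x y)" if "x \<in> V" "y \<in> V" for x y
    using d_triangle[OF assms that] d_triangle[OF assms that(2,1)] d_sym[OF that] by linarith
  then show ?thesis by (auto simp: lip_def)
qed

lemma lip_bump: assumes "p \<in> V" shows "lip (\<lambda>x. max 0 (real T - real (d p x)))"
proof -
  have "\<bar>max 0 (real T - real (d p x)) - max 0 (real T - real (d p y))\<bar> \<le> real (d x y)"
    if "x \<in> V" "y \<in> V" for x y
    using lip_dist[OF assms] that unfolding lip_def by (smt (verit))
  then show ?thesis by (auto simp: lip_def)
qed

text \<open>A loop through \<open>p\<close> that is geodesic near \<open>p\<close> has a large integral of a bump function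
  around \<open>p\<close> against the distance along the geodesic.\<close>

lemma loop_length_bound:
  assumes star: "\<And>f k xs. lip f \<Longrightarrow> lip k \<Longrightarrow> closed_walk xs \<Longrightarrow> \<bar>walk_integral f k xs\<bar> \<le> K * real (length xs)"
    and K: "K \<ge> 0"
    and \<alpha>: "seg \<alpha> x y" and i: "i0 + T \<le> i" "i \<le> i1" "i1 \<le> d x y"
    and conn: "conn {q \<in> V. d (\<alpha> i) q \<ge> T} n (\<alpha> i1) (\<alpha> i0)"
  shows "real T * real T - real T \<le> 2 * K * real (i1 - i0 + n + 1)"
proof -
  let ?p = "\<alpha> i"
  define f where "f = (\<lambda>q. max 0 (real T - real (d ?p q)))"
  define k where "k = (\<lambda>q. real (d (\<alpha> i0) q))"
  have pV: "?p \<in> V" "\<alpha> i0 \<in> V" using seg_in[OF \<alpha>] i by auto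
  obtain ys where ys: "ys \<noteq> []" "hd ys = \<alpha> i1" "last ys = \<alpha> i0" "set ys \<subseteq> {q \<in> V. d ?p q \<ge> T}"
     "successively (\<lambda>u v. d u v \<le> 1) ys" "length ys \<le> Suc n"
    using conn unfolding conn_def by blast
  obtain zs where zs: "ys = \<alpha> i1 # zs" using ys by (cases ys) auto
  define xs where "xs = map \<alpha> [i0..<i1]"
  have le: "i0 \<le> i1" using i by simp
  have xs1: "xs @ [\<alpha> i1] = map \<alpha> [i0..<Suc i1]" using le by (simp add: xs_def)
  have "closed_walk (xs @ ys)"
  proof -
    have "successively (\<lambda>u v. d u v \<le> 1) (xs @ [\<alpha> i1])"
      unfolding xs1 using successively_seg[OF \<alpha> le i(3)] .
    then have "successively (\<lambda>u v. d u v \<le> 1) (xs @ ys)"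
      using ys zs by (cases "xs = []") (auto simp: successively_append_iff)
    moreover have "hd (xs @ ys) = \<alpha> i0"
      using le ys by (cases "i0 = i1") (auto simp: xs_def hd_map)
    moreover have "set xs \<subseteq> V" using seg_in[OF \<alpha>] i by (auto simp: xs_def)
    ultimately show ?thesis using ys by (auto simp: closed_walk_def)
  qed
  then have "\<bar>walk_integral f k (xs @ ys)\<bar> \<le> K * real (length (xs @ ys))"
    unfolding f_def k_def by (rule star[OF lip_bump[OF pV(1)] lip_dist[OF pV(2)]])
  also have "\<dots> \<le> K * real (i1 - i0 + n + 1)"
    using K ys(6) by (intro mult_left_mono) (auto simp: xs_def)
  finally have upper: "walk_integral f k (xs @ ys) \<le> K * real (i1 - i0 + n + 1)" by simp
  \<comment> \<open>The bump \<open>f\<close> vanishes outside the ball of radius \<open>T\<close>,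
    so the return path contributes nothing.\<close>
  have "walk_integral f k ys = 0"
    using ys(4) by (intro walk_integral_eq_0) (auto simp: f_def)
  then have "walk_integral f k (xs @ ys) = walk_integral f k (xs @ [\<alpha> i1])"
    unfolding zs by (subst walk_integral_append) (use zs in simp)
  also have "\<dots> = (\<Sum>j<i1 - i0. f (\<alpha> (i0 + j)) * (k (\<alpha> (i0 + Suc j)) - k (\<alpha> (i0 + j))))"
    unfolding xs1 using walk_integral_map_upt[of f k \<alpha> i0 "i1 - i0"] le by simp
  \<comment> \<open>Along the geodesic the distance \<open>k\<close> from its starting point grows
    by exactly 1 at each step.\<close>
  also have "\<dots> = (\<Sum>j<i1 - i0. f (\<alpha> (i0 + j)))"
    using seg_dist[OF \<alpha>] i le by (intro sum.cong) (auto simp: k_def)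
  \<comment> \<open>The \<open>T\<close> steps before \<open>?p\<close> suffice: there
    \<open>f\<close> takes the values 0, ..., \<open>T - 1\<close>, whose sum is already quadratic
    in \<open>T\<close>.\<close>
  also have "\<dots> \<ge> (\<Sum>j\<in>{i - i0 - T..<i - i0}. f (\<alpha> (i0 + j)))"
    using i by (intro sum_mono2) (auto simp: f_def)
  also have "(\<Sum>j\<in>{i - i0 - T..<i - i0}. f (\<alpha> (i0 + j))) = (\<Sum>j\<in>{i - i0 - T..<i - i0}. real (j - (i - i0 - T)))"
  proof (intro sum.cong refl)
    fix j assume j: "j \<in> {i - i0 - T..<i - i0}"
    then have "d ?p (\<alpha> (i0 + j)) = i - (i0 + j)" using seg_dist'[OF \<alpha>, of "i0 + j" i] i by auto
    then show "f (\<alpha> (i0 + j)) = real (j - (i - i0 - T))" using j i by (auto simp: f_def)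
  qed
  also have "\<dots> = (\<Sum>j<T. real j)"
    using i by (intro sum.reindex_bij_witness[of _ "\<lambda>j. j + (i - i0 - T)" "\<lambda>j. j - (i - i0 - T)"]) auto
  finally have lower: "(\<Sum>j<T. real j) \<le> walk_integral f k (xs @ ys)" .
  have "2 * (\<Sum>j<T. real j) = real T * real T - real T"
    by (induction T) (auto simp: algebra_simps)
  then show ?thesis using lower upper by linarith
qed


text \<open>\<open>T\<close> is the exact thinness constant at perimeter \<open>N\<close>. Some
  \<open>p = \<alpha> i\<close> has distance at least \<open>T\<close> from the two other sides, and
  at the same time every point of a side of a triangle of perimeter at most \<open>N\<close> is
  within \<open>T\<close> of the other two. The latter fact supplies the shortcuts for closing up
  the piece of \<open>\<alpha>\<close> around \<open>p\<close> by a return path outside the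
  ball.\<close>

lemma thin_defect_bound:
  assumes star: "\<And>f k xs. lip f \<Longrightarrow> lip k \<Longrightarrow> closed_walk xs \<Longrightarrow> \<bar>walk_integral f k xs\<bar> \<le> K * real (length xs)"
    and K: "K \<ge> 0" and thin: "thin N T" and not_thin: "\<not> thin N (T - 1)" and T: "T > 0"
  shows "real T \<le> 160 * K + 1"
proof -
  obtain x y z \<alpha> \<beta> \<gamma> i where \<alpha>: "seg \<alpha> x y" and \<beta>: "seg \<beta> z x" and \<gamma>: "seg \<gamma> z y"
    and per: "d x y + d z x + d z y \<le> N" and i: "i \<le> d x y"
    and notle: "\<forall>q \<in> \<beta> ` {..d z x} \<union> \<gamma> ` {..d z y}. \<not> d (\<alpha> i) q \<le> T - 1"
    using not_thin unfolding thin_def by blast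
  have far: "d (\<alpha> i) q \<ge> T" if "q \<in> \<beta> ` {..d z x} \<union> \<gamma> ` {..d z y}" for q
    using bspec[OF notle that] T by linarith
  let ?p = "\<alpha> i" and ?B = "\<beta> ` {..d z x} \<union> \<gamma> ` {..d z y}"
  define Z where "Z = {q \<in> V. d ?p q \<ge> T}"
  note V = seg_ends[OF \<alpha>] seg_ends(1)[OF \<beta>]
  have pV: "?p \<in> V" using seg_in[OF \<alpha> i] .
  have BV: "?B \<subseteq> V" using seg_in[OF \<beta>] seg_in[OF \<gamma>] by auto
  then have BZ: "?B \<subseteq> Z" using far by (auto simp: Z_def)
  have xB: "x \<in> ?B" using seg_end[OF \<beta>] by force
  have yB: "y \<in> ?B" using seg_end[OF \<gamma>] by force
  have "T \<le> i" using far[OF xB] seg_dist'[OF \<alpha>, of 0 i] seg_0[OF \<alpha>] i by simp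
  have "T \<le> d x y - i" using far[OF yB] seg_dist[OF \<alpha>, of i "d x y"] seg_end[OF \<alpha>] i by simp
  \<comment> \<open>An end of the piece is either at distance \<open>3 * T\<close> from
    \<open>?p\<close>, and then a geodesic of length at most \<open>T\<close> to another side keeps
    distance \<open>2 * T\<close>; or the side \<open>\<alpha>\<close> stops earlier, at a vertex
    that already lies on another side.\<close>
  have detour: "\<exists>b\<in>?B. conn Z T (\<alpha> j) b \<and> d ?p b \<le> 4 * T"
    if j: "j \<le> d x y" and "d ?p (\<alpha> j) = 3 * T \<or> d ?p (\<alpha> j) \<le> 3 * T \<and> \<alpha> j \<in> ?B" for j
  proof (cases "\<alpha> j \<in> ?B")
    case True
    then show ?thesis using conn_refl[of "\<alpha> j" Z T] BZ that(2) by (intro bexI[of _ "\<alpha> j"]) auto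
  next
    case False
    then have pj: "d ?p (\<alpha> j) = 3 * T" using that by blast
    have jV: "\<alpha> j \<in> V" using seg_in[OF \<alpha> j] .
    obtain b where b: "b \<in> ?B" "d (\<alpha> j) b \<le> T"
      using thinD[OF thin \<alpha> \<beta> \<gamma> per j] by blast
    have bV: "b \<in> V" using b BV by blast
    have "conn Z (d (\<alpha> j) b) (\<alpha> j) b"
    proof (rule geodesic_conn[OF jV bV])
      fix q assume q: "q \<in> V" "d (\<alpha> j) q \<le> d (\<alpha> j) b"
      have "3 * T \<le> d ?p q + d q (\<alpha> j)" using d_triangle[OF pV q(1) jV] pj by simp
      then show "q \<in> Z" using q b d_sym[OF q(1) jV] T by (auto simp: Z_def)
    qed
    moreover have "d ?p b \<le> 4 * T" using d_triangle[OF pV jV bV] pj b by linarith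
    ultimately show ?thesis using b conn_mono by blast
  qed
  define i0 where "i0 = i - 3 * T"
  define i1 where "i1 = min (d x y) (i + 3 * T)"
  have i01: "i0 + T \<le> i" "i \<le> i1" "i1 \<le> d x y" "i1 - i0 \<le> 6 * T"
    using T i \<open>T \<le> i\<close> by (auto simp: i0_def i1_def)
  have near0: "d ?p (\<alpha> i0) = 3 * T \<or> d ?p (\<alpha> i0) \<le> 3 * T \<and> \<alpha> i0 \<in> ?B"
  proof (cases "3 * T \<le> i")
    case True then show ?thesis using seg_dist'[OF \<alpha>, of i0 i] i by (simp add: i0_def)
  next
    case False
    then have "\<alpha> i0 = x" using seg_0[OF \<alpha>] by (simp add: i0_def)
    then show ?thesis using xB False seg_dist'[OF \<alpha>, of 0 i] i seg_0[OF \<alpha>] by simp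
  qed
  have "i0 \<le> d x y" using i01 by linarith
  then obtain a where a: "a \<in> ?B" "conn Z T (\<alpha> i0) a" "d ?p a \<le> 4 * T" using detour[OF _ near0] by blast
  have near1: "d ?p (\<alpha> i1) = 3 * T \<or> d ?p (\<alpha> i1) \<le> 3 * T \<and> \<alpha> i1 \<in> ?B"
  proof (cases "i + 3 * T \<le> d x y")
    case True then show ?thesis using seg_dist[OF \<alpha>, of i i1] by (simp add: i1_def)
  next
    case False
    then have "\<alpha> i1 = y" using seg_end[OF \<alpha>] by (simp add: i1_def)
    then show ?thesis using yB False seg_dist[OF \<alpha>, of i "d x y"] i seg_end[OF \<alpha>] by (simp; linarith)
  qed
  obtain b where b: "b \<in> ?B" "conn Z T (\<alpha> i1) b" "d ?p b \<le> 4 * T" using detour[OF i01(3) near1] by blast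
  have abV: "a \<in> V" "b \<in> V" using a b BV by auto
  have ab: "d a b \<le> 8 * T" using d_triangle[of a ?p b] d_sym[of a ?p] abV pV a b by simp
  \<comment> \<open>Initial pieces of \<open>\<beta>\<close> and \<open>\<gamma>\<close> join
    \<open>z\<close> to \<open>a\<close> and to \<open>b\<close>; they are the two long sides of the
    narrow triangle to which \<open>bridge\<close> is applied.\<close>
  have branch: "\<exists>\<sigma>. seg \<sigma> z c \<and> \<sigma> ` {..d z c} \<subseteq> ?B" if "c \<in> ?B" for c
    using that
  proof
    assume "c \<in> \<beta> ` {..d z x}"
    then obtain l where l: "l \<le> d z x" "c = \<beta> l" by auto
    then have "d z c \<le> d z x" using seg_dist[OF \<beta>, of 0 l] seg_0[OF \<beta>] by simp
    then show ?thesis using seg_prefix[OF \<beta> l(1)] l by (intro exI[of _ \<beta>]) auto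
  next
    assume "c \<in> \<gamma> ` {..d z y}"
    then obtain l where l: "l \<le> d z y" "c = \<gamma> l" by auto
    then have "d z c \<le> d z y" using seg_dist[OF \<gamma>, of 0 l] seg_0[OF \<gamma>] by simp
    then show ?thesis using seg_prefix[OF \<gamma> l(1)] l by (intro exI[of _ \<gamma>]) auto
  qed
  obtain \<sigma> \<tau> where \<sigma>: "seg \<sigma> z a" "\<sigma> ` {..d z a} \<subseteq> ?B" and \<tau>: "seg \<tau> z b" "\<tau> ` {..d z b} \<subseteq> ?B"
    using branch a(1) b(1) by meson
  \<comment> \<open>The triangle \<open>z\<close>, \<open>a\<close>, \<open>b\<close> must again
    have perimeter at most \<open>N\<close>, since \<open>T\<close> controls only such triangles.
    For \<open>a\<close> and \<open>b\<close> on one side the perimeter is at most twice that side;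
    for different sides it is compared with the original triangle.\<close>
  have same: "d z (\<rho> l) + d z (\<rho> m) + d (\<rho> l) (\<rho> m) \<le> 2 * d z w"
    if "seg \<rho> z w" "l \<le> d z w" "m \<le> d z w" for \<rho> w l m
    using seg_dist[OF that(1), of 0 l] seg_dist[OF that(1), of 0 m] seg_0[OF that(1)] that
      seg_dist[OF that(1), of l m] seg_dist'[OF that(1), of m l] by (cases "l \<le> m") auto
  have opp: "d z (\<beta> l) + d z (\<gamma> m) + d (\<beta> l) (\<gamma> m) \<le> N" if "l \<le> d z x" "m \<le> d z y" for l m
  proof -
    have lm: "\<beta> l \<in> V" "\<gamma> m \<in> V" using that seg_in[OF \<beta>] seg_in[OF \<gamma>] by auto
    have "d (\<beta> l) (\<gamma> m) \<le> d (\<beta> l) x + d x y + d y (\<gamma> m)"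
      using d_triangle[OF lm(1) V(1) lm(2)] d_triangle[OF V(1) V(2) lm(2)] by linarith
    moreover have "d (\<beta> l) x = d z x - l" "d y (\<gamma> m) = d z y - m" "d z (\<beta> l) = l" "d z (\<gamma> m) = m"
      using seg_dist[OF \<beta>, of l "d z x"] seg_dist'[OF \<gamma>, of m "d z y"] seg_dist[OF \<beta>, of 0 l]
        seg_dist[OF \<gamma>, of 0 m] seg_0[OF \<beta>] seg_0[OF \<gamma>] seg_end[OF \<beta>] seg_end[OF \<gamma>] that by auto
    ultimately show ?thesis using per that by linarith
  qed
  have "2 * d z x \<le> N" "2 * d z y \<le> N"
    using per d_triangle[OF V(3) V(1) V(2)] d_triangle[OF V(3) V(2) V(1)] d_sym[OF V(1,2)] by linarith+
  then have perab: "d z a + d z b + d a b \<le> N"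
  proof -
    consider l m where "l \<le> d z x" "m \<le> d z x" "a = \<beta> l" "b = \<beta> m"
      | l m where "l \<le> d z y" "m \<le> d z y" "a = \<gamma> l" "b = \<gamma> m"
      | l m where "l \<le> d z x" "m \<le> d z y" "a = \<beta> l" "b = \<gamma> m"
      | l m where "l \<le> d z x" "m \<le> d z y" "b = \<beta> l" "a = \<gamma> m"
      using a(1) b(1) by blast
    then show ?thesis
    proof cases
      case 1 then show ?thesis using same[OF \<beta> 1(1,2)] \<open>2 * d z x \<le> N\<close> by simp
    next
      case 2 then show ?thesis using same[OF \<gamma> 2(1,2)] \<open>2 * d z y \<le> N\<close> by simp
    next
      case 3 then show ?thesis using opp[OF 3(1,2)] by simp
    next
      case 4 then show ?thesis using opp[OF 4(1,2)] d_sym[OF abV] by simp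
    qed
  qed
  have "conn Z (70 * T) a b"
  proof (rule bridge[OF thin T \<sigma>(1) \<tau>(1) perab ab])
    fix q assume q: "q \<in> V" "29 * T \<le> d a q"
    have "d a q \<le> 4 * T + d ?p q" using d_triangle[OF abV(1) pV q(1)] d_sym[OF abV(1) pV] a by simp
    then show "q \<in> Z" using q T by (simp add: Z_def)
  next
    show "\<sigma> l \<in> Z" if "l \<le> d z a" for l using that \<sigma>(2) BZ by blast
    show "\<tau> l \<in> Z" if "l \<le> d z b" for l using that \<tau>(2) BZ by blast
  qed (auto simp: Z_def)
  then have ba: "conn Z (70 * T) b a" by (rule conn_sym) (auto simp: Z_def)
  have "conn Z (T + 70 * T + T) (\<alpha> i1) (\<alpha> i0)"
    by (rule conn_trans[OF conn_trans[OF b(2) ba] conn_sym[OF a(2)]]) (auto simp: Z_def)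
  note ba = this[unfolded Z_def]
  have "real T * real T - real T \<le> 2 * K * real (i1 - i0 + (T + 70 * T + T) + 1)"
    by (rule loop_length_bound[OF _ K \<alpha> i01(1-3) ba]) (rule star)
  \<comment> \<open>There are at most \<open>6 * T\<close> steps along \<open>\<alpha>\<close> and
    \<open>72 * T\<close> on the return path, which leaves room for the summand 1 as
    \<open>T > 0\<close>.\<close>
  also have "\<dots> \<le> 2 * K * real (80 * T)"
    using i01(4) T K by (intro mult_left_mono of_nat_mono) auto
  finally have "real T * real T \<le> (160 * K + 1) * real T" by (simp add: algebra_simps)
  then show ?thesis using T by simp
qed

text \<open>The least thinness constant at any perimeter is at most the same \<open>T\<close>, so
  all triangles are \<open>T\<close>-thin. By \<open>mid\<close>, the distance from \<open>z\<close>
  to a point of a geodesic can then be read off, up to \<open>2 * T\<close>, from one of the ends of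
  the geodesic.\<close>

theorem four_point_of_integral_bound:
  assumes star: "\<And>f k xs. lip f \<Longrightarrow> lip k \<Longrightarrow> closed_walk xs \<Longrightarrow> \<bar>walk_integral f k xs\<bar> \<le> K * real (length xs)"
    and K: "K \<ge> 0"
  shows "\<exists>\<delta>. \<forall>x\<in>V. \<forall>y\<in>V. \<forall>z\<in>V. \<forall>w\<in>V. d w x + d y z \<le> max (d w y + d x z) (d w z + d x y) + \<delta>"
proof -
  define T where "T = nat \<lceil>160 * K + 1\<rceil>"
  have thin: "thin N T" for N
  proof -
    have "thin N N"
      unfolding thin_def
    proof (intro allI impI)
      fix x y z \<alpha> \<beta> \<gamma> i assume *: "seg \<alpha> x y \<and> seg \<beta> z x \<and> seg \<gamma> z y \<and> d x y + d z x + d z y \<le> N" "i \<le> d x y"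
      have "d (\<alpha> i) x \<le> N" using seg_dist'[of \<alpha> x y 0 i] seg_0[of \<alpha> x y] * by simp
      then show "\<exists>q \<in> \<beta> ` {..d z x} \<union> \<gamma> ` {..d z y}. d (\<alpha> i) q \<le> N"
        using seg_end[of \<beta> z x] * by force
    qed
    define S where "S = (LEAST S. thin N S)"
    have S: "thin N S" unfolding S_def using \<open>thin N N\<close> by (rule LeastI)
    have "S \<le> T"
    proof (cases "S = 0")
      case False
      then have "\<not> thin N (S - 1)" using not_less_Least[of "S - 1" "thin N"] by (simp add: S_def)
      have "real S \<le> 160 * K + 1"
        by (rule thin_defect_bound[OF _ K S \<open>\<not> thin N (S - 1)\<close>]) (use star False in auto)
      then show ?thesis by (simp add: T_def) linarith
    qed simp
    with S show ?thesis unfolding thin_def by (meson order_trans)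
  qed
  have mid: "d z (\<alpha> i) + i \<le> d z x + 2 * T \<or> d z (\<alpha> i) + (d x y - i) \<le> d z y + 2 * T"
    if \<alpha>: "seg \<alpha> x y" and z: "z \<in> V" and i: "i \<le> d x y" for x y z \<alpha> i
  proof -
    note V = seg_ends[OF \<alpha>]
    obtain \<beta> \<gamma> where \<beta>: "seg \<beta> z x" and \<gamma>: "seg \<gamma> z y" using seg_exists z V by meson
    obtain q where q: "q \<in> \<beta> ` {..d z x} \<union> \<gamma> ` {..d z y}" "d (\<alpha> i) q \<le> T"
      using thinD[OF thin \<alpha> \<beta> \<gamma> order_refl i] by blast
    have close: "d z (\<alpha> i) + d (\<alpha> i) w \<le> d z w + 2 * T" if "seg \<rho> z w" "l \<le> d z w" "q = \<rho> l" for \<rho> w l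
    proof -
      have qV: "q \<in> V" "w \<in> V" "\<alpha> i \<in> V" using seg_in that seg_ends[OF that(1)] seg_in[OF \<alpha> i] by auto
      have "d z q + d q w = d z w"
        using seg_dist[OF that(1), of 0 l] seg_dist[OF that(1), of l "d z w"] seg_0[OF that(1)] seg_end[OF that(1)] that
        by simp
      then show ?thesis
        using d_triangle[OF z qV(1,3)] d_triangle[OF qV(3,1,2)] d_sym[OF qV(1,3)] q(2) by linarith
    qed
    have ends: "d (\<alpha> i) x = i" "d (\<alpha> i) y = d x y - i"
      using seg_dist'[OF \<alpha>, of 0 i] seg_dist[OF \<alpha>, of i "d x y"] seg_0[OF \<alpha>] seg_end[OF \<alpha>] i by auto
    from q(1) show ?thesis using close[OF \<beta>] close[OF \<gamma>] ends by auto
  qed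
  show ?thesis
  proof (intro exI[of _ "4 * T + 1"] ballI)
    fix x y z w assume V: "x \<in> V" "y \<in> V" "z \<in> V" "w \<in> V"
    obtain \<alpha> where \<alpha>: "seg \<alpha> y z" using seg_exists V by blast
    have tri: "d x y \<le> d x z + d y z" "d x z \<le> d x y + d y z" "d y z \<le> d x y + d x z"
      using d_triangle[of x z y] d_triangle[of x y z] d_triangle[of y x z] d_sym V by auto
    \<comment> \<open>The integer part of the Gromov product of \<open>x\<close> and
      \<open>z\<close> at \<open>y\<close>, i.e. the place where the inscribed circle of the
      triangle touches the side from \<open>y\<close> to \<open>z\<close>. Seen from
      \<open>x\<close>, both alternatives of \<open>mid\<close> agree there up to rounding. The
      error is \<open>2 * T\<close> from each of \<open>x\<close> and \<open>w\<close>, and 1 from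
      rounding.\<close>
    define i where "i = (d y z + d x y - d x z) div 2"
    have i: "i \<le> d y z" "d x y - i \<le> d x y" "2 * i \<le> d y z + d x y - d x z" "d y z + d x y - d x z \<le> 2 * i + 1"
      using tri by (auto simp: i_def)
    have pV: "\<alpha> i \<in> V" using seg_in[OF \<alpha> i(1)] .
    have "d w x \<le> d w (\<alpha> i) + d x (\<alpha> i)" using d_triangle[OF V(4) pV V(1)] d_sym[OF pV V(1)] by simp
    moreover note mid[OF \<alpha> V(1) i(1)] mid[OF \<alpha> V(4) i(1)] i tri
    ultimately show "d w x + d y z \<le> max (d w y + d x z) (d w z + d x y) + (4 * T + 1)"
      by linarith
  qed
qed

end

section \<open>Free and projective left modules\<close>

lemma left_module_homD:
  assumes "h \<in> left_module_hom A M N"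
  shows "x \<in> carrier M \<Longrightarrow> h x \<in> carrier N"
    and "x \<in> carrier M \<Longrightarrow> y \<in> carrier M \<Longrightarrow> h (x \<oplus>\<^bsub>M\<^esub> y) = h x \<oplus>\<^bsub>N\<^esub> h y"
    and "a \<in> carrier A \<Longrightarrow> x \<in> carrier M \<Longrightarrow> h (a \<odot>\<^bsub>M\<^esub> x) = a \<odot>\<^bsub>N\<^esub> h x"
  using assms by (auto simp: left_module_hom_def)

lemma left_module_hom_comp:
  "\<lbrakk>h \<in> left_module_hom A M N; h' \<in> left_module_hom A N P\<rbrakk> \<Longrightarrow> (\<lambda>x. h' (h x)) \<in> left_module_hom A M P"
  by (simp add: left_module_hom_def Pi_iff)

lemma left_module_hom_zero:
  assumes "h \<in> left_module_hom A M N" "abelian_group M" "abelian_group N"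
  shows "h \<zero>\<^bsub>M\<^esub> = \<zero>\<^bsub>N\<^esub>"
proof -
  interpret M: abelian_group M by fact
  interpret N: abelian_group N by fact
  have "h \<zero>\<^bsub>M\<^esub> \<oplus>\<^bsub>N\<^esub> h \<zero>\<^bsub>M\<^esub> = h \<zero>\<^bsub>M\<^esub>"
    using left_module_homD(2)[OF assms(1), of "\<zero>\<^bsub>M\<^esub>" "\<zero>\<^bsub>M\<^esub>"] by simp
  then show ?thesis using left_module_homD(1)[OF assms(1)] N.add.l_cancel_one' M.zero_closed by metis
qed

lemma left_module_hom_neg:
  assumes "h \<in> left_module_hom A M N" "abelian_group M" "abelian_group N" "x \<in> carrier M"
  shows "h (\<ominus>\<^bsub>M\<^esub> x) = \<ominus>\<^bsub>N\<^esub> h x"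
proof -
  interpret M: abelian_group M by fact
  interpret N: abelian_group N by fact
  have "h (\<ominus>\<^bsub>M\<^esub> x) \<oplus>\<^bsub>N\<^esub> h x = \<zero>\<^bsub>N\<^esub>"
    using left_module_homD(2)[OF assms(1), of "\<ominus>\<^bsub>M\<^esub> x" x] left_module_hom_zero[OF assms(1-3)] assms(4)
    by (simp add: M.l_neg)
  then show ?thesis using left_module_homD(1)[OF assms(1)] assms(4) N.minus_equality by (metis M.a_inv_closed)
qed

context left_module
begin

lemma smult_l_null: assumes "x \<in> carrier M" shows "\<zero> \<odot>\<^bsub>M\<^esub> x = \<zero>\<^bsub>M\<^esub>"
proof -
  have "\<zero> \<odot>\<^bsub>M\<^esub> x = \<zero> \<odot>\<^bsub>M\<^esub> x \<oplus>\<^bsub>M\<^esub> \<zero> \<odot>\<^bsub>M\<^esub> x"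
    using smult_l_distr[of \<zero> \<zero> x] assms by simp
  then show ?thesis using assms smult_closed[of \<zero> x] by (metis M.add.r_cancel_one' A.zero_closed)
qed

lemma smult_r_null: assumes "a \<in> carrier A" shows "a \<odot>\<^bsub>M\<^esub> \<zero>\<^bsub>M\<^esub> = \<zero>\<^bsub>M\<^esub>"
proof -
  have "a \<odot>\<^bsub>M\<^esub> \<zero>\<^bsub>M\<^esub> = a \<odot>\<^bsub>M\<^esub> \<zero>\<^bsub>M\<^esub> \<oplus>\<^bsub>M\<^esub> a \<odot>\<^bsub>M\<^esub> \<zero>\<^bsub>M\<^esub>"
    using smult_r_distr[of a "\<zero>\<^bsub>M\<^esub>" "\<zero>\<^bsub>M\<^esub>"] assms by simp
  then show ?thesis using assms smult_closed[of a "\<zero>\<^bsub>M\<^esub>"] by (metis M.add.r_cancel_one' M.zero_closed)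
qed

lemma smult_r_minus: assumes "a \<in> carrier A" "x \<in> carrier M"
  shows "a \<odot>\<^bsub>M\<^esub> (\<ominus>\<^bsub>M\<^esub> x) = \<ominus>\<^bsub>M\<^esub> (a \<odot>\<^bsub>M\<^esub> x)"
proof (rule M.minus_equality[symmetric])
  show "a \<odot>\<^bsub>M\<^esub> (\<ominus>\<^bsub>M\<^esub> x) \<oplus>\<^bsub>M\<^esub> a \<odot>\<^bsub>M\<^esub> x = \<zero>\<^bsub>M\<^esub>"
    using smult_r_distr[of a "\<ominus>\<^bsub>M\<^esub> x" x] assms smult_r_null by (simp add: M.l_neg)
qed (use assms smult_closed in auto)

lemma smult_finsum:
  assumes "finite I" "a \<in> carrier A" "f \<in> I \<rightarrow> carrier M"
  shows "a \<odot>\<^bsub>M\<^esub> (\<Oplus>\<^bsub>M\<^esub>i\<in>I. f i) = (\<Oplus>\<^bsub>M\<^esub>i\<in>I. a \<odot>\<^bsub>M\<^esub> f i)"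
  using assms
proof (induction I rule: finite_induct)
  case empty
  then show ?case using smult_r_null by simp
next
  case (insert i I)
  then have "f \<in> I \<rightarrow> carrier M" "(\<lambda>i. a \<odot>\<^bsub>M\<^esub> f i) \<in> I \<rightarrow> carrier M" "f i \<in> carrier M"
    using smult_closed by auto
  then show ?case using insert M.finsum_insert[OF insert(1,2), of f] smult_closed smult_r_distr
    by (simp add: M.finsum_insert M.finsum_closed)
qed

end

definition lin_ext :: "('a, 'c) ring_scheme \<Rightarrow> ('a, 'm) module \<Rightarrow> ('x \<Rightarrow> 'm) \<Rightarrow> ('x \<Rightarrow> 'a) \<Rightarrow> 'm" where
  "lin_ext A M v c = (\<Oplus>\<^bsub>M\<^esub>x\<in>{x. c x \<noteq> \<zero>\<^bsub>A\<^esub>}. c x \<odot>\<^bsub>M\<^esub> v x)"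

lemma lincomb_eq_lin_ext: "lincomb A M c = lin_ext A M (\<lambda>x. x) c"
  by (simp add: lincomb_def lin_ext_def)

definition basis_fun :: "('a, 'c) ring_scheme \<Rightarrow> 'x \<Rightarrow> 'x \<Rightarrow> 'a" where
  "basis_fun A x = (\<lambda>y. if y = x then \<one>\<^bsub>A\<^esub> else \<zero>\<^bsub>A\<^esub>)"

lemma free_module_simps:
  "carrier (free_module A B) = {c. (\<forall>x. c x \<in> carrier A) \<and> (\<forall>x. x \<notin> B \<longrightarrow> c x = \<zero>\<^bsub>A\<^esub>) \<and>
                   finite {x. c x \<noteq> \<zero>\<^bsub>A\<^esub>}}"
  "\<zero>\<^bsub>free_module A B\<^esub> = (\<lambda>_. \<zero>\<^bsub>A\<^esub>)"
  "c \<oplus>\<^bsub>free_module A B\<^esub> e = (\<lambda>x. c x \<oplus>\<^bsub>A\<^esub> e x)"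
  "a \<odot>\<^bsub>free_module A B\<^esub> c = (\<lambda>x. a \<otimes>\<^bsub>A\<^esub> c x)"
  by (simp_all add: free_module_def)

context ring
begin

lemma basis_fun_in: "x \<in> B \<Longrightarrow> basis_fun R x \<in> carrier (free_module R B)"
  by (auto simp: free_module_simps basis_fun_def)

lemma free_module_add_closed:
  assumes "c \<in> carrier (free_module R B)" "e \<in> carrier (free_module R B)"
  shows "c \<oplus>\<^bsub>free_module R B\<^esub> e \<in> carrier (free_module R B)"
proof -
  have "{x. c x \<oplus> e x \<noteq> \<zero>} \<subseteq> {x. c x \<noteq> \<zero>} \<union> {x. e x \<noteq> \<zero>}" by auto
  moreover have "finite ({x. c x \<noteq> \<zero>} \<union> {x. e x \<noteq> \<zero>})" using assms by (simp add: free_module_simps)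
  ultimately have "finite {x. c x \<oplus> e x \<noteq> \<zero>}" by (rule finite_subset)
  then show ?thesis using assms by (simp add: free_module_simps)
qed

lemma free_module_smult_closed:
  assumes "a \<in> carrier R" "c \<in> carrier (free_module R B)"
  shows "a \<odot>\<^bsub>free_module R B\<^esub> c \<in> carrier (free_module R B)"
proof -
  have "{x. a \<otimes> c x \<noteq> \<zero>} \<subseteq> {x. c x \<noteq> \<zero>}" using assms(1) by auto
  moreover have "finite {x. c x \<noteq> \<zero>}" using assms by (simp add: free_module_simps)
  ultimately have "finite {x. a \<otimes> c x \<noteq> \<zero>}" by (rule finite_subset)
  then show ?thesis using assms by (simp add: free_module_simps)
qed

lemma free_module_induct [consumes 1, case_names zero add]:
  assumes c: "c \<in> carrier (free_module R B)"
    and zero: "P (\<lambda>_. \<zero>)"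
    and add: "\<And>c a x. \<lbrakk>c \<in> carrier (free_module R B); P c; a \<in> carrier R; x \<in> B\<rbrakk> \<Longrightarrow>
       P (c \<oplus>\<^bsub>free_module R B\<^esub> (a \<odot>\<^bsub>free_module R B\<^esub> basis_fun R x))"
  shows "P c"
  using c
proof (induction "card {x. c x \<noteq> \<zero>}" arbitrary: c)
  case 0
  then have "c = (\<lambda>_. \<zero>)" by (auto simp: free_module_simps)
  then show ?case using zero by simp
next
  case (Suc n)
  then obtain x where x: "c x \<noteq> \<zero>" by fastforce
  define e where "e = c(x := \<zero>)"
  have fin: "finite {x. c x \<noteq> \<zero>}" using Suc by (simp add: free_module_simps)
  have supp: "{y. e y \<noteq> \<zero>} = {x. c x \<noteq> \<zero>} - {x}" by (auto simp: e_def)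
  have e: "e \<in> carrier (free_module R B)"
    using Suc.prems fin unfolding free_module_simps mem_Collect_eq supp by (simp add: e_def)
  have "P e" using Suc.hyps fin x by (intro Suc.hyps(1) e) (simp add: supp)
  moreover have "x \<in> B" "c x \<in> carrier R" using Suc.prems x by (auto simp: free_module_simps)
  moreover have "c = e \<oplus>\<^bsub>free_module R B\<^esub> (c x \<odot>\<^bsub>free_module R B\<^esub> basis_fun R x)"
    using Suc.prems by (auto simp: free_module_simps e_def basis_fun_def)
  ultimately show ?case using add[OF e] by metis
qed

end

text \<open>Restricts \<open>M\<close> to the plain record type that \<open>free_module\<close> and
  \<open>left_module_hom\<close> expect.\<close>

locale plain_left_module = left_module A M
  for A :: "('a, 'c) ring_scheme" (structure) and M :: "('a, 'm) module" (structure)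
begin

lemma lin_ext_superset:
  assumes "finite S" "{x. c x \<noteq> \<zero>} \<subseteq> S" "\<And>x. x \<in> S \<Longrightarrow> c x \<in> carrier A" "v \<in> S \<rightarrow> carrier M"
  shows "lin_ext A M v c = (\<Oplus>\<^bsub>M\<^esub>x\<in>S. c x \<odot>\<^bsub>M\<^esub> v x)"
  unfolding lin_ext_def
  using assms smult_closed smult_l_null
  by (intro M.add.finprod_mono_neutral_cong_left) (auto simp: Pi_iff)

lemma lin_ext_hom:
  assumes v: "v \<in> B \<rightarrow> carrier M"
  shows "lin_ext A M v \<in> left_module_hom A (free_module A B) M"
proof -
  \<comment> \<open>The support over which \<open>lin_ext\<close> sums changes under addition and
    scaling, so all sums are first enlarged to a common finite set.\<close>
  have eq: "lin_ext A M v c = (\<Oplus>\<^bsub>M\<^esub>x\<in>S. c x \<odot>\<^bsub>M\<^esub> v x)"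
    if "c \<in> carrier (free_module A B)" "finite S" "{x. c x \<noteq> \<zero>} \<subseteq> S" "S \<subseteq> B" for c S
    using that v by (intro lin_ext_superset) (auto simp: free_module_simps)
  have supp: "finite {x. c x \<noteq> \<zero>}" "{x. c x \<noteq> \<zero>} \<subseteq> B" "\<And>x. c x \<in> carrier A"
    if "c \<in> carrier (free_module A B)" for c
    using that by (auto simp: free_module_simps)
  have cl: "(\<lambda>x. c x \<odot>\<^bsub>M\<^esub> v x) \<in> B \<rightarrow> carrier M" if "c \<in> carrier (free_module A B)" for c
    using supp[OF that] v smult_closed by (simp add: Pi_iff)
  show ?thesis
    unfolding left_module_hom_def
  proof (intro CollectI conjI ballI funcsetI)
    fix c assume c: "c \<in> carrier (free_module A B)"
    show "lin_ext A M v c \<in> carrier M"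
      unfolding lin_ext_def using cl[OF c] supp[OF c] by (intro M.finsum_closed) auto
  next
    fix c e assume c: "c \<in> carrier (free_module A B)" and e: "e \<in> carrier (free_module A B)"
    let ?S = "{x. c x \<noteq> \<zero>} \<union> {x. e x \<noteq> \<zero>}"
    note S = supp[OF c] supp[OF e]
    have vS: "v x \<in> carrier M" if "x \<in> ?S" for x using that v S by auto
    have "lin_ext A M v (c \<oplus>\<^bsub>free_module A B\<^esub> e) = (\<Oplus>\<^bsub>M\<^esub>x\<in>?S. (c x \<oplus> e x) \<odot>\<^bsub>M\<^esub> v x)"
      using A.free_module_add_closed[OF c e] S by (subst eq[of _ ?S]) (auto simp: free_module_simps)
    also have "\<dots> = (\<Oplus>\<^bsub>M\<^esub>x\<in>?S. c x \<odot>\<^bsub>M\<^esub> v x \<oplus>\<^bsub>M\<^esub> e x \<odot>\<^bsub>M\<^esub> v x)"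
      using S vS smult_closed by (intro M.finsum_cong' refl) (auto intro!: smult_l_distr)
    also have "\<dots> = lin_ext A M v c \<oplus>\<^bsub>M\<^esub> lin_ext A M v e"
      using S vS smult_closed c e
      by (subst M.finsum_addf) (auto simp: eq[of c ?S] eq[of e ?S])
    finally show "lin_ext A M v (c \<oplus>\<^bsub>free_module A B\<^esub> e) = lin_ext A M v c \<oplus>\<^bsub>M\<^esub> lin_ext A M v e" .
  next
    fix a c assume a: "a \<in> carrier A" and c: "c \<in> carrier (free_module A B)"
    let ?S = "{x. c x \<noteq> \<zero>}"
    note S = supp[OF c]
    have vS: "v x \<in> carrier M" if "x \<in> ?S" for x using that v S by auto
    have "lin_ext A M v (a \<odot>\<^bsub>free_module A B\<^esub> c) = (\<Oplus>\<^bsub>M\<^esub>x\<in>?S. (a \<otimes> c x) \<odot>\<^bsub>M\<^esub> v x)"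
      using A.free_module_smult_closed[OF a c] S a by (subst eq[of _ ?S]) (auto simp: free_module_simps)
    also have "\<dots> = (\<Oplus>\<^bsub>M\<^esub>x\<in>?S. a \<odot>\<^bsub>M\<^esub> (c x \<odot>\<^bsub>M\<^esub> v x))"
      using S vS smult_closed a by (intro M.finsum_cong' refl) (auto intro!: smult_assoc)
    also have "\<dots> = a \<odot>\<^bsub>M\<^esub> lin_ext A M v c"
      unfolding lin_ext_def using S vS smult_closed a by (intro smult_finsum[symmetric]) auto
    finally show "lin_ext A M v (a \<odot>\<^bsub>free_module A B\<^esub> c) = a \<odot>\<^bsub>M\<^esub> lin_ext A M v c" .
  qed
qed

lemma lin_ext_basis_fun:
  assumes "v x \<in> carrier M" shows "lin_ext A M v (basis_fun A x) = v x"
proof -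
  have "lin_ext A M v (basis_fun A x) = (\<Oplus>\<^bsub>M\<^esub>y\<in>{x}. basis_fun A x y \<odot>\<^bsub>M\<^esub> v y)"
    using assms by (intro lin_ext_superset) (auto simp: basis_fun_def split: if_splits)
  also have "\<dots> = v x" using assms smult_one by (simp add: basis_fun_def)
  finally show ?thesis .
qed

lemma free_module_hom_eqI:
  assumes "h \<in> left_module_hom A (free_module A B) M" "h' \<in> left_module_hom A (free_module A B) M"
    and eq: "\<And>x. x \<in> B \<Longrightarrow> h (basis_fun A x) = h' (basis_fun A x)"
    and c: "c \<in> carrier (free_module A B)"
  shows "h c = h' c"
  using c
proof (induction rule: A.free_module_induct)
  case zero
  have *: "k (\<lambda>_. \<zero>) = \<zero>\<^bsub>M\<^esub>" if "k \<in> left_module_hom A (free_module A B) M" for k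
  proof -
    have "(\<lambda>_. \<zero>) \<in> carrier (free_module A B)" by (simp add: free_module_simps)
    then have "k (\<zero> \<odot>\<^bsub>free_module A B\<^esub> (\<lambda>_. \<zero>)) = \<zero>\<^bsub>M\<^esub>"
      using left_module_homD(1,3)[OF that] smult_l_null by simp
    then show ?thesis by (simp add: free_module_simps)
  qed
  show ?case using *[OF assms(1)] *[OF assms(2)] by simp
next
  case (add c a x)
  have b: "basis_fun A x \<in> carrier (free_module A B)" using A.basis_fun_in \<open>x \<in> B\<close> .
  note ab = A.free_module_smult_closed[OF \<open>a \<in> carrier A\<close> b]
  show ?case
    using add eq b by (simp add: left_module_homD(2)[OF assms(1) _ ab] left_module_homD(2)[OF assms(2) _ ab]
      left_module_homD(3)[OF assms(1)] left_module_homD(3)[OF assms(2)])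
qed

end

text \<open>Preimages \<open>v x\<close> of the values of \<open>f \<circ> p\<close> on basis
  elements extend to the free module, and composition with the section \<open>i\<close> gives the
  lift. The condition on \<open>q\<close> is an inclusion of images because \<open>q\<close> is the
  augmentation in one application and \<open>d1\<close>, which maps onto the kernel of
  \<open>\<epsilon>\<close>, in another.\<close>

lemma projective_lift:
  fixes P :: "('a, 'p) module"
  assumes P: "projective_module A P" and M: "left_module A M" and N: "left_module A N"
    and f: "f \<in> left_module_hom A P N" and q: "q \<in> left_module_hom A M N"
    and sub: "f ` carrier P \<subseteq> q ` carrier M"
  shows "\<exists>h \<in> left_module_hom A P M. \<forall>x\<in>carrier P. q (h x) = f x"
proof -
  interpret M: plain_left_module A M using M by (simp add: plain_left_module_def)
  interpret N: plain_left_module A N using N by (simp add: plain_left_module_def)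
  obtain B :: "'p set" and i p where i: "i \<in> left_module_hom A P (free_module A B)"
    and p: "p \<in> left_module_hom A (free_module A B) P" and pi: "\<And>x. x \<in> carrier P \<Longrightarrow> p (i x) = x"
    using P unfolding projective_module_def by auto
  have "\<exists>m\<in>carrier M. q m = f (p (basis_fun A x))" if "x \<in> B" for x
    using left_module_homD(1)[OF p M.A.basis_fun_in[OF that]] sub by (metis image_eqI image_iff subsetD)
  then obtain v where v: "\<And>x. x \<in> B \<Longrightarrow> v x \<in> carrier M \<and> q (v x) = f (p (basis_fun A x))"
    by metis
  have L: "lin_ext A M v \<in> left_module_hom A (free_module A B) M"
    using v by (intro M.lin_ext_hom) auto
  show ?thesis
  proof (intro bexI ballI)
    show "(\<lambda>x. lin_ext A M v (i x)) \<in> left_module_hom A P M"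
      by (rule left_module_hom_comp[OF i L])
    fix x assume x: "x \<in> carrier P"
    have "q (lin_ext A M v (i x)) = f (p (i x))"
    proof (rule N.free_module_hom_eqI[OF left_module_hom_comp[OF L q] left_module_hom_comp[OF p f]])
      show "i x \<in> carrier (free_module A B)" using left_module_homD(1)[OF i x] .
      show "q (lin_ext A M v (basis_fun A y)) = f (p (basis_fun A y))" if "y \<in> B" for y
        using v[OF that] M.lin_ext_basis_fun[of v y] by simp
    qed
    then show "q (lin_ext A M v (i x)) = f x" using pi x by simp
  qed
qed

section \<open>Modules over group rings and the l1-norm\<close>

definition gmon :: "complex \<Rightarrow> 'g \<Rightarrow> 'g \<Rightarrow> complex" where
  "gmon r g = (\<lambda>h. if h = g then r else 0)"

text \<open>The linear extension of \<open>k\<close> to finitely supported functions; the constant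
  function 1 gives the augmentation.\<close>

definition pairing :: "('g \<Rightarrow> complex) \<Rightarrow> ('g \<Rightarrow> complex) \<Rightarrow> complex" where
  "pairing a k = (\<Sum>g | a g \<noteq> 0. a g * k g)"

definition nrm1 :: "('g \<Rightarrow> complex) \<Rightarrow> real" where
  "nrm1 a = (\<Sum>g | a g \<noteq> 0. cmod (a g))"

lemma complex_of_real_of_rat: "complex_of_real (of_rat q) = of_rat q"
  by (cases q) (simp add: of_rat_rat)

lemma pairing_superset: "finite S \<Longrightarrow> {g. a g \<noteq> 0} \<subseteq> S \<Longrightarrow> pairing a k = (\<Sum>g\<in>S. a g * k g)"
  unfolding pairing_def by (rule sum.mono_neutral_left) auto

lemma nrm1_superset: "finite S \<Longrightarrow> {g. a g \<noteq> 0} \<subseteq> S \<Longrightarrow> nrm1 a = (\<Sum>g\<in>S. cmod (a g))"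
  unfolding nrm1_def by (rule sum.mono_neutral_left) auto

lemma pairing_mon: "pairing (gmon r g) k = r * k g"
  by (subst pairing_superset[of "{g}"]) (auto simp: gmon_def)

lemma nrm1_nonneg: "nrm1 a \<ge> 0"
  unfolding nrm1_def by (rule sum_nonneg) simp

lemma gmon_zero: "gmon 0 g = (\<lambda>_. 0)"
  by (auto simp: gmon_def)

lemma pairing_zero: "pairing (\<lambda>_. 0) k = 0" and nrm1_zero: "nrm1 (\<lambda>_. 0) = 0"
  by (simp_all add: pairing_def nrm1_def)

lemma pairing_add:
  assumes "finite {g. a g \<noteq> 0}" "finite {g. b g \<noteq> 0}"
  shows "pairing (\<lambda>g. a g + b g) k = pairing a k + pairing b k"
proof -
  let ?S = "{g. a g \<noteq> 0} \<union> {g. b g \<noteq> 0}"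
  have "finite ?S" using assms by simp
  then show ?thesis
    by (subst (1 2 3) pairing_superset[of ?S]) (auto simp: sum.distrib ring_distribs)
qed

lemma nrm1_add:
  assumes "finite {g. a g \<noteq> 0}" "finite {g. b g \<noteq> 0}"
  shows "nrm1 (\<lambda>g. a g + b g) \<le> nrm1 a + nrm1 b"
proof -
  let ?S = "{g. a g \<noteq> 0} \<union> {g. b g \<noteq> 0}"
  have "finite ?S" using assms by simp
  then show ?thesis
    by (subst (1 2 3) nrm1_superset[of ?S]) (auto simp: sum.distrib[symmetric] intro!: sum_mono norm_triangle_ineq)
qed

lemma pairing_fun_diff: "pairing a (\<lambda>g. k g - l g) = pairing a k - pairing a l"
  by (simp add: pairing_def ring_distribs sum_subtractf)

lemma pairing_fun_cmult: "pairing a (\<lambda>g. c * k g) = c * pairing a k"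
  by (simp add: pairing_def sum_distrib_left mult_ac)

lemma pairing_bound:
  assumes "\<And>g. a g \<noteq> 0 \<Longrightarrow> cmod (k g) \<le> B g"
  shows "cmod (pairing a k) \<le> (\<Sum>g | a g \<noteq> 0. cmod (a g) * B g)"
  unfolding pairing_def using assms
  by (intro order_trans[OF norm_sum] sum_mono) (auto simp: norm_mult intro!: mult_left_mono)

section \<open>Group rings over the rational, real or complex numbers, and the action of
  monomials\<close>

locale coeff_group = G: group G for G :: "('g, 'b) monoid_scheme" (structure) +
  fixes R :: "complex set"
  assumes R_cases: "R = \<rat> \<or> R = \<real> \<or> R = UNIV"
begin

abbreviation "A \<equiv> group_ring R G"

lemma R_closed:
  "0 \<in> R" "1 \<in> R" "x \<in> R \<Longrightarrow> y \<in> R \<Longrightarrow> x + y \<in> R" "x \<in> R \<Longrightarrow> y \<in> R \<Longrightarrow> x * y \<in> R" "x \<in> R \<Longrightarrow> - x \<in> R"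
  using R_cases by auto

lemma R_rat: "x \<in> \<rat> \<Longrightarrow> x \<in> R"
  using R_cases by (auto elim!: Rats_cases simp flip: complex_of_real_of_rat)

lemma A_simps:
  "a \<in> carrier A \<longleftrightarrow> (\<forall>g. a g \<in> R) \<and> (\<forall>g. g \<notin> carrier G \<longrightarrow> a g = 0) \<and> finite {g. a g \<noteq> 0}"
  "\<zero>\<^bsub>A\<^esub> = (\<lambda>_. 0)" "\<one>\<^bsub>A\<^esub> = gmon 1 \<one>"
  "a \<oplus>\<^bsub>A\<^esub> b = (\<lambda>g. a g + b g)"
  by (auto simp: group_ring_def gmon_def)

lemma gmon_in [simp]: "r \<in> R \<Longrightarrow> g \<in> carrier G \<Longrightarrow> gmon r g \<in> carrier A"
  using R_closed(1) by (auto simp: A_simps gmon_def)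

lemma gmon_mult:
  assumes "g \<in> carrier G"
  shows "gmon r g \<otimes>\<^bsub>A\<^esub> a = (\<lambda>h. if h \<in> carrier G then r * a (inv g \<otimes> h) else 0)"
proof
  fix h
  have "(\<Sum>h' | gmon r g h' \<noteq> 0. gmon r g h' * a (inv h' \<otimes> h)) = (\<Sum>h'\<in>{g}. gmon r g h' * a (inv h' \<otimes> h))"
    by (rule sum.mono_neutral_left) (auto simp: gmon_def)
  then show "(gmon r g \<otimes>\<^bsub>A\<^esub> a) h = (if h \<in> carrier G then r * a (inv g \<otimes> h) else 0)"
    by (simp add: group_ring_def gmon_def)
qed

lemma inv_mult_eq_iff: "\<lbrakk>g \<in> carrier G; h \<in> carrier G; k \<in> carrier G\<rbrakk> \<Longrightarrow> inv g \<otimes> h = k \<longleftrightarrow> h = g \<otimes> k"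
  using G.inv_solve_left'[of k g h] by blast

lemma gmon_mult_mon:
  assumes "g \<in> carrier G" "g' \<in> carrier G"
  shows "gmon r g \<otimes>\<^bsub>A\<^esub> gmon r' g' = gmon (r * r') (g \<otimes> g')"
  using assms inv_mult_eq_iff[of g _ g'] unfolding gmon_mult[OF assms(1)] by (auto simp: gmon_def intro!: ext)

lemma gmon_add_mon: "gmon r g \<oplus>\<^bsub>A\<^esub> gmon r' g = gmon (r + r') g"
  by (auto simp: A_simps gmon_def)

lemma supp_mon_mult:
  assumes "g \<in> carrier G" "r \<noteq> 0" "a \<in> carrier A"
  shows "{h. (gmon r g \<otimes>\<^bsub>A\<^esub> a) h \<noteq> 0} = (\<lambda>h. g \<otimes> h) ` {h. a h \<noteq> 0}"
proof -
  have supp: "h \<in> carrier G" if "a h \<noteq> 0" for h using assms that by (auto simp: A_simps)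
  show ?thesis
  proof (intro equalityI subsetI)
    fix h assume "h \<in> {h. (gmon r g \<otimes>\<^bsub>A\<^esub> a) h \<noteq> 0}"
    then have "h \<in> carrier G" "a (inv g \<otimes> h) \<noteq> 0" by (auto simp: gmon_mult assms split: if_splits)
    then show "h \<in> (\<lambda>h. g \<otimes> h) ` {h. a h \<noteq> 0}"
      using assms by (intro image_eqI[of _ _ "inv g \<otimes> h"]) (auto simp: G.m_assoc[symmetric])
  next
    fix h assume "h \<in> (\<lambda>h. g \<otimes> h) ` {h. a h \<noteq> 0}"
    then obtain l where "h = g \<otimes> l" "a l \<noteq> 0" "l \<in> carrier G" using supp by auto
    then show "h \<in> {h. (gmon r g \<otimes>\<^bsub>A\<^esub> a) h \<noteq> 0}"
      using assms by (auto simp: gmon_mult G.m_assoc[symmetric])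
  qed
qed

lemma inj_on_translate: "g \<in> carrier G \<Longrightarrow> S \<subseteq> carrier G \<Longrightarrow> inj_on (\<lambda>h. g \<otimes> h) S"
  by (intro inj_onI) (auto simp: subset_iff)

lemma supp_A: "a \<in> carrier A \<Longrightarrow> {h. a h \<noteq> 0} \<subseteq> carrier G" and fin_A: "a \<in> carrier A \<Longrightarrow> finite {h. a h \<noteq> 0}"
  by (auto simp: A_simps)

lemma pairing_mon_mult:
  assumes "g \<in> carrier G" "a \<in> carrier A"
  shows "pairing (gmon r g \<otimes>\<^bsub>A\<^esub> a) k = r * pairing a (\<lambda>h. k (g \<otimes> h))"
proof (cases "r = 0")
  case True
  then show ?thesis using assms by (simp add: gmon_mult pairing_def)
next
  case False
  have "pairing (gmon r g \<otimes>\<^bsub>A\<^esub> a) k = (\<Sum>h | a h \<noteq> 0. (gmon r g \<otimes>\<^bsub>A\<^esub> a) (g \<otimes> h) * k (g \<otimes> h))"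
    unfolding pairing_def supp_mon_mult[OF assms(1) False assms(2)]
    using inj_on_translate[OF assms(1) supp_A[OF assms(2)]] by (simp add: sum.reindex)
  also have "\<dots> = (\<Sum>h | a h \<noteq> 0. r * (a h * k (g \<otimes> h)))"
    using assms(1) supp_A[OF assms(2)] by (intro sum.cong) (auto simp: gmon_mult subset_iff G.m_assoc[symmetric])
  finally show ?thesis by (simp add: pairing_def sum_distrib_left)
qed

lemma nrm1_mon_mult:
  assumes "g \<in> carrier G" "a \<in> carrier A"
  shows "nrm1 (gmon r g \<otimes>\<^bsub>A\<^esub> a) = cmod r * nrm1 a"
proof (cases "r = 0")
  case True
  then show ?thesis using assms by (simp add: gmon_mult nrm1_def)
next
  case False
  have "nrm1 (gmon r g \<otimes>\<^bsub>A\<^esub> a) = (\<Sum>h | a h \<noteq> 0. cmod ((gmon r g \<otimes>\<^bsub>A\<^esub> a) (g \<otimes> h)))"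
    unfolding nrm1_def supp_mon_mult[OF assms(1) False assms(2)]
    using inj_on_translate[OF assms(1) supp_A[OF assms(2)]] by (simp add: sum.reindex)
  also have "\<dots> = (\<Sum>h | a h \<noteq> 0. cmod r * cmod (a h))"
    using assms(1) supp_A[OF assms(2)] by (intro sum.cong) (auto simp: gmon_mult subset_iff G.m_assoc[symmetric] norm_mult)
  finally show ?thesis by (simp add: nrm1_def sum_distrib_left)
qed

lemma pairing_A_add: "a \<in> carrier A \<Longrightarrow> b \<in> carrier A \<Longrightarrow> pairing (a \<oplus>\<^bsub>A\<^esub> b) k = pairing a k + pairing b k"
  unfolding A_simps(4) by (rule pairing_add) (auto simp: A_simps)

lemma nrm1_A_add: "a \<in> carrier A \<Longrightarrow> b \<in> carrier A \<Longrightarrow> nrm1 (a \<oplus>\<^bsub>A\<^esub> b) \<le> nrm1 a + nrm1 b"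
  unfolding A_simps(4) by (rule nrm1_add) (auto simp: A_simps)

end

locale rg_module = coeff_group G R + plain_left_module "group_ring R G" M
  for G :: "('g, 'b) monoid_scheme" (structure) and R :: "complex set"
    and M :: "('g \<Rightarrow> complex, 'm) module"
begin

lemma act_closed [simp]:
  "\<lbrakk>r \<in> R; g \<in> carrier G; m \<in> carrier M\<rbrakk> \<Longrightarrow> gmon r g \<odot>\<^bsub>M\<^esub> m \<in> carrier M"
  by (simp add: smult_closed)

lemma act_act:
  "\<lbrakk>r \<in> R; g \<in> carrier G; r' \<in> R; g' \<in> carrier G; m \<in> carrier M\<rbrakk> \<Longrightarrow>
    gmon r g \<odot>\<^bsub>M\<^esub> (gmon r' g' \<odot>\<^bsub>M\<^esub> m) = gmon (r * r') (g \<otimes> g') \<odot>\<^bsub>M\<^esub> m"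
  by (simp add: smult_assoc[symmetric] gmon_mult_mon)

lemma act_add_scalar:
  "\<lbrakk>r \<in> R; g \<in> carrier G; r' \<in> R; m \<in> carrier M\<rbrakk> \<Longrightarrow>
    gmon (r + r') g \<odot>\<^bsub>M\<^esub> m = gmon r g \<odot>\<^bsub>M\<^esub> m \<oplus>\<^bsub>M\<^esub> gmon r' g \<odot>\<^bsub>M\<^esub> m"
  by (simp add: smult_l_distr[symmetric] gmon_add_mon)

lemma act_add:
  "\<lbrakk>r \<in> R; g \<in> carrier G; m \<in> carrier M; m' \<in> carrier M\<rbrakk> \<Longrightarrow>
    gmon r g \<odot>\<^bsub>M\<^esub> (m \<oplus>\<^bsub>M\<^esub> m') = gmon r g \<odot>\<^bsub>M\<^esub> m \<oplus>\<^bsub>M\<^esub> gmon r g \<odot>\<^bsub>M\<^esub> m'"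
  by (simp add: smult_r_distr)

lemma act_one: "m \<in> carrier M \<Longrightarrow> gmon 1 \<one> \<odot>\<^bsub>M\<^esub> m = m"
  using smult_one by (simp add: A_simps)

lemma act_zero_scalar: "m \<in> carrier M \<Longrightarrow> gmon 0 g \<odot>\<^bsub>M\<^esub> m = \<zero>\<^bsub>M\<^esub>"
  using smult_l_null by (simp add: gmon_zero A_simps)

lemma act_zero: "\<lbrakk>r \<in> R; g \<in> carrier G\<rbrakk> \<Longrightarrow> gmon r g \<odot>\<^bsub>M\<^esub> \<zero>\<^bsub>M\<^esub> = \<zero>\<^bsub>M\<^esub>"
  by (simp add: smult_r_null)

lemma act_uminus_scalar:
  "\<lbrakk>r \<in> R; g \<in> carrier G; m \<in> carrier M\<rbrakk> \<Longrightarrow> gmon (- r) g \<odot>\<^bsub>M\<^esub> m = \<ominus>\<^bsub>M\<^esub> (gmon r g \<odot>\<^bsub>M\<^esub> m)"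
  using act_add_scalar[of "- r" g r m] R_closed act_zero_scalar[of m g]
  by (intro M.minus_equality[symmetric]) auto

lemma act_uminus:
  "\<lbrakk>r \<in> R; g \<in> carrier G; m \<in> carrier M\<rbrakk> \<Longrightarrow> gmon r g \<odot>\<^bsub>M\<^esub> (\<ominus>\<^bsub>M\<^esub> m) = \<ominus>\<^bsub>M\<^esub> (gmon r g \<odot>\<^bsub>M\<^esub> m)"
  by (simp add: smult_r_minus)

end

section \<open>Based free modules: coordinates, the l1-norm and linear functionals\<close>

locale free_rg_module = rg_module G R M
  for G :: "('g, 'b) monoid_scheme" (structure) and R :: "complex set"
    and M :: "('g \<Rightarrow> complex, 'm) module" +
  fixes \<Lambda> :: "'m set"
  assumes finite_basis: "finite \<Lambda>" and basis: "free_basis (group_ring R G) M \<Lambda>"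
begin

definition cf :: "'m \<Rightarrow> 'm \<Rightarrow> 'g \<Rightarrow> complex" where
  "cf m = coords A M \<Lambda> m"

definition N :: "'m \<Rightarrow> real" where
  "N m = l1_norm R G M \<Lambda> m"

text \<open>The \<open>R\<close>-linear functional with value \<open>w x g\<close> at the basis element \<open>g \<cdot> x\<close>.\<close>

definition ext :: "('m \<Rightarrow> 'g \<Rightarrow> complex) \<Rightarrow> 'm \<Rightarrow> complex" where
  "ext w m = (\<Sum>x\<in>\<Lambda>. pairing (cf m x) (w x))"

lemma basis_subset: "\<Lambda> \<subseteq> carrier M"
  using basis by (simp add: free_basis_def)

lemma basis_in [simp]: "x \<in> \<Lambda> \<Longrightarrow> x \<in> carrier M"
  using basis_subset by blast

lemma cf_ex1: "m \<in> carrier M \<Longrightarrow> \<exists>!c. c \<in> carrier (free_module A \<Lambda>) \<and> lincomb A M c = m"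
  using basis by (simp add: free_basis_def)

lemma cf_in: "m \<in> carrier M \<Longrightarrow> cf m \<in> carrier (free_module A \<Lambda>)"
  and lincomb_cf: "m \<in> carrier M \<Longrightarrow> lincomb A M (cf m) = m"
  using theI'[OF cf_ex1] by (auto simp: cf_def coords_def)

lemma lincomb_hom: "lincomb A M \<in> left_module_hom A (free_module A \<Lambda>) M"
proof -
  have "lincomb A M = lin_ext A M (\<lambda>x. x)" by (intro ext lincomb_eq_lin_ext)
  then show ?thesis using lin_ext_hom[of "\<lambda>x. x" \<Lambda>] by auto
qed

lemma cf_unique:
  assumes "c \<in> carrier (free_module A \<Lambda>)" "lincomb A M c = m" shows "cf m = c"
proof -
  have "m \<in> carrier M" using left_module_homD(1)[OF lincomb_hom assms(1)] assms(2) by simp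
  then show ?thesis using cf_ex1 cf_in lincomb_cf assms by blast
qed

lemma cf_A: "m \<in> carrier M \<Longrightarrow> cf m x \<in> carrier A"
  using cf_in by (auto simp: free_module_simps)

lemma cf_outside: "m \<in> carrier M \<Longrightarrow> x \<notin> \<Lambda> \<Longrightarrow> cf m x = (\<lambda>_. 0)"
  using cf_in by (auto simp: free_module_simps A_simps)

lemma cf_add:
  assumes "m \<in> carrier M" "m' \<in> carrier M"
  shows "cf (m \<oplus>\<^bsub>M\<^esub> m') x = cf m x \<oplus>\<^bsub>A\<^esub> cf m' x"
proof -
  have "cf (m \<oplus>\<^bsub>M\<^esub> m') = cf m \<oplus>\<^bsub>free_module A \<Lambda>\<^esub> cf m'"
    using assms cf_in lincomb_cf left_module_homD(2)[OF lincomb_hom]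
    by (intro cf_unique A.free_module_add_closed) auto
  then show ?thesis by (simp add: free_module_simps)
qed

lemma cf_smult:
  assumes "a \<in> carrier A" "m \<in> carrier M"
  shows "cf (a \<odot>\<^bsub>M\<^esub> m) x = a \<otimes>\<^bsub>A\<^esub> cf m x"
proof -
  have "cf (a \<odot>\<^bsub>M\<^esub> m) = a \<odot>\<^bsub>free_module A \<Lambda>\<^esub> cf m"
    using assms cf_in lincomb_cf left_module_homD(3)[OF lincomb_hom]
    by (intro cf_unique A.free_module_smult_closed) auto
  then show ?thesis by (simp add: free_module_simps)
qed

lemma cf_basis: assumes "y \<in> \<Lambda>" shows "cf y x = (if x = y then gmon 1 \<one> else (\<lambda>_. 0))"
proof -
  have "cf y = basis_fun A y"
    using lin_ext_basis_fun[of "\<lambda>x. x" y] assms A.basis_fun_in[of y \<Lambda>]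
    by (intro cf_unique) (auto simp: lincomb_eq_lin_ext)
  then show ?thesis by (simp add: basis_fun_def A_simps)
qed

lemma cf_mon_basis:
  assumes "y \<in> \<Lambda>" "r \<in> R" "g \<in> carrier G"
  shows "cf (gmon r g \<odot>\<^bsub>M\<^esub> y) x = (if x = y then gmon r g else (\<lambda>_. 0))"
  using assms cf_smult[of "gmon r g" y x] A.r_one[of "gmon r g"] A.r_null[of "gmon r g"]
  by (auto simp: cf_basis A_simps(2,3))

lemma cf_inj: "m \<in> carrier M \<Longrightarrow> m' \<in> carrier M \<Longrightarrow> (\<And>x. cf m x = cf m' x) \<Longrightarrow> m = m'"
  using lincomb_cf by (metis HOL.ext)

lemma cf_zero: "cf \<zero>\<^bsub>M\<^esub> x = (\<lambda>_. 0)"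
  using cf_smult[of "\<zero>\<^bsub>A\<^esub>" "\<zero>\<^bsub>M\<^esub>" x] smult_l_null[of "\<zero>\<^bsub>M\<^esub>"] A.l_null[OF cf_A[of "\<zero>\<^bsub>M\<^esub>" x]]
    A.zero_closed
  by (simp add: A_simps(2))

lemma N_eq: assumes "m \<in> carrier M" shows "N m = (\<Sum>x\<in>\<Lambda>. nrm1 (cf m x))"
proof -
  have "{(x, g) \<in> \<Lambda> \<times> carrier G. cf m x g \<noteq> 0} = Sigma \<Lambda> (\<lambda>x. {g. cf m x g \<noteq> 0})"
    using cf_A[OF assms] by (auto simp: A_simps)
  then show ?thesis
    unfolding N_def l1_norm_def nrm1_def cf_def[symmetric]
    using finite_basis fin_A[OF cf_A[OF assms]] by (simp add: sum.Sigma)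
qed

lemma N_nonneg: "m \<in> carrier M \<Longrightarrow> N m \<ge> 0"
  by (simp add: N_eq sum_nonneg nrm1_nonneg)

lemma N_zero: "N \<zero>\<^bsub>M\<^esub> = 0"
  by (simp add: N_eq cf_zero nrm1_zero)

lemma N_add: "m \<in> carrier M \<Longrightarrow> m' \<in> carrier M \<Longrightarrow> N (m \<oplus>\<^bsub>M\<^esub> m') \<le> N m + N m'"
  by (simp add: N_eq cf_add sum.distrib[symmetric] sum_mono nrm1_A_add cf_A)

lemma N_act: "\<lbrakk>r \<in> R; g \<in> carrier G; m \<in> carrier M\<rbrakk> \<Longrightarrow> N (gmon r g \<odot>\<^bsub>M\<^esub> m) = cmod r * N m"
  by (simp add: N_eq cf_smult nrm1_mon_mult cf_A sum_distrib_left)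

lemma ext_zero: "ext w \<zero>\<^bsub>M\<^esub> = 0"
  by (simp add: ext_def cf_zero pairing_zero)

lemma ext_add: "m \<in> carrier M \<Longrightarrow> m' \<in> carrier M \<Longrightarrow> ext w (m \<oplus>\<^bsub>M\<^esub> m') = ext w m + ext w m'"
  by (simp add: ext_def cf_add pairing_A_add cf_A sum.distrib)

lemma ext_act: "\<lbrakk>r \<in> R; g \<in> carrier G; m \<in> carrier M\<rbrakk> \<Longrightarrow>
    ext w (gmon r g \<odot>\<^bsub>M\<^esub> m) = r * ext (\<lambda>x h. w x (g \<otimes> h)) m"
  by (simp add: ext_def cf_smult pairing_mon_mult cf_A sum_distrib_left)

lemma ext_fun_diff: "ext (\<lambda>x g. w x g - v x g) m = ext w m - ext v m"
  by (simp add: ext_def pairing_fun_diff sum_subtractf)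

lemma ext_mon_basis: "\<lbrakk>y \<in> \<Lambda>; r \<in> R; g \<in> carrier G\<rbrakk> \<Longrightarrow> ext w (gmon r g \<odot>\<^bsub>M\<^esub> y) = r * w y g"
  using finite_basis
  by (simp add: ext_def cf_mon_basis pairing_mon pairing_zero if_distrib[of "\<lambda>a. pairing a _"] sum.delta cong: if_cong)

text \<open>Removing one term of the basis expansion lowers the norm by exactly the absolute value
  of its coefficient, so the second argument of \<open>P\<close> follows the norm. Bounds that are
  linear in the norm thereby reduce to translated basis elements and the triangle
  inequality.\<close>

lemma l1_induct [consumes 1, case_names zero add]:
  assumes m: "m \<in> carrier M"
    and zero: "P \<zero>\<^bsub>M\<^esub> 0"
    and add: "\<And>m n r g y. \<lbrakk>m \<in> carrier M; P m n; n \<ge> 0; r \<in> R; g \<in> carrier G; y \<in> \<Lambda>\<rbrakk> \<Longrightarrow>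
       P (m \<oplus>\<^bsub>M\<^esub> gmon r g \<odot>\<^bsub>M\<^esub> y) (n + cmod r)"
  shows "P m (N m)"
  using m
proof (induction "\<Sum>x\<in>\<Lambda>. card {g. cf m x g \<noteq> 0}" arbitrary: m rule: less_induct)
  case less
  show ?case
  proof (cases "\<exists>y\<in>\<Lambda>. \<exists>g. cf m y g \<noteq> 0")
    case False
    then have "cf m x = cf \<zero>\<^bsub>M\<^esub> x" for x
      using cf_outside[OF less.prems] by (cases "x \<in> \<Lambda>") (auto simp: cf_zero)
    then have "m = \<zero>\<^bsub>M\<^esub>" using cf_inj less.prems by blast
    then show ?thesis using zero N_zero by simp
  next
    case True
    then obtain y g where y: "y \<in> \<Lambda>" and g: "cf m y g \<noteq> 0" by blast
    define r where "r = cf m y g"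
    have gG: "g \<in> carrier G" and r: "r \<in> R" using g cf_A[OF less.prems, of y] by (auto simp: A_simps r_def)
    define m' where "m' = m \<oplus>\<^bsub>M\<^esub> gmon (- r) g \<odot>\<^bsub>M\<^esub> y"
    have m': "m' \<in> carrier M" using less.prems y gG r R_closed(5) by (simp add: m'_def)
    have cf': "cf m' x = (if x = y then (cf m x)(g := 0) else cf m x)" for x
    proof -
      have "cf m' x = cf m x \<oplus>\<^bsub>A\<^esub> cf (gmon (- r) g \<odot>\<^bsub>M\<^esub> y) x"
        using less.prems y gG r R_closed(5) by (simp add: m'_def cf_add)
      then show ?thesis
        unfolding cf_mon_basis[OF y R_closed(5)[OF r] gG] A_simps(4) by (auto simp: gmon_def r_def)
    qed
    have m_eq: "m = m' \<oplus>\<^bsub>M\<^esub> gmon r g \<odot>\<^bsub>M\<^esub> y"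
      using less.prems y gG r R_closed(5) act_add_scalar[of "- r" g r y] act_zero_scalar[of y g]
      by (simp add: m'_def M.a_assoc)
    have fin: "finite {h. cf m y h \<noteq> 0}" using fin_A[OF cf_A[OF less.prems]] .
    have supp: "{h. ((cf m y)(g := 0)) h \<noteq> 0} = {h. cf m y h \<noteq> 0} - {g}" by auto
    have "(\<Sum>x\<in>\<Lambda>. card {h. cf m' x h \<noteq> 0}) < (\<Sum>x\<in>\<Lambda>. card {h. cf m x h \<noteq> 0})"
    proof (rule sum_strict_mono_ex1[OF finite_basis])
      show "\<forall>x\<in>\<Lambda>. card {h. cf m' x h \<noteq> 0} \<le> card {h. cf m x h \<noteq> 0}"
        using fin by (auto simp: cf' supp intro!: card_mono)
      show "\<exists>x\<in>\<Lambda>. card {h. cf m' x h \<noteq> 0} < card {h. cf m x h \<noteq> 0}"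
        using y g fin by (intro bexI[of _ y]) (auto simp: cf' supp intro!: psubset_card_mono)
    qed
    then have "P m' (N m')" using less.hyps m' by blast
    then have "P m (N m' + cmod r)"
      using add[OF m' _ N_nonneg[OF m'] r gG y] m_eq by simp
    moreover have "N m' + cmod r = N m"
    proof -
      have "nrm1 (cf m y) = (\<Sum>h\<in>insert g ({h. cf m y h \<noteq> 0} - {g}). cmod (cf m y h))"
        using fin by (intro nrm1_superset) auto
      also have "\<dots> = cmod r + (\<Sum>h\<in>{h. cf m y h \<noteq> 0} - {g}. cmod (cf m y h))"
        using fin by (subst sum.insert) (auto simp: r_def)
      also have "(\<Sum>h\<in>{h. cf m y h \<noteq> 0} - {g}. cmod (cf m y h)) = nrm1 ((cf m y)(g := 0))"
        unfolding nrm1_def supp by (intro sum.cong) auto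
      finally have "nrm1 (cf m y) = cmod r + nrm1 (cf m' y)" by (simp add: cf')
      moreover have "N m = nrm1 (cf m y) + (\<Sum>x\<in>\<Lambda> - {y}. nrm1 (cf m x))"
        using less.prems finite_basis y by (simp add: N_eq sum.remove)
      moreover have "N m' = nrm1 (cf m' y) + (\<Sum>x\<in>\<Lambda> - {y}. nrm1 (cf m x))"
        using m' finite_basis y by (simp add: N_eq sum.remove[of _ y] cf')
      ultimately show ?thesis by simp
    qed
    ultimately show ?thesis by simp
  qed
qed

end

section \<open>Word metrics\<close>

locale generated_group = group G for G :: "('g, 'b) monoid_scheme" (structure) +
  fixes S :: "'g set"
  assumes S_subset: "S \<subseteq> carrier G" and generates: "generate G S = carrier G"
begin

definition letters :: "'g set" where
  "letters = S \<union> m_inv G ` S"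

definition wprod :: "'g list \<Rightarrow> 'g" where
  "wprod ws = foldr (\<lambda>x y. x \<otimes> y) ws \<one>"

definition wl :: "'g \<Rightarrow> nat" where
  "wl g = word_length G S g"

definition wdist :: "'g \<Rightarrow> 'g \<Rightarrow> nat" where
  "wdist x y = wl (inv x \<otimes> y)"

lemma letters_subset: "letters \<subseteq> carrier G"
  using S_subset by (auto simp: letters_def)

lemma inv_letters: "s \<in> letters \<Longrightarrow> inv s \<in> letters"
  using S_subset by (auto simp: letters_def subset_iff)

lemma wprod_simps [simp]: "wprod [] = \<one>" "wprod (x # ws) = x \<otimes> wprod ws"
  by (simp_all add: wprod_def)

lemma wprod_closed [simp]: "set ws \<subseteq> letters \<Longrightarrow> wprod ws \<in> carrier G"
  using letters_subset by (induction ws) auto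

lemma wprod_append: "set ws \<subseteq> letters \<Longrightarrow> set vs \<subseteq> letters \<Longrightarrow> wprod (ws @ vs) = wprod ws \<otimes> wprod vs"
  using letters_subset by (induction ws) (auto simp: m_assoc subset_iff)

lemma wprod_inv: "set ws \<subseteq> letters \<Longrightarrow> \<exists>vs. set vs \<subseteq> letters \<and> length vs = length ws \<and> wprod vs = inv (wprod ws)"
proof (induction ws)
  case (Cons x ws)
  then obtain vs where vs: "set vs \<subseteq> letters" "length vs = length ws" "wprod vs = inv (wprod ws)" by auto
  have x: "x \<in> carrier G" "inv x \<in> letters" using Cons.prems letters_subset inv_letters by auto
  then have "wprod (vs @ [inv x]) = inv (wprod (x # ws))"
    using vs Cons.prems by (subst wprod_append) (auto simp: inv_mult_group)
  then show ?case using vs x by (intro exI[of _ "vs @ [inv x]"]) auto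
qed simp

lemma word_exists: assumes "g \<in> carrier G" shows "\<exists>ws. set ws \<subseteq> letters \<and> wprod ws = g"
proof -
  have "g \<in> generate G S" using assms generates by simp
  then show ?thesis
  proof (induction rule: generate.induct)
    case one
    show ?case by (intro exI[of _ "[]"]) auto
  next
    case (incl h)
    then show ?case using S_subset by (intro exI[of _ "[h]"]) (auto simp: letters_def)
  next
    case (inv h)
    then show ?case using S_subset by (intro exI[of _ "[inv h]"]) (auto simp: letters_def)
  next
    case (eng h1 h2)
    then obtain ws vs where "set ws \<subseteq> letters" "wprod ws = h1" "set vs \<subseteq> letters" "wprod vs = h2" by blast
    then show ?case by (intro exI[of _ "ws @ vs"]) (auto simp: wprod_append)
  qed
qed

lemma wl_def': "wl g = (LEAST n. \<exists>ws. length ws = n \<and> set ws \<subseteq> letters \<and> wprod ws = g)"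
  by (simp add: wl_def word_length_def letters_def wprod_def)

lemma wl_word: assumes "g \<in> carrier G" shows "\<exists>ws. length ws = wl g \<and> set ws \<subseteq> letters \<and> wprod ws = g"
  unfolding wl_def' by (rule LeastI_ex) (use word_exists[OF assms] in blast)

lemma wl_le: "set ws \<subseteq> letters \<Longrightarrow> wl (wprod ws) \<le> length ws"
  unfolding wl_def' by (rule Least_le) blast

lemma wl_one [simp]: "wl \<one> = 0"
  using wl_le[of "[]"] by simp

lemma wl_eq_0: "g \<in> carrier G \<Longrightarrow> wl g = 0 \<Longrightarrow> g = \<one>"
  using wl_word[of g] by auto

lemma wl_mult: assumes "g \<in> carrier G" "h \<in> carrier G" shows "wl (g \<otimes> h) \<le> wl g + wl h"
proof -
  obtain ws vs where "length ws = wl g" "set ws \<subseteq> letters" "wprod ws = g"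
    "length vs = wl h" "set vs \<subseteq> letters" "wprod vs = h"
    using wl_word assms by meson
  then show ?thesis using wl_le[of "ws @ vs"] by (simp add: wprod_append)
qed

lemma wl_inv_le: assumes "g \<in> carrier G" shows "wl (inv g) \<le> wl g"
proof -
  obtain ws where "length ws = wl g" "set ws \<subseteq> letters" "wprod ws = g" using wl_word assms by meson
  then show ?thesis using wprod_inv[of ws] wl_le by metis
qed

lemma wl_inv: "g \<in> carrier G \<Longrightarrow> wl (inv g) = wl g"
  using wl_inv_le[of g] wl_inv_le[of "inv g"] by simp

lemma wdist_translate:
  assumes "g \<in> carrier G" "x \<in> carrier G" "y \<in> carrier G"
  shows "wdist (g \<otimes> x) (g \<otimes> y) = wdist x y"
proof -
  have "inv (g \<otimes> x) \<otimes> (g \<otimes> y) = inv x \<otimes> (inv g \<otimes> (g \<otimes> y))" using assms by (simp add: inv_mult_group m_assoc)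
  also have "inv g \<otimes> (g \<otimes> y) = y" using assms by (simp add: m_assoc[symmetric])
  finally show ?thesis by (simp add: wdist_def)
qed

lemma wdist_mult: "x \<in> carrier G \<Longrightarrow> h \<in> carrier G \<Longrightarrow> wdist x (x \<otimes> h) = wl h"
  by (simp add: wdist_def m_assoc[symmetric])

lemma wdist_triangle:
  assumes "x \<in> carrier G" "y \<in> carrier G" "z \<in> carrier G"
  shows "wdist x z \<le> wdist x y + wdist y z"
proof -
  have "inv x \<otimes> z = (inv x \<otimes> y) \<otimes> (inv y \<otimes> z)"
    using assms by (simp add: m_assoc) (simp add: m_assoc[symmetric])
  then show ?thesis using wl_mult[of "inv x \<otimes> y" "inv y \<otimes> z"] assms by (simp add: wdist_def)
qed

lemma wdist_sym: assumes "x \<in> carrier G" "y \<in> carrier G" shows "wdist x y = wdist y x"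
proof -
  have "inv (inv x \<otimes> y) = inv y \<otimes> x" using assms by (simp add: inv_mult_group)
  then show ?thesis using wl_inv[of "inv x \<otimes> y"] assms by (simp add: wdist_def)
qed

lemma wdist_eq_0: assumes "x \<in> carrier G" "y \<in> carrier G" shows "wdist x y = 0 \<longleftrightarrow> x = y"
proof
  assume "wdist x y = 0"
  then have "inv x \<otimes> y = \<one>" using assms wl_eq_0 by (simp add: wdist_def)
  then show "x = y" using assms inv_solve_left'[of \<one> x y] by simp
qed (use assms in \<open>simp add: wdist_def\<close>)

lemma subword_dist:
  assumes "x \<in> carrier G" "set ws \<subseteq> letters" "i \<le> j" "j \<le> length ws"
  shows "wdist (x \<otimes> wprod (take i ws)) (x \<otimes> wprod (take j ws)) = wl (wprod (take (j - i) (drop i ws)))"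
proof -
  have sub: "set (take i ws) \<subseteq> letters" "set (take (j - i) (drop i ws)) \<subseteq> letters" "set (take j ws) \<subseteq> letters"
    using assms(2) set_take_subset set_drop_subset by (meson subset_trans)+
  have "take j ws = take i ws @ take (j - i) (drop i ws)"
    using assms(3) take_add[of i "j - i" ws] by simp
  then have "wprod (take j ws) = wprod (take i ws) \<otimes> wprod (take (j - i) (drop i ws))"
    using sub wprod_append by simp
  then show ?thesis using assms(1) sub by (simp add: wdist_translate wdist_mult)
qed

text \<open>A shortest word for \<open>inv x \<otimes> y\<close> spells a geodesic: its subwords
  bound the partial distances from above, and since these bounds add up to the total distance, they
  are attained.\<close>

lemma graph_metric_wdist: "graph_metric (carrier G) wdist"
proof
  fix x y assume xy: "x \<in> carrier G" "y \<in> carrier G"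
  then have "inv x \<otimes> y \<in> carrier G" by simp
  then obtain ws where ws: "length ws = wdist x y" "set ws \<subseteq> letters" "wprod ws = inv x \<otimes> y"
    using wl_word unfolding wdist_def by blast
  define \<gamma> where "\<gamma> i = x \<otimes> wprod (take i ws)" for i
  have sub: "set (take i ws) \<subseteq> letters" for i using ws(2) set_take_subset by (meson subset_trans)
  have y: "\<gamma> (wdist x y) = y" using ws xy by (simp add: \<gamma>_def m_assoc[symmetric])
  have x: "\<gamma> 0 = x" using xy by (simp add: \<gamma>_def)
  have cl: "\<gamma> i \<in> carrier G" for i using xy sub by (simp add: \<gamma>_def)
  have le: "wdist (\<gamma> i) (\<gamma> j) \<le> j - i" if "i \<le> j" "j \<le> wdist x y" for i j
  proof -
    have "set (take (j - i) (drop i ws)) \<subseteq> letters"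
      using ws(2) set_take_subset set_drop_subset by (meson subset_trans)
    then show ?thesis
      using subword_dist[OF xy(1) ws(2) that(1)] that wl_le[of "take (j - i) (drop i ws)"] ws(1) by (simp add: \<gamma>_def)
  qed
  have "wdist (\<gamma> i) (\<gamma> j) = j - i" if ij: "i \<le> j" "j \<le> wdist x y" for i j
  proof -
    have "wdist x y \<le> wdist x (\<gamma> i) + wdist (\<gamma> i) y" using xy cl by (intro wdist_triangle)
    also have "wdist (\<gamma> i) y \<le> wdist (\<gamma> i) (\<gamma> j) + wdist (\<gamma> j) y" using xy cl by (intro wdist_triangle)
    finally show ?thesis
      using le[of 0 i] le[OF ij] le[of j "wdist x y"] ij x y by simp
  qed
  then show "\<exists>\<gamma>. \<gamma> 0 = x \<and> \<gamma> (wdist x y) = y \<and> (\<forall>i\<le>wdist x y. \<gamma> i \<in> carrier G) \<and>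
      (\<forall>i j. i \<le> j \<and> j \<le> wdist x y \<longrightarrow> wdist (\<gamma> i) (\<gamma> j) = j - i)"
    using x y cl by (intro exI[of _ \<gamma>]) auto
qed (use wdist_eq_0 wdist_sym wdist_triangle in auto)

lemma word_metric_eq: "x \<in> carrier G \<Longrightarrow> y \<in> carrier G \<Longrightarrow> word_metric G S x y = real (wdist x y)"
  by (simp add: word_metric_def wdist_def wl_def)

lemma Metric_space_word_metric: "Metric_space (carrier G) (word_metric G S)"
proof
  show "0 \<le> word_metric G S x y" for x y by (simp add: word_metric_def)
  show "word_metric G S x y = word_metric G S y x" for x y
    using wdist_sym[of x y]
    by (cases "x \<in> carrier G"; cases "y \<in> carrier G") (simp_all add: word_metric_eq, simp_all add: word_metric_def)
  show "(word_metric G S x y = 0) = (x = y)" if "x \<in> carrier G" "y \<in> carrier G" for x y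
    using that by (simp add: word_metric_eq wdist_eq_0)
  show "word_metric G S x z \<le> word_metric G S x y + word_metric G S y z"
    if "x \<in> carrier G" "y \<in> carrier G" "z \<in> carrier G" for x y z
    using that wdist_triangle[of x y z] by (simp add: word_metric_eq)
qed

text \<open>Dehn's algorithm: the four-point condition is applied to a point of the loop farthest from
  the base point, its two neighbours at distance \<open>r\<close> along the loop, and the base point.\<close>

lemma Dehn_shortcut:
  assumes four: "\<And>x y z w. \<lbrakk>x \<in> carrier G; y \<in> carrier G; z \<in> carrier G; w \<in> carrier G\<rbrakk> \<Longrightarrow>
      real (wdist w x + wdist y z) \<le> real (max (wdist w y + wdist x z) (wdist w z + wdist x y)) + D"
    and r: "real r > D"
    and ws: "set ws \<subseteq> letters" "wprod ws = \<one>" "length ws \<ge> r"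
  shows "\<exists>us vs ws'. ws = us @ vs @ ws' \<and> length vs \<le> 2 * r \<and> wl (wprod vs) < length vs"
proof (rule ccontr)
  assume no: "\<not> ?thesis"
  define p where "p i = wprod (take i ws)" for i
  define n where "n = length ws"
  have sub: "set (take i ws) \<subseteq> letters" "set (take j (drop i ws)) \<subseteq> letters" "set (drop i ws) \<subseteq> letters" for i j
    using ws(1) set_take_subset set_drop_subset by (meson subset_trans)+
  have pG: "p i \<in> carrier G" for i using sub by (simp add: p_def)
  \<comment> \<open>By the contrary assumption, all subwords of length at most \<open>2 * r\<close>
    are geodesic.\<close>
  have dist: "wdist (p i) (p (i + l)) = l" if "i + l \<le> n" "l \<le> 2 * r" for i l
  proof -
    have "wdist (p i) (p (i + l)) = wl (wprod (take l (drop i ws)))"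
      using subword_dist[of \<one> ws i "i + l"] ws(1) that pG sub by (simp add: p_def n_def)
    moreover have "ws = take i ws @ take l (drop i ws) @ drop l (drop i ws)"
      by (simp only: append_take_drop_id)
    then have "\<not> wl (wprod (take l (drop i ws))) < length (take l (drop i ws))"
    proof -
      have "length (take l (drop i ws)) \<le> 2 * r" using that by simp
      then show ?thesis using no \<open>ws = _\<close> by blast
    qed
    moreover have "length (take l (drop i ws)) = l" using that by (simp add: n_def)
    ultimately show ?thesis using wl_le[OF sub(2), of l i] by linarith
  qed
  have p0: "p 0 = \<one>" by (simp add: p_def)
  have dist1: "wdist \<one> (p i) = wl (p i)" for i using pG by (simp add: wdist_def)
  obtain m where m: "m \<le> n" "\<And>i. i \<le> n \<Longrightarrow> wl (p i) \<le> wl (p m)"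
  proof -
    let ?W = "(\<lambda>i. wl (p i)) ` {..n}"
    have "Max ?W \<in> ?W" by (intro Max_in) auto
    then obtain m where m: "m \<in> {..n}" "Max ?W = wl (p m)" by blast
    have "wl (p i) \<le> wl (p m)" if "i \<le> n" for i
      unfolding m(2)[symmetric] using that by (intro Max_ge) auto
    then show thesis using that[of m] m(1) by simp
  qed
  \<comment> \<open>The farthest point has distance at least \<open>r\<close> from the base point,
    hence lies at least \<open>r\<close> letters away from both ends of the word. Its two neighbours
    at distance \<open>r\<close> therefore exist.\<close>
  have "r \<le> wl (p m)" using m(2)[of r] dist[of 0 r] dist1[of r] p0 ws(3) by (simp add: n_def)
  moreover have "wl (p m) \<le> m" using wl_le[OF sub(1), of m] m(1) by (simp add: p_def n_def)
  moreover have "wl (p m) \<le> n - m"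
  proof -
    have "p m \<otimes> wprod (drop m ws) = \<one>"
      using wprod_append[OF sub(1) sub(3), of m m] ws(2) by (simp add: p_def)
    then have "p m = inv (wprod (drop m ws))" using pG sub by (metis inv_equality wprod_closed)
    then show ?thesis using wl_inv[of "wprod (drop m ws)"] wl_le[OF sub(3), of m] sub by (simp add: n_def)
  qed
  ultimately have mr: "r \<le> m" "m + r \<le> n" using m(1) by auto
  have "m - r + 2 * r = m + r" using mr by simp
  moreover have "wdist (p (m - r)) (p (m - r + 2 * r)) = 2 * r" using mr by (intro dist) auto
  ultimately have 1: "wdist (p (m - r)) (p m) = r" "wdist (p m) (p (m + r)) = r"
      "wdist (p (m - r)) (p (m + r)) = 2 * r"
    using dist[of "m - r" r] dist[of m r] mr by (simp_all only:) auto
  \<comment> \<open>Neither neighbour is farther from the base point than \<open>p m\<close>, so the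
    right side is at most \<open>wl (p m) + r + D\<close>, which forces
    \<open>r \<le> D\<close>.\<close>
  have "real (wl (p m) + 2 * r) \<le> real (max (wl (p (m - r)) + r) (wl (p (m + r)) + r)) + D"
    using four[of "p m" "p (m - r)" "p (m + r)" \<one>] pG 1 wdist_sym[OF pG pG, of m "m - r"] by (simp add: dist1)
  also have "max (wl (p (m - r)) + r) (wl (p (m + r)) + r) \<le> wl (p m) + r"
    using m(2)[of "m - r"] m(2)[of "m + r"] mr by simp
  finally show False using r by simp
qed

text \<open>Doubling the inequality of Gromov products and cancelling the distances to
  \<open>w\<close> gives the symmetric four-point form, with \<open>x\<close> and \<open>y\<close>
  interchanged. The sign of \<open>D\<close> is unrestricted, whereas \<open>\<delta>\<close> must
  be nonnegative; hence the absolute value.\<close>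

lemma hyperbolic_iff_four_point:
  "Gromov_hyperbolic_space (carrier G) (word_metric G S) \<longleftrightarrow>
   (\<exists>D. \<forall>x\<in>carrier G. \<forall>y\<in>carrier G. \<forall>z\<in>carrier G. \<forall>w\<in>carrier G.
      real (wdist w x + wdist y z) \<le> real (max (wdist w y + wdist x z) (wdist w z + wdist x y)) + D)"
  (is "?L \<longleftrightarrow> ?R")
proof
  assume ?L
  then obtain \<delta> where \<delta>: "\<forall>x\<in>carrier G. \<forall>y\<in>carrier G. \<forall>z\<in>carrier G. \<forall>w\<in>carrier G.
     min (Gromov_product (word_metric G S) w x y) (Gromov_product (word_metric G S) w y z) - \<delta>
       \<le> Gromov_product (word_metric G S) w x z"
    unfolding Gromov_hyperbolic_space_def by blast
  show ?R
  proof (intro exI[of _ "2 * \<delta>"] ballI)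
    fix x y z w assume G: "x \<in> carrier G" "y \<in> carrier G" "z \<in> carrier G" "w \<in> carrier G"
    have "min (Gromov_product (word_metric G S) w y x) (Gromov_product (word_metric G S) w x z) - \<delta>
       \<le> Gromov_product (word_metric G S) w y z" using \<delta> G by blast
    then show "real (wdist w x + wdist y z) \<le> real (max (wdist w y + wdist x z) (wdist w z + wdist x y)) + 2 * \<delta>"
      using wdist_sym[of w x] wdist_sym[of w y] wdist_sym[of w z] wdist_sym[of y x] G
      by (simp add: Gromov_product_def word_metric_eq min_def max_def field_simps split: if_splits)
  qed
next
  assume ?R
  then obtain D where D: "\<And>x y z w. \<lbrakk>x \<in> carrier G; y \<in> carrier G; z \<in> carrier G; w \<in> carrier G\<rbrakk> \<Longrightarrow>
      real (wdist w x + wdist y z) \<le> real (max (wdist w y + wdist x z) (wdist w z + wdist x y)) + D"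
    by blast
  show ?L
    unfolding Gromov_hyperbolic_space_def
  proof (intro conjI exI[of _ "\<bar>D\<bar>"] ballI Metric_space_word_metric)
    fix x y z w assume G: "x \<in> carrier G" "y \<in> carrier G" "z \<in> carrier G" "w \<in> carrier G"
    show "min (Gromov_product (word_metric G S) w x y) (Gromov_product (word_metric G S) w y z) - \<bar>D\<bar>
       \<le> Gromov_product (word_metric G S) w x z"
      using D[of y x z w] wdist_sym[of w x] wdist_sym[of w y] wdist_sym[of w z] wdist_sym[of y x] G
      by (simp add: Gromov_product_def word_metric_eq min_def max_def field_simps split: if_splits)
  qed simp
qed

end

section \<open>Partial resolutions of the trivial module\<close>

definition regular_module :: "('a, 'c) ring_scheme \<Rightarrow> ('a, 'a) module" where
  "regular_module A = \<lparr>carrier = carrier A, mult = undefined, one = undefined,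
     zero = \<zero>\<^bsub>A\<^esub>, add = (\<lambda>a b. a \<oplus>\<^bsub>A\<^esub> b), smult = (\<lambda>a b. a \<otimes>\<^bsub>A\<^esub> b)\<rparr>"

lemma regular_module_simps:
  "carrier (regular_module A) = carrier A" "\<zero>\<^bsub>regular_module A\<^esub> = \<zero>\<^bsub>A\<^esub>"
  "a \<oplus>\<^bsub>regular_module A\<^esub> b = a \<oplus>\<^bsub>A\<^esub> b" "a \<odot>\<^bsub>regular_module A\<^esub> b = a \<otimes>\<^bsub>A\<^esub> b"
  by (simp_all add: regular_module_def)

lemma (in ring) left_module_regular: "left_module R (regular_module R)"
proof -
  have "abelian_group (regular_module R)"
    by (rule abelian_groupI)
      (auto simp: regular_module_simps a_ac intro: l_neg exI[of _ "\<ominus> _"])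
  then show ?thesis
    by (intro left_module.intro ring_axioms left_module_axioms.intro)
      (auto simp: regular_module_simps l_distr r_distr m_assoc)
qed

text \<open>Degrees 0 to 2 of a 1-admissible resolution. \<open>C0\<close> comes without a basis, so
  its elements have to be studied through a map to the group ring.\<close>

locale fp2_complex = coeff_group G R
  for G :: "('g, 'b) monoid_scheme" (structure) and R :: "complex set" +
  fixes C0 C1 C2 :: "('g \<Rightarrow> complex, 'm) module" and d1 d2 :: "'m \<Rightarrow> 'm" and \<epsilon> :: "'m \<Rightarrow> complex"
    and \<Lambda>1 \<Lambda>2 :: "'m set"
  assumes trivial: "left_module (group_ring R G) (trivial_module R)"
    and proj: "projective_module (group_ring R G) C0"
    and basis1: "finite \<Lambda>1" "free_basis (group_ring R G) C1 \<Lambda>1"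
    and basis2: "finite \<Lambda>2" "free_basis (group_ring R G) C2 \<Lambda>2"
    and d1_hom: "d1 \<in> left_module_hom (group_ring R G) C1 C0"
    and d2_hom: "d2 \<in> left_module_hom (group_ring R G) C2 C1"
    and \<epsilon>_hom: "\<epsilon> \<in> left_module_hom (group_ring R G) C0 (trivial_module R)"
    and \<epsilon>_surj: "\<epsilon> ` carrier C0 = R"
    and exact0: "d1 ` carrier C1 = {x \<in> carrier C0. \<epsilon> x = 0}"
    and exact1: "d2 ` carrier C2 = {x \<in> carrier C1. d1 x = \<zero>\<^bsub>C0\<^esub>}"

sublocale fp2_complex \<subseteq> C0: rg_module G R C0
  using proj by (intro rg_module.intro coeff_group_axioms plain_left_module.intro) (simp add: projective_module_def)

sublocale fp2_complex \<subseteq> C1: free_rg_module G R C1 \<Lambda>1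
  using basis1 by (intro free_rg_module.intro rg_module.intro coeff_group_axioms plain_left_module.intro
    free_rg_module_axioms.intro) (simp_all add: free_basis_def)

sublocale fp2_complex \<subseteq> C2: free_rg_module G R C2 \<Lambda>2
  using basis2 by (intro free_rg_module.intro rg_module.intro coeff_group_axioms plain_left_module.intro
    free_rg_module_axioms.intro) (simp_all add: free_basis_def)

context fp2_complex
begin

lemma trivial_simps:
  "carrier (trivial_module R) = R" "x \<oplus>\<^bsub>trivial_module R\<^esub> y = x + y" "\<zero>\<^bsub>trivial_module R\<^esub> = 0"
  "a \<odot>\<^bsub>trivial_module R\<^esub> x = pairing a (\<lambda>_. 1) * x"
  by (simp_all add: trivial_module_def pairing_def)

lemma aug_hom: "(\<lambda>a. pairing a (\<lambda>_. 1)) \<in> left_module_hom A (regular_module A) (trivial_module R)"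
proof -
  interpret T: left_module A "trivial_module R" by (rule trivial)
  have 1: "pairing a (\<lambda>_. 1) \<in> R" if "a \<in> carrier A" for a
    using T.smult_closed[OF that, of 1] R_closed by (simp add: trivial_simps)
  \<comment> \<open>The augmentation is multiplicative by associativity of the action on the trivial
    module, evaluated at 1.\<close>
  have 2: "pairing (a \<otimes>\<^bsub>A\<^esub> b) (\<lambda>_. 1) = pairing a (\<lambda>_. 1) * pairing b (\<lambda>_. 1)"
    if "a \<in> carrier A" "b \<in> carrier A" for a b
    using T.smult_assoc[OF that, of 1] R_closed by (simp add: trivial_simps)
  show ?thesis
    using 1 2 by (auto simp: left_module_hom_def trivial_simps regular_module_simps pairing_A_add)
qed

text \<open>A lift of \<open>\<epsilon>\<close> through the augmentation of the group ring, i.e. a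
  comparison with the 0-chains of a Cayley graph. It takes the place of coordinates on
  \<open>C0\<close>.\<close>

definition phi :: "'m \<Rightarrow> 'g \<Rightarrow> complex" where
  "phi = (SOME h. h \<in> left_module_hom A C0 (regular_module A) \<and>
            (\<forall>x\<in>carrier C0. pairing (h x) (\<lambda>_. 1) = \<epsilon> x))"

lemma phi: "phi \<in> left_module_hom A C0 (regular_module A)"
  and aug_phi: "x \<in> carrier C0 \<Longrightarrow> pairing (phi x) (\<lambda>_. 1) = \<epsilon> x"
proof -
  have "\<epsilon> ` carrier C0 \<subseteq> (\<lambda>a. pairing a (\<lambda>_. 1)) ` carrier (regular_module A)"
  proof
    fix r assume "r \<in> \<epsilon> ` carrier C0"
    then have "r \<in> R" using \<epsilon>_surj by simp
    then have "gmon r \<one> \<in> carrier A" "r = pairing (gmon r \<one>) (\<lambda>_. 1)" by (simp_all add: pairing_mon)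
    then show "r \<in> (\<lambda>a. pairing a (\<lambda>_. 1)) ` carrier (regular_module A)"
      unfolding regular_module_simps by blast
  qed
  then have "\<exists>h. h \<in> left_module_hom A C0 (regular_module A) \<and>
            (\<forall>x\<in>carrier C0. pairing (h x) (\<lambda>_. 1) = \<epsilon> x)"
    using projective_lift[OF proj C0.A.left_module_regular trivial \<epsilon>_hom aug_hom] by blast
  from someI_ex[OF this] show "phi \<in> left_module_hom A C0 (regular_module A)"
    "x \<in> carrier C0 \<Longrightarrow> pairing (phi x) (\<lambda>_. 1) = \<epsilon> x" unfolding phi_def by auto
qed

lemma phi_closed: "x \<in> carrier C0 \<Longrightarrow> phi x \<in> carrier A"
  and phi_add: "x \<in> carrier C0 \<Longrightarrow> y \<in> carrier C0 \<Longrightarrow> phi (x \<oplus>\<^bsub>C0\<^esub> y) = phi x \<oplus>\<^bsub>A\<^esub> phi y"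
  and phi_smult: "a \<in> carrier A \<Longrightarrow> x \<in> carrier C0 \<Longrightarrow> phi (a \<odot>\<^bsub>C0\<^esub> x) = a \<otimes>\<^bsub>A\<^esub> phi x"
  using left_module_homD[OF phi] by (auto simp: regular_module_simps)

lemma phi_zero: "phi \<zero>\<^bsub>C0\<^esub> = (\<lambda>_. 0)"
  using left_module_hom_zero[OF phi C0.M.abelian_group_axioms]
    left_module.axioms(2)[OF C0.A.left_module_regular]
  by (simp add: regular_module_simps A_simps)

text \<open>The base vertex: its translates stand for the vertices of the Cayley graph.\<close>

definition e0 :: 'm where
  "e0 = (SOME x. x \<in> carrier C0 \<and> \<epsilon> x = 1)"

lemma e0_in [simp]: "e0 \<in> carrier C0" and \<epsilon>_e0: "\<epsilon> e0 = 1"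
proof -
  have "1 \<in> \<epsilon> ` carrier C0" using \<epsilon>_surj R_closed by simp
  then have "\<exists>x. x \<in> carrier C0 \<and> \<epsilon> x = 1" by auto
  from someI_ex[OF this] show "e0 \<in> carrier C0" "\<epsilon> e0 = 1" by (auto simp: e0_def)
qed

lemma d1_closed [simp]: "x \<in> carrier C1 \<Longrightarrow> d1 x \<in> carrier C0"
  and d1_add: "x \<in> carrier C1 \<Longrightarrow> y \<in> carrier C1 \<Longrightarrow> d1 (x \<oplus>\<^bsub>C1\<^esub> y) = d1 x \<oplus>\<^bsub>C0\<^esub> d1 y"
  and d1_smult: "a \<in> carrier A \<Longrightarrow> x \<in> carrier C1 \<Longrightarrow> d1 (a \<odot>\<^bsub>C1\<^esub> x) = a \<odot>\<^bsub>C0\<^esub> d1 x"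
  using left_module_homD[OF d1_hom] by auto

lemma d2_closed [simp]: "x \<in> carrier C2 \<Longrightarrow> d2 x \<in> carrier C1"
  and d2_add: "x \<in> carrier C2 \<Longrightarrow> y \<in> carrier C2 \<Longrightarrow> d2 (x \<oplus>\<^bsub>C2\<^esub> y) = d2 x \<oplus>\<^bsub>C1\<^esub> d2 y"
  and d2_smult: "a \<in> carrier A \<Longrightarrow> x \<in> carrier C2 \<Longrightarrow> d2 (a \<odot>\<^bsub>C2\<^esub> x) = a \<odot>\<^bsub>C1\<^esub> d2 x"
  using left_module_homD[OF d2_hom] by auto

lemma d1_zero: "d1 \<zero>\<^bsub>C1\<^esub> = \<zero>\<^bsub>C0\<^esub>"
  by (rule left_module_hom_zero[OF d1_hom C1.M.abelian_group_axioms C0.M.abelian_group_axioms])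

lemma d2_zero: "d2 \<zero>\<^bsub>C2\<^esub> = \<zero>\<^bsub>C1\<^esub>"
  by (rule left_module_hom_zero[OF d2_hom C2.M.abelian_group_axioms C1.M.abelian_group_axioms])

lemma d1_uminus: "x \<in> carrier C1 \<Longrightarrow> d1 (\<ominus>\<^bsub>C1\<^esub> x) = \<ominus>\<^bsub>C0\<^esub> d1 x"
  by (rule left_module_hom_neg[OF d1_hom C1.M.abelian_group_axioms C0.M.abelian_group_axioms])

lemma d1_d2: "x \<in> carrier C2 \<Longrightarrow> d1 (d2 x) = \<zero>\<^bsub>C0\<^esub>"
  using exact1 by blast

lemma \<epsilon>_d1: "x \<in> carrier C1 \<Longrightarrow> \<epsilon> (d1 x) = 0"
  using exact0 by blast

lemma \<epsilon>_add: "x \<in> carrier C0 \<Longrightarrow> y \<in> carrier C0 \<Longrightarrow> \<epsilon> (x \<oplus>\<^bsub>C0\<^esub> y) = \<epsilon> x + \<epsilon> y"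
  and \<epsilon>_smult: "a \<in> carrier A \<Longrightarrow> x \<in> carrier C0 \<Longrightarrow> \<epsilon> (a \<odot>\<^bsub>C0\<^esub> x) = pairing a (\<lambda>_. 1) * \<epsilon> x"
  using left_module_homD[OF \<epsilon>_hom] by (auto simp: trivial_simps)

lemma \<epsilon>_uminus: assumes "x \<in> carrier C0" shows "\<epsilon> (\<ominus>\<^bsub>C0\<^esub> x) = - \<epsilon> x"
proof -
  have "\<epsilon> (\<ominus>\<^bsub>C0\<^esub> x) + \<epsilon> x = \<epsilon> \<zero>\<^bsub>C0\<^esub>" using \<epsilon>_add[of "\<ominus>\<^bsub>C0\<^esub> x" x] assms by (simp add: C0.M.l_neg)
  moreover have "\<epsilon> \<zero>\<^bsub>C0\<^esub> = 0" using \<epsilon>_d1[of "\<zero>\<^bsub>C1\<^esub>"] d1_zero by simp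
  ultimately show ?thesis by (simp add: add_eq_0_iff2)
qed

text \<open>The last property is obtained by averaging; it makes reversing an edge of the Cayley graph change
  the sign of the corresponding chain.\<close>

lemma psi_exists:
  "\<exists>\<psi>. \<forall>g\<in>carrier G. \<psi> g \<in> carrier C1 \<and> d1 (\<psi> g) = gmon 1 g \<odot>\<^bsub>C0\<^esub> e0 \<oplus>\<^bsub>C0\<^esub> \<ominus>\<^bsub>C0\<^esub> e0 \<and>
      gmon 1 g \<odot>\<^bsub>C1\<^esub> \<psi> (inv g) = \<ominus>\<^bsub>C1\<^esub> \<psi> g"
proof -
  have "\<exists>m\<in>carrier C1. d1 m = gmon 1 g \<odot>\<^bsub>C0\<^esub> e0 \<oplus>\<^bsub>C0\<^esub> \<ominus>\<^bsub>C0\<^esub> e0" if "g \<in> carrier G" for g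
  proof -
    have "gmon 1 g \<odot>\<^bsub>C0\<^esub> e0 \<oplus>\<^bsub>C0\<^esub> \<ominus>\<^bsub>C0\<^esub> e0 \<in> {x \<in> carrier C0. \<epsilon> x = 0}"
      using that R_closed by (simp add: \<epsilon>_add \<epsilon>_smult \<epsilon>_uminus \<epsilon>_e0 pairing_mon)
    then show ?thesis unfolding exact0[symmetric] by auto
  qed
  then obtain \<theta> where \<theta>: "\<And>g. g \<in> carrier G \<Longrightarrow> \<theta> g \<in> carrier C1"
      "\<And>g. g \<in> carrier G \<Longrightarrow> d1 (\<theta> g) = gmon 1 g \<odot>\<^bsub>C0\<^esub> e0 \<oplus>\<^bsub>C0\<^esub> \<ominus>\<^bsub>C0\<^esub> e0"
    by metis
  have half: "1/2 \<in> R" "- (1/2) \<in> R" by (auto intro!: R_rat)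
  note R1 = R_closed(2)
  \<comment> \<open>The chains \<open>\<theta> g\<close> and
    \<open>- g \<cdot> \<theta> (inv g)\<close> have the same boundary, and their mean is
    antisymmetric.\<close>
  define \<psi> where "\<psi> g = gmon (1/2) \<one> \<odot>\<^bsub>C1\<^esub> \<theta> g \<oplus>\<^bsub>C1\<^esub> gmon (- (1/2)) g \<odot>\<^bsub>C1\<^esub> \<theta> (inv g)" for g
  have \<psi>: "\<psi> g \<in> carrier C1" if "g \<in> carrier G" for g using that half \<theta> by (simp add: \<psi>_def)
  have neg: "\<ominus>\<^bsub>C0\<^esub> (gmon r g \<odot>\<^bsub>C0\<^esub> e0) = gmon (- r) g \<odot>\<^bsub>C0\<^esub> e0" if "r \<in> R" "g \<in> carrier G" for r g
    using C0.act_uminus_scalar[OF that e0_in] by simp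
  show ?thesis
  proof (intro exI[of _ \<psi>] ballI conjI)
    fix g assume g: "g \<in> carrier G"
    show "\<psi> g \<in> carrier C1" using \<psi> g .
    have e0: "\<ominus>\<^bsub>C0\<^esub> e0 = gmon (- 1) \<one> \<odot>\<^bsub>C0\<^esub> e0" using neg[of 1 \<one>] R1 C0.act_one by simp
    let ?a = "gmon (1/2) g \<odot>\<^bsub>C0\<^esub> e0" and ?b = "gmon (- (1/2)) \<one> \<odot>\<^bsub>C0\<^esub> e0"
    have ab: "?a \<in> carrier C0" "?b \<in> carrier C0" using half g by auto
    have "d1 (\<psi> g) = (?a \<oplus>\<^bsub>C0\<^esub> ?b) \<oplus>\<^bsub>C0\<^esub> (?b \<oplus>\<^bsub>C0\<^esub> ?a)"
      using g half R1 R_closed(5)[OF R1]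
      by (simp add: \<psi>_def d1_add d1_smult \<theta> C0.act_add e0 C0.act_act)
    also have "\<dots> = (?a \<oplus>\<^bsub>C0\<^esub> ?a) \<oplus>\<^bsub>C0\<^esub> (?b \<oplus>\<^bsub>C0\<^esub> ?b)"
      using ab by (simp add: C0.M.a_ac)
    also have "?a \<oplus>\<^bsub>C0\<^esub> ?a = gmon 1 g \<odot>\<^bsub>C0\<^esub> e0"
      using C0.act_add_scalar[of "1/2" g "1/2" e0] half g by simp
    also have "?b \<oplus>\<^bsub>C0\<^esub> ?b = \<ominus>\<^bsub>C0\<^esub> e0"
      using C0.act_add_scalar[of "-(1/2)" \<one> "-(1/2)" e0] half unfolding e0 by simp
    finally show "d1 (\<psi> g) = gmon 1 g \<odot>\<^bsub>C0\<^esub> e0 \<oplus>\<^bsub>C0\<^esub> \<ominus>\<^bsub>C0\<^esub> e0" .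
    have "gmon 1 g \<odot>\<^bsub>C1\<^esub> \<psi> (inv g) = gmon (1/2) g \<odot>\<^bsub>C1\<^esub> \<theta> (inv g) \<oplus>\<^bsub>C1\<^esub> gmon (- (1/2)) \<one> \<odot>\<^bsub>C1\<^esub> \<theta> g"
      using g half R1 by (simp add: \<psi>_def C1.act_add C1.act_act \<theta>)
    moreover have "\<ominus>\<^bsub>C1\<^esub> \<psi> g = gmon (- (1/2)) \<one> \<odot>\<^bsub>C1\<^esub> \<theta> g \<oplus>\<^bsub>C1\<^esub> gmon (1/2) g \<odot>\<^bsub>C1\<^esub> \<theta> (inv g)"
      using g half C1.act_uminus_scalar[of "1/2" \<one> "\<theta> g"] C1.act_uminus_scalar[of "-(1/2)" g "\<theta> (inv g)"]
      by (simp add: \<psi>_def \<theta> C1.M.minus_add)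
    ultimately show "gmon 1 g \<odot>\<^bsub>C1\<^esub> \<psi> (inv g) = \<ominus>\<^bsub>C1\<^esub> \<psi> g"
      using g half \<theta> by (simp add: C1.M.a_comm)
  qed
qed

definition psi :: "'g \<Rightarrow> 'm" where
  "psi = (SOME \<psi>. \<forall>g\<in>carrier G. \<psi> g \<in> carrier C1 \<and> d1 (\<psi> g) = gmon 1 g \<odot>\<^bsub>C0\<^esub> e0 \<oplus>\<^bsub>C0\<^esub> \<ominus>\<^bsub>C0\<^esub> e0 \<and>
      gmon 1 g \<odot>\<^bsub>C1\<^esub> \<psi> (inv g) = \<ominus>\<^bsub>C1\<^esub> \<psi> g)"

lemma psi_closed [simp]: "g \<in> carrier G \<Longrightarrow> psi g \<in> carrier C1"
  and d1_psi: "g \<in> carrier G \<Longrightarrow> d1 (psi g) = gmon 1 g \<odot>\<^bsub>C0\<^esub> e0 \<oplus>\<^bsub>C0\<^esub> \<ominus>\<^bsub>C0\<^esub> e0"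
  and psi_inv: "g \<in> carrier G \<Longrightarrow> gmon 1 g \<odot>\<^bsub>C1\<^esub> psi (inv g) = \<ominus>\<^bsub>C1\<^esub> psi g"
  using someI_ex[OF psi_exists] unfolding psi_def by blast+

text \<open>Available for any two vertices, adjacent or not. As a translate of \<open>psi\<close> it
  is equivariant, and its boundary is the difference of the two translates of
  \<open>e0\<close>.\<close>

definition edge :: "'g \<Rightarrow> 'g \<Rightarrow> 'm" where
  "edge x y = gmon 1 x \<odot>\<^bsub>C1\<^esub> psi (inv x \<otimes> y)"

lemma R1 [simp]: "1 \<in> R" "- 1 \<in> R" "0 \<in> R"
  using R_closed by auto

lemma edge_closed [simp]: "x \<in> carrier G \<Longrightarrow> y \<in> carrier G \<Longrightarrow> edge x y \<in> carrier C1"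
  by (simp add: edge_def)

lemma cancel_inv: "x \<in> carrier G \<Longrightarrow> y \<in> carrier G \<Longrightarrow> x \<otimes> (inv x \<otimes> y) = y"
  by (simp add: G.m_assoc[symmetric])

lemma d1_edge:
  assumes "x \<in> carrier G" "y \<in> carrier G"
  shows "d1 (edge x y) = gmon 1 y \<odot>\<^bsub>C0\<^esub> e0 \<oplus>\<^bsub>C0\<^esub> \<ominus>\<^bsub>C0\<^esub> (gmon 1 x \<odot>\<^bsub>C0\<^esub> e0)"
  using assms by (simp add: edge_def d1_smult d1_psi C0.act_add C0.act_act C0.act_uminus cancel_inv)

lemma edge_sym:
  assumes "x \<in> carrier G" "y \<in> carrier G"
  shows "edge y x = \<ominus>\<^bsub>C1\<^esub> edge x y"
proof -
  let ?t = "inv x \<otimes> y"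
  have t: "?t \<in> carrier G" "inv ?t = inv y \<otimes> x" using assms by (auto simp: G.inv_mult_group)
  have "\<ominus>\<^bsub>C1\<^esub> edge x y = gmon 1 x \<odot>\<^bsub>C1\<^esub> (gmon 1 ?t \<odot>\<^bsub>C1\<^esub> psi (inv ?t))"
    unfolding psi_inv[OF t(1)] using assms t(1) by (simp add: edge_def C1.act_uminus)
  also have "\<dots> = edge y x" using assms t by (simp add: C1.act_act cancel_inv edge_def)
  finally show ?thesis by simp
qed

lemma edge_translate:
  assumes "g \<in> carrier G" "x \<in> carrier G" "y \<in> carrier G"
  shows "gmon 1 g \<odot>\<^bsub>C1\<^esub> edge x y = edge (g \<otimes> x) (g \<otimes> y)"
proof -
  have "inv (g \<otimes> x) \<otimes> (g \<otimes> y) = inv x \<otimes> (inv g \<otimes> (g \<otimes> y))" using assms by (simp add: G.inv_mult_group G.m_assoc)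
  also have "inv g \<otimes> (g \<otimes> y) = y" using assms by (simp add: G.m_assoc[symmetric])
  finally show ?thesis using assms by (simp add: edge_def C1.act_act)
qed

fun walk_chain :: "'g list \<Rightarrow> 'm" where
  "walk_chain (x # y # zs) = edge x y \<oplus>\<^bsub>C1\<^esub> walk_chain (y # zs)"
| "walk_chain _ = \<zero>\<^bsub>C1\<^esub>"

lemma walk_chain_closed [simp]: "set xs \<subseteq> carrier G \<Longrightarrow> walk_chain xs \<in> carrier C1"
  by (induction xs rule: walk_chain.induct) auto

lemma d1_walk_chain:
  "xs \<noteq> [] \<Longrightarrow> set xs \<subseteq> carrier G \<Longrightarrow>
    d1 (walk_chain xs) = gmon 1 (last xs) \<odot>\<^bsub>C0\<^esub> e0 \<oplus>\<^bsub>C0\<^esub> \<ominus>\<^bsub>C0\<^esub> (gmon 1 (hd xs) \<odot>\<^bsub>C0\<^esub> e0)"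
proof (induction xs rule: walk_chain.induct)
  case (1 x y zs)
  let ?z = "gmon 1 (last (y # zs)) \<odot>\<^bsub>C0\<^esub> e0" and ?x = "gmon 1 x \<odot>\<^bsub>C0\<^esub> e0" and ?y = "gmon 1 y \<odot>\<^bsub>C0\<^esub> e0"
  have G: "x \<in> carrier G" "y \<in> carrier G" "last (y # zs) \<in> carrier G"
    using 1 last_in_set[of "y # zs"] by (auto simp del: last.simps last_in_set)
  have xyz: "?x \<in> carrier C0" "?y \<in> carrier C0" "?z \<in> carrier C0" using G by simp_all
  have "d1 (walk_chain (x # y # zs)) = (?y \<oplus>\<^bsub>C0\<^esub> \<ominus>\<^bsub>C0\<^esub> ?x) \<oplus>\<^bsub>C0\<^esub> (?z \<oplus>\<^bsub>C0\<^esub> \<ominus>\<^bsub>C0\<^esub> ?y)"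
    using 1 by (simp add: d1_add d1_edge)
  also have "\<dots> = (?y \<oplus>\<^bsub>C0\<^esub> \<ominus>\<^bsub>C0\<^esub> ?y) \<oplus>\<^bsub>C0\<^esub> (?z \<oplus>\<^bsub>C0\<^esub> \<ominus>\<^bsub>C0\<^esub> ?x)"
    using xyz by (simp add: C0.M.a_ac)
  also have "\<dots> = ?z \<oplus>\<^bsub>C0\<^esub> \<ominus>\<^bsub>C0\<^esub> ?x" using xyz by (simp add: C0.M.r_neg)
  finally show ?case by simp
qed (auto simp: d1_zero C0.M.r_neg)

text \<open>An actual filling replaces the infimum, so that estimates can be added along
  constructions. By exactness the cycles are the elements of the image of \<open>d2\<close>.\<close>

definition linear_filling :: "real \<Rightarrow> bool" where
  "linear_filling K \<longleftrightarrow> (\<forall>b\<in>carrier C1. d1 b = \<zero>\<^bsub>C0\<^esub> \<longrightarrow> (\<exists>c\<in>carrier C2. d2 c = b \<and> C2.N c \<le> K * C1.N b))"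

end

section \<open>Linear filling implies hyperbolicity\<close>

context fp2_complex
begin

text \<open>\<open>phi \<circ> d1\<close> is determined by its values on \<open>\<Lambda>1\<close>,
  so up to translation the elements of the basis of \<open>C1\<close> reach no further than these
  finitely many group elements.\<close>

definition supp_gens :: "'g set" where
  "supp_gens = {h. phi e0 h \<noteq> 0} \<union> (\<Union>y\<in>\<Lambda>1. {h. phi (d1 y) h \<noteq> 0})"

lemma supp_gens_subset: "supp_gens \<subseteq> carrier G"
  using supp_A[OF phi_closed[OF e0_in]] supp_A[OF phi_closed[OF d1_closed[OF C1.basis_in]]]
  by (auto simp: supp_gens_def)

lemma finite_supp_gens: "finite supp_gens"
  using fin_A[OF phi_closed[OF e0_in]] fin_A[OF phi_closed[OF d1_closed[OF C1.basis_in]]] basis1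
  by (auto simp: supp_gens_def)

text \<open>Modulo the subgroup \<open>H\<close> generated by the supports, \<open>phi \<circ> d1\<close> vanishes; since
  \<open>(g - 1) \<cdot> e0\<close> is a boundary, \<open>g\<close> fixes the coset \<open>H\<close>.\<close>

lemma generate_supp_gens: "generate G supp_gens = carrier G"
proof
  let ?H = "generate G supp_gens"
  interpret H: subgroup ?H G using G.generate_is_subgroup[OF supp_gens_subset] .
  define ind :: "'g \<Rightarrow> complex" where "ind h = (if h \<in> ?H then 1 else 0)" for h
  have ind_mult: "ind (g \<otimes> h) = ind g" if "g \<in> carrier G" "h \<in> ?H" for g h
  proof -
    have "g \<in> ?H" if "g \<otimes> h \<in> ?H"
      using H.m_closed[OF that H.m_inv_closed[OF \<open>h \<in> ?H\<close>]] \<open>g \<in> carrier G\<close> \<open>h \<in> ?H\<close> H.mem_carrier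
      by (simp add: G.m_assoc)
    then show ?thesis using H.m_closed that by (auto simp: ind_def)
  qed
  have supp1: "l \<in> ?H" if "y \<in> \<Lambda>1" "phi (d1 y) l \<noteq> 0" for y l
    using that by (intro generate.incl) (auto simp: supp_gens_def)
  have supp0: "l \<in> ?H" if "phi e0 l \<noteq> 0" for l
    using that by (intro generate.incl) (auto simp: supp_gens_def)
  show "?H \<subseteq> carrier G" by (rule H.subset)
  show "carrier G \<subseteq> ?H"
  proof
    fix g assume g: "g \<in> carrier G"
    have bd: "pairing (phi (d1 b)) ind = 0" if "b \<in> carrier C1" for b
      using that
    proof (induction rule: C1.l1_induct)
      case zero
      show ?case by (simp add: d1_zero phi_zero pairing_zero)
    next
      case (add m n r h y)
      let ?a = "phi (d1 y)"
      have a: "?a \<in> carrier A" using add phi_closed by simp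
      \<comment> \<open>The support of \<open>?a\<close> lies in \<open>?H\<close>, so the
        translated indicator is constant on it. The pairing becomes \<open>ind h\<close> times the
        augmentation, which vanishes on boundaries.\<close>
      have "pairing ?a (\<lambda>l. ind (h \<otimes> l)) = pairing ?a (\<lambda>_. ind h * 1)"
        unfolding pairing_def using add supp1 by (intro sum.cong refl) (simp add: ind_mult)
      also have "\<dots> = 0" using add by (subst pairing_fun_cmult) (simp add: aug_phi \<epsilon>_d1)
      finally show ?case
        using add a by (simp add: d1_add d1_smult phi_add phi_smult phi_closed pairing_A_add pairing_mon_mult
          C0.smult_closed C0.A.m_closed)
    qed
    have u: "phi e0 \<in> carrier A" by (simp add: phi_closed)
    have 1: "pairing (phi e0) (\<lambda>l. ind (h \<otimes> l)) = ind h" if "h \<in> carrier G" for h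
    proof -
      have "pairing (phi e0) (\<lambda>l. ind (h \<otimes> l)) = pairing (phi e0) (\<lambda>_. ind h * 1)"
        unfolding pairing_def using that supp0 by (intro sum.cong refl) (simp add: ind_mult)
      also have "\<dots> = ind h" by (subst pairing_fun_cmult) (simp add: aug_phi \<epsilon>_e0)
      finally show ?thesis .
    qed
    have "gmon 1 g \<odot>\<^bsub>C0\<^esub> e0 \<oplus>\<^bsub>C0\<^esub> gmon (- 1) \<one> \<odot>\<^bsub>C0\<^esub> e0 = d1 (psi g)"
      using g C0.act_uminus_scalar[of 1 \<one> e0] by (simp add: d1_psi C0.act_one)
    then have "pairing (phi (gmon 1 g \<odot>\<^bsub>C0\<^esub> e0 \<oplus>\<^bsub>C0\<^esub> gmon (- 1) \<one> \<odot>\<^bsub>C0\<^esub> e0)) ind = 0"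
      using bd g by simp
    then have "ind g - ind \<one> = 0"
      using g u by (simp add: phi_add phi_smult pairing_A_add pairing_mon_mult C0.A.m_closed 1)
    then show "g \<in> ?H" using H.one_closed by (simp add: ind_def split: if_splits)
  qed
qed

end

section \<open>The cochains \<open>f dk\<close> and their uniform bounds\<close>

locale fp2_generated = fp2_complex G R C0 C1 C2 d1 d2 \<epsilon> \<Lambda>1 \<Lambda>2 + generated_group G S
  for G :: "('g, 'b) monoid_scheme" (structure) and R :: "complex set"
    and C0 C1 C2 :: "('g \<Rightarrow> complex, 'm) module" and d1 d2 :: "'m \<Rightarrow> 'm" and \<epsilon> :: "'m \<Rightarrow> complex"
    and \<Lambda>1 \<Lambda>2 :: "'m set" and S +
  assumes finite_S: "finite S"
begin

sublocale W: graph_metric "carrier G" wdist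
  by (rule graph_metric_wdist)

lemma finite_letters: "finite letters"
  using finite_S by (simp add: letters_def)

lemma lipD: "W.lip f \<Longrightarrow> x \<in> carrier G \<Longrightarrow> y \<in> carrier G \<Longrightarrow> \<bar>f x - f y\<bar> \<le> real (wdist x y)"
  by (simp add: W.lip_def)

text \<open>The pairing of chains with the cochain \<open>f dk\<close>.\<close>

definition form :: "('g \<Rightarrow> complex) \<Rightarrow> ('g \<Rightarrow> complex) \<Rightarrow> 'm \<Rightarrow> complex" where
  "form f k m = C1.ext (\<lambda>y g. f g * pairing (phi (d1 y)) (\<lambda>h. k (g \<otimes> h))) m"

text \<open>For constant \<open>f\<close> the cochain is exact, so its value on a chain depends only
  on the boundary of the chain.\<close>

lemma form_const:
  assumes "m \<in> carrier C1" shows "form (\<lambda>_. c) k m = c * pairing (phi (d1 m)) k"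
  using assms
proof (induction rule: C1.l1_induct)
  case zero
  show ?case by (simp add: form_def C1.ext_zero d1_zero phi_zero pairing_zero)
next
  case (add m n r g y)
  then have "phi (d1 y) \<in> carrier A" using phi_closed by simp
  with add show ?case
    by (simp add: form_def C1.ext_add C1.ext_mon_basis d1_add d1_smult phi_add phi_smult phi_closed
        pairing_A_add pairing_mon_mult C0.A.m_closed algebra_simps)
qed

lemma form_fun_diff: "form (\<lambda>x. f x - f' x) k m = form f k m - form f' k m"
  unfolding form_def C1.ext_fun_diff[symmetric] by (simp add: left_diff_distrib)

lemma form_zero: "form f k \<zero>\<^bsub>C1\<^esub> = 0"
  and form_add: "m \<in> carrier C1 \<Longrightarrow> m' \<in> carrier C1 \<Longrightarrow> form f k (m \<oplus>\<^bsub>C1\<^esub> m') = form f k m + form f k m'"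
  by (simp_all add: form_def C1.ext_zero C1.ext_add)

text \<open>A term \<open>gmon r h \<odot> y\<close> of \<open>m\<close>, translated by
  \<open>g\<close>, sees \<open>f\<close> only at \<open>g \<otimes> h\<close>, at distance
  \<open>wl h\<close> from the zero \<open>g\<close> of \<open>f\<close>, and sees \<open>k\<close>
  only on a translate of the support of \<open>phi (d1 y)\<close>. Both effects are bounded
  independently of \<open>g\<close> because the word metric is left invariant.\<close>

lemma form_local:
  assumes "m \<in> carrier C1"
  shows "\<exists>M\<ge>0. \<forall>g\<in>carrier G. \<forall>f k. W.lip f \<and> W.lip k \<and> f g = 0 \<longrightarrow>
    cmod (form (\<lambda>x. of_real (f x)) (\<lambda>x. of_real (k x)) (gmon 1 g \<odot>\<^bsub>C1\<^esub> m)) \<le> M"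
  using assms
proof (induction rule: C1.l1_induct)
  case zero
  show ?case by (intro exI[of _ 0]) (auto simp: C1.act_zero form_zero)
next
  case (add m n r h y)
  let ?a = "phi (d1 y)"
  have a: "?a \<in> carrier A" "d1 y \<in> carrier C0" using add phi_closed by auto
  define B where "B = (\<Sum>l | ?a l \<noteq> 0. cmod (?a l) * real (wl l))"
  have B: "B \<ge> 0" by (auto simp: B_def intro!: sum_nonneg)
  obtain M where M: "M \<ge> 0" and bound: "\<And>g f k. g \<in> carrier G \<Longrightarrow> W.lip f \<Longrightarrow> W.lip k \<Longrightarrow> f g = 0 \<Longrightarrow>
      cmod (form (\<lambda>x. of_real (f x)) (\<lambda>x. of_real (k x)) (gmon 1 g \<odot>\<^bsub>C1\<^esub> m)) \<le> M"
    using add by blast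
  show ?case
  proof (intro exI[of _ "M + cmod r * (real (wl h) * B)"] conjI ballI allI impI)
    show "0 \<le> M + cmod r * (real (wl h) * B)" using M B by simp
    fix g and f k :: "'g \<Rightarrow> real" assume g: "g \<in> carrier G" and fk: "W.lip f \<and> W.lip k \<and> f g = 0"
    let ?f = "\<lambda>x. complex_of_real (f x)" and ?k = "\<lambda>x. complex_of_real (k x)"
    have gh: "g \<otimes> h \<in> carrier G" using g add by simp
    have "\<bar>f (g \<otimes> h) - f g\<bar> \<le> real (wdist (g \<otimes> h) g)" using lipD[OF _ gh g] fk by blast
    then have f: "cmod (?f (g \<otimes> h)) \<le> real (wl h)"
      using fk wdist_mult[OF g \<open>h \<in> carrier G\<close>] wdist_sym[OF g gh] by simp
    \<comment> \<open>Subtracting the constant \<open>?k (g \<otimes> h)\<close> changes nothing,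
      since \<open>?a\<close> has augmentation 0, and leaves differences controlled by the Lipschitz
      condition.\<close>
    have "pairing ?a (\<lambda>l. ?k (g \<otimes> h \<otimes> l)) = pairing ?a (\<lambda>l. ?k (g \<otimes> h \<otimes> l) - ?k (g \<otimes> h) * 1)"
      unfolding pairing_fun_diff pairing_fun_cmult using add a by (simp add: aug_phi \<epsilon>_d1)
    also have "cmod \<dots> \<le> B"
      unfolding B_def
    proof (rule pairing_bound)
      fix l assume "?a l \<noteq> 0"
      then have l: "l \<in> carrier G" using supp_A[OF a(1)] by blast
      then have "\<bar>k (g \<otimes> h \<otimes> l) - k (g \<otimes> h)\<bar> \<le> real (wdist (g \<otimes> h \<otimes> l) (g \<otimes> h))"
        using lipD[of k "g \<otimes> h \<otimes> l" "g \<otimes> h"] fk gh by simp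
      also have "wdist (g \<otimes> h \<otimes> l) (g \<otimes> h) = wl l" using wdist_mult[OF gh l] wdist_sym[of "g \<otimes> h" "g \<otimes> h \<otimes> l"] gh l by simp
      finally show "cmod (?k (g \<otimes> h \<otimes> l) - ?k (g \<otimes> h) * 1) \<le> real (wl l)"
        by (simp flip: of_real_diff)
    qed
    finally have k: "cmod (pairing ?a (\<lambda>l. ?k (g \<otimes> h \<otimes> l))) \<le> B" .
    have "form ?f ?k (gmon 1 g \<odot>\<^bsub>C1\<^esub> (m \<oplus>\<^bsub>C1\<^esub> gmon r h \<odot>\<^bsub>C1\<^esub> y))
        = form ?f ?k (gmon 1 g \<odot>\<^bsub>C1\<^esub> m) + r * (?f (g \<otimes> h) * pairing ?a (\<lambda>l. ?k (g \<otimes> h \<otimes> l)))"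
      using add g gh by (simp add: C1.act_add C1.act_act form_add) (simp add: form_def C1.ext_mon_basis)
    also have "cmod \<dots> \<le> M + cmod r * (real (wl h) * B)"
      using bound[OF g, of f k] fk f k B unfolding norm_mult
      by (intro order_trans[OF norm_triangle_ineq] add_mono) (auto simp: norm_mult intro!: mult_mono)
    finally show "cmod (form ?f ?k (gmon 1 g \<odot>\<^bsub>C1\<^esub> (m \<oplus>\<^bsub>C1\<^esub> gmon r h \<odot>\<^bsub>C1\<^esub> y))) \<le> M + cmod r * (real (wl h) * B)" .
  qed
qed

lemma lip_diff_const: "W.lip f \<Longrightarrow> W.lip (\<lambda>x. f x - c)"
  by (simp add: W.lip_def)

text \<open>Split \<open>f\<close> into the constant \<open>f g\<close> and \<open>f - f g\<close>:
  the constant part is computed by \<open>form_const\<close>, and the rest vanishes at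
  \<open>g\<close>, so that \<open>form_local\<close> bounds it.\<close>

lemma form_translate:
  assumes "m \<in> carrier C1"
  shows "\<exists>M\<ge>0. \<forall>g\<in>carrier G. \<forall>f k. W.lip f \<and> W.lip k \<longrightarrow>
    cmod (form (\<lambda>x. of_real (f x)) (\<lambda>x. of_real (k x)) (gmon 1 g \<odot>\<^bsub>C1\<^esub> m)
      - of_real (f g) * pairing (phi (gmon 1 g \<odot>\<^bsub>C0\<^esub> d1 m)) (\<lambda>x. of_real (k x))) \<le> M"
proof -
  obtain M where M: "M \<ge> 0" "\<forall>g\<in>carrier G. \<forall>f k. W.lip f \<and> W.lip k \<and> f g = 0 \<longrightarrow>
    cmod (form (\<lambda>x. of_real (f x)) (\<lambda>x. of_real (k x)) (gmon 1 g \<odot>\<^bsub>C1\<^esub> m)) \<le> M"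
    using form_local[OF assms] by blast
  show ?thesis
  proof (intro exI[of _ M] conjI M(1) ballI allI impI)
    fix g and f k :: "'g \<Rightarrow> real" assume g: "g \<in> carrier G" and fk: "W.lip f \<and> W.lip k"
    have "cmod (form (\<lambda>x. of_real (f x - f g)) (\<lambda>x. of_real (k x)) (gmon 1 g \<odot>\<^bsub>C1\<^esub> m)) \<le> M"
      using M(2)[rule_format, OF g, of "\<lambda>x. f x - f g" k] fk lip_diff_const by simp
    then show "cmod (form (\<lambda>x. of_real (f x)) (\<lambda>x. of_real (k x)) (gmon 1 g \<odot>\<^bsub>C1\<^esub> m)
      - of_real (f g) * pairing (phi (gmon 1 g \<odot>\<^bsub>C0\<^esub> d1 m)) (\<lambda>x. of_real (k x))) \<le> M"
      using g assms by (simp add: form_fun_diff form_const d1_smult)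
  qed
qed

text \<open>The differential of \<open>f dk\<close> is bounded: on a translate of the cycle
  \<open>d2 z\<close> the main term of \<open>form_translate\<close> vanishes and only its uniform
  error is left. Finiteness of \<open>\<Lambda>2\<close> gives a common bound.\<close>

lemma form_boundary:
  "\<exists>M\<ge>0. \<forall>c\<in>carrier C2. \<forall>f k. W.lip f \<and> W.lip k \<longrightarrow>
     cmod (form (\<lambda>x. of_real (f x)) (\<lambda>x. of_real (k x)) (d2 c)) \<le> M * C2.N c"
proof -
  have "\<forall>z\<in>\<Lambda>2. \<exists>M\<ge>0. \<forall>g\<in>carrier G. \<forall>f k. W.lip f \<and> W.lip k \<longrightarrow>
    cmod (form (\<lambda>x. of_real (f x)) (\<lambda>x. of_real (k x)) (gmon 1 g \<odot>\<^bsub>C1\<^esub> d2 z)) \<le> M"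
  proof
    fix z assume z: "z \<in> \<Lambda>2"
    then have "d2 z \<in> carrier C1" "d1 (d2 z) = \<zero>\<^bsub>C0\<^esub>" by (simp_all add: d1_d2)
    then show "\<exists>M\<ge>0. \<forall>g\<in>carrier G. \<forall>f k. W.lip f \<and> W.lip k \<longrightarrow>
      cmod (form (\<lambda>x. of_real (f x)) (\<lambda>x. of_real (k x)) (gmon 1 g \<odot>\<^bsub>C1\<^esub> d2 z)) \<le> M"
      using form_translate[of "d2 z"] by (simp add: C0.act_zero phi_zero pairing_zero)
  qed
  from bchoice[OF this] obtain M where M: "\<And>z. z \<in> \<Lambda>2 \<Longrightarrow> M z \<ge> (0::real)"
    "\<And>z g f k. z \<in> \<Lambda>2 \<Longrightarrow> g \<in> carrier G \<Longrightarrow> W.lip f \<Longrightarrow> W.lip k \<Longrightarrow>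
      cmod (form (\<lambda>x. of_real (f x)) (\<lambda>x. of_real (k x)) (gmon 1 g \<odot>\<^bsub>C1\<^esub> d2 z)) \<le> M z"
    by blast
  let ?M = "\<Sum>z\<in>\<Lambda>2. M z"
  have le: "M z \<le> ?M" if "z \<in> \<Lambda>2" for z using M(1) that basis2 by (intro member_le_sum) auto
  have "?M \<ge> 0" using M(1) by (rule sum_nonneg)
  moreover have "cmod (form (\<lambda>x. of_real (f x)) (\<lambda>x. of_real (k x)) (d2 c)) \<le> ?M * C2.N c"
    if "c \<in> carrier C2" and fk: "W.lip f" "W.lip k" for c f k
    using that(1)
  proof (induction rule: C2.l1_induct)
    case zero
    show ?case by (simp add: d2_zero form_zero)
  next
    case (add m n r g z)
    let ?F = "form (\<lambda>x. of_real (f x)) (\<lambda>x. of_real (k x))"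
    have "form f' k' (gmon r g \<odot>\<^bsub>C1\<^esub> b) = r * form f' k' (gmon 1 g \<odot>\<^bsub>C1\<^esub> b)" if "b \<in> carrier C1" for f' k' b
      unfolding form_def using add that by (simp add: C1.ext_act)
    then have "?F (d2 (m \<oplus>\<^bsub>C2\<^esub> gmon r g \<odot>\<^bsub>C2\<^esub> z)) = ?F (d2 m) + r * ?F (gmon 1 g \<odot>\<^bsub>C1\<^esub> d2 z)"
      using add by (simp add: d2_add d2_smult form_add)
    also have "cmod \<dots> \<le> ?M * n + cmod r * ?M"
      unfolding norm_mult[symmetric]
      using add M(2)[of z g f k] fk le[of z]
      by (intro order_trans[OF norm_triangle_ineq] add_mono) (auto simp: norm_mult intro!: mult_left_mono)
    finally show ?case by (simp add: algebra_simps)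
  qed
  ultimately show ?thesis by blast
qed

lemma uniform_bound:
  fixes P :: "'x \<Rightarrow> real \<Rightarrow> bool"
  assumes "finite X" "\<And>x. x \<in> X \<Longrightarrow> \<exists>M\<ge>0. P x M" "\<And>x M M'. P x M \<Longrightarrow> M \<le> M' \<Longrightarrow> P x M'"
  shows "\<exists>M\<ge>0. \<forall>x\<in>X. P x M"
  using assms(1,2)
proof (induction X rule: finite_induct)
  case empty
  show ?case by (intro exI[of _ 0]) auto
next
  case (insert x X)
  then obtain M where "M \<ge> 0" "\<forall>x\<in>X. P x M" by auto
  moreover obtain M' where "M' \<ge> 0" "P x M'" using insert by auto
  ultimately have M: "M \<ge> 0" "\<forall>x\<in>X. P x M" "M' \<ge> 0" "P x M'" by auto
  then have "P y (max M M')" if "y \<in> insert x X" for y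
    using that assms(3)[of _ M "max M M'"] assms(3)[of _ M' "max M M'"] by (auto simp: le_max_iff_disj)
  then show ?case using M by (intro exI[of _ "max M M'"]) auto
qed

lemma finite_unit_ball: "finite {g \<in> carrier G. wl g \<le> 1}"
proof (rule finite_subset)
  show "{g \<in> carrier G. wl g \<le> 1} \<subseteq> insert \<one> letters"
  proof
    fix g assume "g \<in> {g \<in> carrier G. wl g \<le> 1}"
    then obtain ws where ws: "length ws \<le> 1" "set ws \<subseteq> letters" "wprod ws = g" using wl_word by force
    then show "g \<in> insert \<one> letters" using letters_subset by (cases ws) auto
  qed
qed (simp add: finite_letters)

text \<open>A closed walk gives a cycle of norm at most \<open>L\<close> times its length, and a
  linear filling bounds the pairing of this cycle with \<open>f dk\<close>. The passage back to the
  integral costs two errors per vertex of the list: \<open>M\<close> for replacing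
  \<open>form\<close> on an edge by an increment of \<open>k'\<close>, and \<open>U\<close> for
  replacing \<open>k'\<close> by \<open>k\<close>.\<close>

lemma walk_integral_form:
  assumes K: "linear_filling K" "K \<ge> 0"
  shows "\<exists>K'\<ge>0. \<forall>f k xs. W.lip f \<and> W.lip k \<and> W.closed_walk xs \<longrightarrow> \<bar>walk_integral f k xs\<bar> \<le> K' * real (length xs)"
proof -
  let ?T = "{g \<in> carrier G. wl g \<le> 1}"
  let ?c = "\<lambda>f x. complex_of_real (f x)"
  have "\<exists>M\<ge>0. \<forall>t\<in>?T. \<forall>g\<in>carrier G. \<forall>f k. W.lip f \<and> W.lip k \<longrightarrow>
    cmod (form (?c f) (?c k) (gmon 1 g \<odot>\<^bsub>C1\<^esub> psi t) - ?c f g * pairing (phi (gmon 1 g \<odot>\<^bsub>C0\<^esub> d1 (psi t))) (?c k)) \<le> M"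
  proof (rule uniform_bound[OF finite_unit_ball])
    fix t assume "t \<in> ?T"
    then have "psi t \<in> carrier C1" by simp
    from form_translate[OF this] show "\<exists>M\<ge>0. \<forall>g\<in>carrier G. \<forall>f k. W.lip f \<and> W.lip k \<longrightarrow>
      cmod (form (?c f) (?c k) (gmon 1 g \<odot>\<^bsub>C1\<^esub> psi t) - ?c f g * pairing (phi (gmon 1 g \<odot>\<^bsub>C0\<^esub> d1 (psi t))) (?c k)) \<le> M" .
  qed (meson order_trans)
  then obtain M where M: "M \<ge> 0" "\<And>t g f k. t \<in> ?T \<Longrightarrow> g \<in> carrier G \<Longrightarrow> W.lip f \<Longrightarrow> W.lip k \<Longrightarrow>
    cmod (form (?c f) (?c k) (gmon 1 g \<odot>\<^bsub>C1\<^esub> psi t) - ?c f g * pairing (phi (gmon 1 g \<odot>\<^bsub>C0\<^esub> d1 (psi t))) (?c k)) \<le> M"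
    by blast
  have "\<exists>L\<ge>0. \<forall>t\<in>?T. C1.N (psi t) \<le> L"
  proof (rule uniform_bound[OF finite_unit_ball])
    show "\<exists>L\<ge>0. C1.N (psi t) \<le> L" if "t \<in> ?T" for t
      using that by (intro exI[of _ "C1.N (psi t)"]) (simp add: C1.N_nonneg)
  qed simp
  then obtain L where L: "L \<ge> 0" "\<And>t. t \<in> ?T \<Longrightarrow> C1.N (psi t) \<le> L" by blast
  obtain B where B: "B \<ge> 0" "\<And>c f k. c \<in> carrier C2 \<Longrightarrow> W.lip f \<Longrightarrow> W.lip k \<Longrightarrow>
     cmod (form (?c f) (?c k) (d2 c)) \<le> B * C2.N c"
    using form_boundary by blast
  let ?u = "phi e0"
  have u: "?u \<in> carrier A" by (simp add: phi_closed)
  define U where "U = (\<Sum>h | ?u h \<noteq> 0. cmod (?u h) * real (wl h))"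
  have U: "U \<ge> 0" by (auto simp: U_def intro!: sum_nonneg)
  have main: "\<bar>walk_integral f k xs\<bar> \<le> (M + U + B * K * L) * real (length xs)"
    if f: "W.lip f" and k: "W.lip k" and xs: "W.closed_walk xs" for f k xs
  proof -
    \<comment> \<open>\<open>phi\<close> sends the translate of \<open>e0\<close> by
      \<open>g\<close> to a combination of group elements near \<open>g\<close> with total
      coefficient 1, so chains see this average of \<open>k\<close> rather than \<open>k\<close>
      itself.\<close>
    define k' where "k' g = pairing ?u (\<lambda>h. ?c k (g \<otimes> h))" for g
    have steps: "successively (\<lambda>u v. wdist u v \<le> 1) xs" and G: "set xs \<subseteq> carrier G" and ne: "xs \<noteq> []"
      and closed: "hd xs = last xs"
      using xs by (auto simp: W.closed_walk_def)
    have edge: "cmod (form (?c f) (?c k) (edge x y) - ?c f x * (k' y - k' x)) \<le> M" "C1.N (edge x y) \<le> L"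
      if xy: "x \<in> carrier G" "y \<in> carrier G" "wdist x y \<le> 1" for x y
    proof -
      have t: "inv x \<otimes> y \<in> ?T" using xy by (simp add: wdist_def)
      have "gmon 1 x \<odot>\<^bsub>C0\<^esub> d1 (psi (inv x \<otimes> y)) = gmon 1 y \<odot>\<^bsub>C0\<^esub> e0 \<oplus>\<^bsub>C0\<^esub> gmon (- 1) x \<odot>\<^bsub>C0\<^esub> e0"
        using xy C0.act_uminus_scalar[of 1 x e0] d1_edge[OF xy(1,2)] by (simp add: edge_def d1_smult)
      then have "pairing (phi (gmon 1 x \<odot>\<^bsub>C0\<^esub> d1 (psi (inv x \<otimes> y)))) (?c k) = k' y - k' x"
        using xy u by (simp add: phi_add phi_smult pairing_A_add pairing_mon_mult C0.A.m_closed k'_def)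
      then show "cmod (form (?c f) (?c k) (edge x y) - ?c f x * (k' y - k' x)) \<le> M"
        using M(2)[OF t xy(1) f k] by (simp add: edge_def)
      show "C1.N (edge x y) \<le> L"
        using L(2)[OF t] xy by (simp add: edge_def C1.N_act)
    qed
    have chain: "cmod (form (?c f) (?c k) (walk_chain xs) - walk_integral (?c f) k' xs) \<le> M * real (length xs)
        \<and> C1.N (walk_chain xs) \<le> L * real (length xs)"
      using steps G
    proof (induction xs rule: walk_chain.induct)
      case (1 x y zs)
      let ?F = "form (?c f) (?c k)"
      have "?F (walk_chain (x # y # zs)) - walk_integral (?c f) k' (x # y # zs) =
          (?F (edge x y) - ?c f x * (k' y - k' x)) + (?F (walk_chain (y # zs)) - walk_integral (?c f) k' (y # zs))"
        using 1 by (simp add: form_add)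
      also have "cmod \<dots> \<le> M + M * real (length (y # zs))"
        using 1 edge(1)[of x y] by (intro order_trans[OF norm_triangle_ineq] add_mono) auto
      finally have *: "cmod (?F (walk_chain (x # y # zs)) - walk_integral (?c f) k' (x # y # zs)) \<le> M * real (length (x # y # zs))"
        by (simp add: algebra_simps)
      have "C1.N (walk_chain (x # y # zs)) \<le> C1.N (edge x y) + C1.N (walk_chain (y # zs))"
        using 1 C1.N_add[of "edge x y" "walk_chain (y # zs)"] by simp
      also have "\<dots> \<le> L + L * real (length (y # zs))"
        using 1 edge(2)[of x y] by (intro add_mono) auto
      finally show ?case using * by (simp add: algebra_simps)
    qed (use M(1) L(1) in \<open>auto simp: form_zero C1.N_zero\<close>)
    have "cmod (form (?c f) (?c k) (walk_chain xs)) \<le> B * K * L * real (length xs)"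
    proof -
      have "d1 (walk_chain xs) = \<zero>\<^bsub>C0\<^esub>"
        using d1_walk_chain[OF ne G] closed last_in_set[OF ne] G by (simp add: C0.M.r_neg subset_iff)
      then obtain c where c: "c \<in> carrier C2" "d2 c = walk_chain xs" "C2.N c \<le> K * C1.N (walk_chain xs)"
        using K(1) walk_chain_closed[OF G] unfolding linear_filling_def by blast
      have "cmod (form (?c f) (?c k) (walk_chain xs)) \<le> B * C2.N c" using B(2)[OF c(1) f k] c(2) by simp
      also have "\<dots> \<le> B * (K * (L * real (length xs)))"
        using c(3) chain K(2) B(1) by (intro mult_left_mono order_trans[OF c(3)]) auto
      finally show ?thesis by (simp add: mult_ac)
    qed
    moreover have "cmod (walk_integral (?c f) (\<lambda>x. k' x - ?c k x) xs) \<le> U * real (length xs)"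
    proof -
      have "cmod (walk_integral (?c f) (\<lambda>x. k' x - ?c k x) xs - (?c f (last xs) * (k' (last xs) - ?c k (last xs))
          - ?c f (hd xs) * (k' (hd xs) - ?c k (hd xs)))) \<le> U * real (length xs)"
      proof (rule walk_integral_by_parts[OF ne _ _ U])
        show "successively (\<lambda>x y. cmod (?c f y - ?c f x) \<le> 1) xs"
        proof (rule successively_mono[OF steps])
          fix x y assume xy: "x \<in> set xs" "y \<in> set xs" "wdist x y \<le> 1"
          then have "\<bar>f x - f y\<bar> \<le> real (wdist x y)" using lipD[OF f] G by blast
          then show "cmod (?c f y - ?c f x) \<le> 1" using xy by (simp flip: of_real_diff)
        qed
        fix x assume "x \<in> set xs"
        then have x: "x \<in> carrier G" using G by blast
        have "k' x - ?c k x = pairing ?u (\<lambda>h. ?c k (x \<otimes> h) - ?c k x * 1)"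
          unfolding pairing_fun_diff pairing_fun_cmult by (simp add: aug_phi \<epsilon>_e0 k'_def)
        also have "cmod \<dots> \<le> U"
          unfolding U_def
        proof (rule pairing_bound)
          fix h assume "?u h \<noteq> 0"
          then have h: "h \<in> carrier G" using supp_A[OF u] by blast
          then have "\<bar>k (x \<otimes> h) - k x\<bar> \<le> real (wdist (x \<otimes> h) x)" using lipD[OF k _ x] x by simp
          also have "wdist (x \<otimes> h) x = wl h" using wdist_mult[OF x h] wdist_sym[of x "x \<otimes> h"] x h by simp
          finally show "cmod (?c k (x \<otimes> h) - ?c k x * 1) \<le> real (wl h)" by (simp flip: of_real_diff)
        qed
        finally show "cmod (k' x - ?c k x) \<le> U" .
      qed
      then show ?thesis using closed by simp
    qed
    moreover have "walk_integral (?c f) (\<lambda>x. k' x - ?c k x) xs = walk_integral (?c f) k' xs - walk_integral (?c f) (?c k) xs"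
      by (induction xs rule: walk_chain.induct) (auto simp: algebra_simps)
    ultimately have "cmod (walk_integral (?c f) (?c k) xs) \<le> M * real (length xs) + B * K * L * real (length xs) + U * real (length xs)"
      using chain by (smt (verit) norm_triangle_sub norm_minus_commute)
    then show ?thesis unfolding walk_integral_of_real by (simp add: algebra_simps)
  qed
  show ?thesis
    using M(1) U B(1) K(2) L(1) main by (intro exI[of _ "M + U + B * K * L"]) auto
qed

theorem hyperbolic_of_linear_filling:
  assumes "linear_filling K" "K \<ge> 0"
  shows "Gromov_hyperbolic_space (carrier G) (word_metric G S)"
proof -
  obtain K' where K': "K' \<ge> 0" "\<And>f k xs. W.lip f \<Longrightarrow> W.lip k \<Longrightarrow> W.closed_walk xs \<Longrightarrow>
      \<bar>walk_integral f k xs\<bar> \<le> K' * real (length xs)"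
    using walk_integral_form[OF assms] by blast
  obtain \<delta> where "\<forall>x\<in>carrier G. \<forall>y\<in>carrier G. \<forall>z\<in>carrier G. \<forall>w\<in>carrier G.
      wdist w x + wdist y z \<le> max (wdist w y + wdist x z) (wdist w z + wdist x y) + \<delta>"
    using W.four_point_of_integral_bound[OF _ K'(1)] K'(2) by blast
  then show ?thesis
    unfolding hyperbolic_iff_four_point
    by (intro exI[of _ "real \<delta>"]) (metis of_nat_add of_nat_le_iff)
qed

end

section \<open>Filling of closed walks\<close>

text \<open>By the pigeonhole principle the orbit of \<open>j0\<close> becomes periodic, and
  minimality of the period makes the cycle simple. Applied to a choice of successor edges, this
  extracts from a flow a closed walk without repeated edges.\<close>

lemma periodic_orbit:
  assumes "finite J" "j0 \<in> J" "\<And>j. j \<in> J \<Longrightarrow> f j \<in> J"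
  shows "\<exists>j\<in>J. \<exists>k>0. (f ^^ k) j = j \<and> inj_on (\<lambda>i. (f ^^ i) j) {..<k}"
proof -
  have inJ: "(f ^^ i) j \<in> J" if "j \<in> J" for i j
    using that assms(3) by (induction i) auto
  have "\<not> inj (\<lambda>i. (f ^^ i) j0)"
    using inJ[OF assms(2)] assms(1) finite_subset[of "range (\<lambda>i. (f ^^ i) j0)" J]
      finite_imageD[of "\<lambda>i. (f ^^ i) j0" UNIV] by auto
  then obtain a b where ab: "a < b" "(f ^^ a) j0 = (f ^^ b) j0"
    unfolding inj_def by (metis linorder_neqE_nat)
  define j where "j = (f ^^ a) j0"
  have j: "j \<in> J" using inJ assms(2) by (simp add: j_def)
  have "(f ^^ (b - a)) j = (f ^^ (b - a + a)) j0" by (simp only: j_def funpow_add comp_apply)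
  then have "b - a > 0 \<and> (f ^^ (b - a)) j = j" using ab by (simp add: j_def)
  then have ex: "\<exists>k. k > 0 \<and> (f ^^ k) j = j" by blast
  define k where "k = (LEAST k. k > 0 \<and> (f ^^ k) j = j)"
  have k: "k > 0" "(f ^^ k) j = j" using LeastI_ex[OF ex] by (auto simp: k_def)
  have least: "\<not> (l > 0 \<and> (f ^^ l) j = j)" if "l < k" for l
    using not_less_Least[of l "\<lambda>k. k > 0 \<and> (f ^^ k) j = j"] that by (simp add: k_def)
  have "(f ^^ i) j \<noteq> (f ^^ i') j" if "i < i'" "i' < k" for i i'
  proof
    assume eq: "(f ^^ i) j = (f ^^ i') j"
    have "(f ^^ (k - i' + i)) j = (f ^^ (k - i' + i')) j" by (simp only: funpow_add comp_apply eq)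
    moreover have "k - i' + i < k" "k - i' + i > 0" "k - i' + i' = k" using that by linarith+
    ultimately show False using least[of "k - i' + i"] k(2) by simp
  qed
  then have "inj_on (\<lambda>i. (f ^^ i) j) {..<k}"
    by (intro inj_onI) (metis lessThan_iff linorder_neqE_nat)
  then show ?thesis using j k by blast
qed

context fp2_complex
begin

lemma C1_minus_zero: "\<ominus>\<^bsub>C1\<^esub> \<zero>\<^bsub>C1\<^esub> = \<zero>\<^bsub>C1\<^esub>"
  by (rule C1.M.minus_equality) simp_all

definition fillable :: "'m \<Rightarrow> real \<Rightarrow> bool" where
  "fillable m c \<longleftrightarrow> (\<exists>e\<in>carrier C2. d2 e = m \<and> C2.N e \<le> c)"

lemma fillable_zero: "fillable \<zero>\<^bsub>C1\<^esub> 0"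
  unfolding fillable_def by (intro bexI[of _ "\<zero>\<^bsub>C2\<^esub>"]) (auto simp: d2_zero C2.N_zero)

lemma fillable_add: "fillable m c \<Longrightarrow> fillable m' c' \<Longrightarrow> fillable (m \<oplus>\<^bsub>C1\<^esub> m') (c + c')"
proof -
  assume "fillable m c" "fillable m' c'"
  then obtain e e' where e: "e \<in> carrier C2" "d2 e = m" "C2.N e \<le> c" "e' \<in> carrier C2" "d2 e' = m'" "C2.N e' \<le> c'"
    unfolding fillable_def by blast
  then show "fillable (m \<oplus>\<^bsub>C1\<^esub> m') (c + c')"
    unfolding fillable_def using C2.N_add[of e e']
    by (intro bexI[of _ "e \<oplus>\<^bsub>C2\<^esub> e'"]) (auto simp: d2_add)
qed

lemma fillable_mono: "fillable m c \<Longrightarrow> c \<le> c' \<Longrightarrow> fillable m c'"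
  unfolding fillable_def by (meson order_trans)

lemma fillable_act:
  assumes "fillable m c" "r \<in> R" "g \<in> carrier G" shows "fillable (gmon r g \<odot>\<^bsub>C1\<^esub> m) (cmod r * c)"
proof -
  obtain e where "e \<in> carrier C2" "d2 e = m" "C2.N e \<le> c" using assms by (auto simp: fillable_def)
  then show ?thesis
    unfolding fillable_def using assms
    by (intro bexI[of _ "gmon r g \<odot>\<^bsub>C2\<^esub> e"]) (auto simp: d2_smult C2.N_act intro: mult_left_mono)
qed

lemma fillable_cycle: assumes "m \<in> carrier C1" "d1 m = \<zero>\<^bsub>C0\<^esub>" shows "\<exists>c\<ge>0. fillable m c"
proof -
  have "m \<in> d2 ` carrier C2" using assms unfolding exact1 by simp
  then obtain e where "e \<in> carrier C2" "d2 e = m" by blast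
  then show ?thesis unfolding fillable_def using C2.N_nonneg by (intro exI[of _ "C2.N e"]) auto
qed

text \<open>Since \<open>phi\<close> preserves augmentations,
  \<open>m \<mapsto> m - phi m \<cdot> e0\<close> takes values in the kernel of
  \<open>\<epsilon>\<close>, which is the image of \<open>d1\<close>; as \<open>C0\<close> is
  projective, it lifts. The lift is the degree 0 part of a chain homotopy between the identity and
  the passage through the group ring.\<close>

lemma homotopy_exists:
  "\<exists>h\<in>left_module_hom A C0 C1. \<forall>m\<in>carrier C0. d1 (h m) = m \<oplus>\<^bsub>C0\<^esub> \<ominus>\<^bsub>C0\<^esub> (phi m \<odot>\<^bsub>C0\<^esub> e0)"
proof -
  let ?f = "\<lambda>m. m \<oplus>\<^bsub>C0\<^esub> \<ominus>\<^bsub>C0\<^esub> (phi m \<odot>\<^bsub>C0\<^esub> e0)"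
  have cl: "phi m \<odot>\<^bsub>C0\<^esub> e0 \<in> carrier C0" if "m \<in> carrier C0" for m
    using that by (simp add: C0.smult_closed phi_closed)
  have "?f \<in> left_module_hom A C0 C0"
    unfolding left_module_hom_def
  proof (intro CollectI conjI ballI funcsetI)
    show "?f m \<in> carrier C0" if "m \<in> carrier C0" for m using that cl by simp
    fix m m' assume m: "m \<in> carrier C0" "m' \<in> carrier C0"
    have "phi (m \<oplus>\<^bsub>C0\<^esub> m') \<odot>\<^bsub>C0\<^esub> e0 = phi m \<odot>\<^bsub>C0\<^esub> e0 \<oplus>\<^bsub>C0\<^esub> phi m' \<odot>\<^bsub>C0\<^esub> e0"
      using m by (simp add: phi_add C0.smult_l_distr phi_closed)
    then show "?f (m \<oplus>\<^bsub>C0\<^esub> m') = ?f m \<oplus>\<^bsub>C0\<^esub> ?f m'"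
      using m cl by (simp add: C0.M.minus_add C0.M.a_ac)
  next
    fix a m assume am: "a \<in> carrier A" "m \<in> carrier C0"
    then have "phi (a \<odot>\<^bsub>C0\<^esub> m) \<odot>\<^bsub>C0\<^esub> e0 = a \<odot>\<^bsub>C0\<^esub> (phi m \<odot>\<^bsub>C0\<^esub> e0)"
      by (simp add: phi_smult C0.smult_assoc phi_closed)
    then show "?f (a \<odot>\<^bsub>C0\<^esub> m) = a \<odot>\<^bsub>C0\<^esub> ?f m"
      using am cl by (simp add: C0.smult_r_distr C0.smult_r_minus)
  qed
  moreover have "?f ` carrier C0 \<subseteq> d1 ` carrier C1"
  proof
    fix x assume "x \<in> ?f ` carrier C0"
    then obtain m where m: "m \<in> carrier C0" "x = ?f m" by blast
    then show "x \<in> d1 ` carrier C1"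
      unfolding exact0 using cl by (simp add: \<epsilon>_add \<epsilon>_uminus \<epsilon>_smult phi_closed aug_phi \<epsilon>_e0)
  qed
  ultimately show ?thesis
    by (rule projective_lift[OF proj C1.left_module_axioms C0.left_module_axioms _ d1_hom])
qed

end

context fp2_generated
begin

text \<open>The rule of Fox derivatives: the chain of the path from \<open>\<one>\<close> that
  spells the word. Starting all paths at \<open>\<one>\<close> leaves only finitely many chains for
  words of bounded length.\<close>

fun word_chain :: "'g list \<Rightarrow> 'm" where
  "word_chain [] = \<zero>\<^bsub>C1\<^esub>"
| "word_chain (s # ws) = psi s \<oplus>\<^bsub>C1\<^esub> gmon 1 s \<odot>\<^bsub>C1\<^esub> word_chain ws"

lemma word_chain_closed [simp]: "set ws \<subseteq> letters \<Longrightarrow> word_chain ws \<in> carrier C1"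
  using letters_subset by (induction ws) auto

lemma C0_cancel:
  assumes "x \<in> carrier C0" "y \<in> carrier C0" "z \<in> carrier C0"
  shows "(x \<oplus>\<^bsub>C0\<^esub> \<ominus>\<^bsub>C0\<^esub> y) \<oplus>\<^bsub>C0\<^esub> (z \<oplus>\<^bsub>C0\<^esub> \<ominus>\<^bsub>C0\<^esub> x) = z \<oplus>\<^bsub>C0\<^esub> \<ominus>\<^bsub>C0\<^esub> y"
proof -
  have "(x \<oplus>\<^bsub>C0\<^esub> \<ominus>\<^bsub>C0\<^esub> y) \<oplus>\<^bsub>C0\<^esub> (z \<oplus>\<^bsub>C0\<^esub> \<ominus>\<^bsub>C0\<^esub> x) = (x \<oplus>\<^bsub>C0\<^esub> \<ominus>\<^bsub>C0\<^esub> x) \<oplus>\<^bsub>C0\<^esub> (z \<oplus>\<^bsub>C0\<^esub> \<ominus>\<^bsub>C0\<^esub> y)"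
    using assms by (simp add: C0.M.a_ac)
  then show ?thesis using assms by (simp add: C0.M.r_neg)
qed

lemma d1_word_chain:
  "set ws \<subseteq> letters \<Longrightarrow> d1 (word_chain ws) = gmon 1 (wprod ws) \<odot>\<^bsub>C0\<^esub> e0 \<oplus>\<^bsub>C0\<^esub> \<ominus>\<^bsub>C0\<^esub> e0"
proof (induction ws)
  case Nil
  then show ?case by (simp add: d1_zero C0.act_one C0.M.r_neg)
next
  case (Cons s ws)
  then have s: "s \<in> carrier G" using letters_subset by auto
  have w: "wprod ws \<in> carrier G" using Cons by simp
  have "d1 (word_chain (s # ws)) = (gmon 1 s \<odot>\<^bsub>C0\<^esub> e0 \<oplus>\<^bsub>C0\<^esub> \<ominus>\<^bsub>C0\<^esub> e0) \<oplus>\<^bsub>C0\<^esub>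
      (gmon 1 (s \<otimes> wprod ws) \<odot>\<^bsub>C0\<^esub> e0 \<oplus>\<^bsub>C0\<^esub> \<ominus>\<^bsub>C0\<^esub> (gmon 1 s \<odot>\<^bsub>C0\<^esub> e0))"
    using Cons s w by (simp add: d1_add d1_smult d1_psi C0.act_add C0.act_act C0.act_uminus)
  also have "\<dots> = gmon 1 (s \<otimes> wprod ws) \<odot>\<^bsub>C0\<^esub> e0 \<oplus>\<^bsub>C0\<^esub> \<ominus>\<^bsub>C0\<^esub> e0"
    using s w by (intro C0_cancel) auto
  finally show ?case by simp
qed

lemma word_chain_append:
  assumes "set ws \<subseteq> letters" "set vs \<subseteq> letters"
  shows "word_chain (ws @ vs) = word_chain ws \<oplus>\<^bsub>C1\<^esub> gmon 1 (wprod ws) \<odot>\<^bsub>C1\<^esub> word_chain vs"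
  using assms
proof (induction ws)
  case (Cons s ws)
  then have s: "s \<in> carrier G" using letters_subset by auto
  show ?case using Cons s by (simp add: C1.act_add C1.act_act C1.M.a_assoc)
qed (simp add: C1.act_one)

lemma word_difference_cycle:
  assumes "set u \<subseteq> letters" "set v \<subseteq> letters" "wprod u = wprod v"
  shows "d1 (word_chain u \<oplus>\<^bsub>C1\<^esub> \<ominus>\<^bsub>C1\<^esub> word_chain v) = \<zero>\<^bsub>C0\<^esub>"
  using assms by (simp add: d1_add d1_uminus d1_word_chain C0.M.r_neg)

text \<open>Exchanging a subword for a shorter one with the same product changes the chain by a
  translate of one of finitely many cycles, at a cost of at most \<open>K\<close>. Each exchange
  shortens the word, so the total cost is at most \<open>K\<close> times its length.\<close>

lemma Dehn_filling:
  assumes four: "\<And>x y z w. \<lbrakk>x \<in> carrier G; y \<in> carrier G; z \<in> carrier G; w \<in> carrier G\<rbrakk> \<Longrightarrow>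
      real (wdist w x + wdist y z) \<le> real (max (wdist w y + wdist x z) (wdist w z + wdist x y)) + D"
  shows "\<exists>K\<ge>0. \<forall>ws. set ws \<subseteq> letters \<and> wprod ws = \<one> \<longrightarrow> fillable (word_chain ws) (K * real (length ws))"
proof -
  obtain r :: nat where r: "real r > D" using reals_Archimedean2 by blast
  let ?X = "{ws. set ws \<subseteq> letters \<and> length ws \<le> 2 * r}"
  let ?P = "{p \<in> ?X \<times> ?X. wprod (fst p) = wprod (snd p)}"
  have "finite ?P" using finite_lists_length_le[OF finite_letters, of "2 * r"] by simp
  then have "\<exists>K\<ge>0. \<forall>p\<in>?P. fillable (word_chain (fst p) \<oplus>\<^bsub>C1\<^esub> \<ominus>\<^bsub>C1\<^esub> word_chain (snd p)) K"
    by (rule uniform_bound) (auto intro!: fillable_cycle word_difference_cycle intro: fillable_mono)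
  then obtain K where K: "K \<ge> 0" "\<And>u v. u \<in> ?X \<Longrightarrow> v \<in> ?X \<Longrightarrow> wprod u = wprod v \<Longrightarrow>
      fillable (word_chain u \<oplus>\<^bsub>C1\<^esub> \<ominus>\<^bsub>C1\<^esub> word_chain v) K"
    by force
  have "fillable (word_chain ws) (K * real (length ws))" if "set ws \<subseteq> letters" "wprod ws = \<one>" for ws
    using that
  proof (induction ws rule: measure_induct_rule[of length])
    case (less ws)
    show ?case
    proof (cases "length ws < r")
      case True
      show ?thesis
      proof (cases "ws = []")
        case False
        then have "1 \<le> real (length ws)" by (simp add: Suc_leI)
        \<comment> \<open>A nonempty word shorter than \<open>r\<close> is filled in one piece, by
          comparison with the empty word.\<close>
        have "fillable (word_chain ws \<oplus>\<^bsub>C1\<^esub> \<ominus>\<^bsub>C1\<^esub> word_chain []) K"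
          using K(2)[of ws "[]"] less.prems True by simp
        then have "fillable (word_chain ws) K" using less.prems by (simp add: C1_minus_zero)
        moreover have "K \<le> K * real (length ws)"
          using mult_left_mono[OF \<open>1 \<le> real (length ws)\<close> K(1)] by simp
        ultimately show ?thesis by (rule fillable_mono)
      qed (simp add: fillable_zero)
    next
      case False
      have "\<exists>us vs ws'. ws = us @ vs @ ws' \<and> length vs \<le> 2 * r \<and> wl (wprod vs) < length vs"
        by (rule Dehn_shortcut[OF _ r less.prems]) (use four False in auto)
      then obtain us vs ws' where split: "ws = us @ vs @ ws'" "length vs \<le> 2 * r" "wl (wprod vs) < length vs"
        by blast
      then have sub: "set us \<subseteq> letters" "set vs \<subseteq> letters" "set ws' \<subseteq> letters" using less.prems by auto
      obtain v' where v': "length v' = wl (wprod vs)" "set v' \<subseteq> letters" "wprod v' = wprod vs"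
        using wl_word[of "wprod vs"] sub by auto
      let ?p = "gmon 1 (wprod us)"
      let ?U = "word_chain us" and ?V = "?p \<odot>\<^bsub>C1\<^esub> word_chain vs" and ?V' = "?p \<odot>\<^bsub>C1\<^esub> word_chain v'"
        and ?W = "?p \<odot>\<^bsub>C1\<^esub> (gmon 1 (wprod vs) \<odot>\<^bsub>C1\<^esub> word_chain ws')"
      have cl: "?U \<in> carrier C1" "?V \<in> carrier C1" "?V' \<in> carrier C1" "?W \<in> carrier C1"
        using sub v' by auto
      have "wprod (us @ v' @ ws') = \<one>" using less.prems(2) sub v' by (simp add: split wprod_append)
      then have IH: "fillable (word_chain (us @ v' @ ws')) (K * real (length (us @ v' @ ws')))"
        using sub v' split by (intro less.IH) auto
      have "fillable (word_chain vs \<oplus>\<^bsub>C1\<^esub> \<ominus>\<^bsub>C1\<^esub> word_chain v') K"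
      proof (rule K(2))
        show "vs \<in> ?X" using sub split(2) by simp
        show "v' \<in> ?X" using v'(1,2) split(2,3) by simp
      qed (rule v'(3)[symmetric])
      from fillable_act[OF this, of 1 "wprod us"]
      have "fillable (?V \<oplus>\<^bsub>C1\<^esub> \<ominus>\<^bsub>C1\<^esub> ?V') K" using sub v' by (simp add: C1.act_add C1.act_uminus)
      from fillable_add[OF IH this]
      have "fillable (word_chain (us @ v' @ ws') \<oplus>\<^bsub>C1\<^esub> (?V \<oplus>\<^bsub>C1\<^esub> \<ominus>\<^bsub>C1\<^esub> ?V')) (K * real (length (us @ v' @ ws')) + K)" .
      moreover have "word_chain (us @ v' @ ws') = ?U \<oplus>\<^bsub>C1\<^esub> (?V' \<oplus>\<^bsub>C1\<^esub> ?W)"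
        using sub v' by (simp add: word_chain_append C1.act_add)
      \<comment> \<open>Adding the translated short cycle exchanges \<open>?V'\<close> for
        \<open>?V\<close>.\<close>
      moreover have "(?U \<oplus>\<^bsub>C1\<^esub> (?V' \<oplus>\<^bsub>C1\<^esub> ?W)) \<oplus>\<^bsub>C1\<^esub> (?V \<oplus>\<^bsub>C1\<^esub> \<ominus>\<^bsub>C1\<^esub> ?V') =
          (?U \<oplus>\<^bsub>C1\<^esub> (?V \<oplus>\<^bsub>C1\<^esub> ?W)) \<oplus>\<^bsub>C1\<^esub> (?V' \<oplus>\<^bsub>C1\<^esub> \<ominus>\<^bsub>C1\<^esub> ?V')"
        using cl by (simp add: C1.M.a_ac)
      moreover have "?U \<oplus>\<^bsub>C1\<^esub> (?V \<oplus>\<^bsub>C1\<^esub> ?W) = word_chain ws"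
        using sub by (simp add: split word_chain_append C1.act_add)
      ultimately have "fillable (word_chain ws) (K * real (length (us @ v' @ ws')) + K)"
        using cl less.prems by (simp add: C1.M.r_neg)
      moreover have "K * real (length (us @ v' @ ws')) + K = K * real (length (us @ v' @ ws') + 1)"
        by (simp add: algebra_simps)
      \<comment> \<open>At least one letter is saved, which pays for the additional
        \<open>K\<close>.\<close>
      moreover have "K * real (length (us @ v' @ ws') + 1) \<le> K * real (length ws)"
        using split v' K(1) by (intro mult_left_mono of_nat_mono) auto
      ultimately show ?thesis using fillable_mono by metis
    qed
  qed
  then show ?thesis using K(1) by blast
qed

text \<open>The steps come from an arbitrary finite set \<open>T\<close> rather than from the
  letters. Each step is exchanged for a fixed word, at bounded cost and with bounded lengthening,
  which turns the walk into a translate of the path spelled by a word.\<close>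

lemma walk_filling:
  assumes K: "K \<ge> 0" "\<And>ws. set ws \<subseteq> letters \<Longrightarrow> wprod ws = \<one> \<Longrightarrow> fillable (word_chain ws) (K * real (length ws))"
    and T: "finite T" "T \<subseteq> carrier G"
  shows "\<exists>K'\<ge>0. \<forall>xs. xs \<noteq> [] \<and> hd xs = last xs \<and> set xs \<subseteq> carrier G \<and>
     successively (\<lambda>x y. inv x \<otimes> y \<in> T) xs \<longrightarrow> fillable (walk_chain xs) (K' * real (length xs))"
proof -
  have "\<forall>t\<in>T. \<exists>ws. set ws \<subseteq> letters \<and> wprod ws = t" using word_exists T by blast
  then obtain W where W: "\<And>t. t \<in> T \<Longrightarrow> set (W t) \<subseteq> letters" "\<And>t. t \<in> T \<Longrightarrow> wprod (W t) = t" by metis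
  have "\<exists>k\<ge>0. \<forall>t\<in>T. fillable (psi t \<oplus>\<^bsub>C1\<^esub> \<ominus>\<^bsub>C1\<^esub> word_chain (W t)) k"
  proof (rule uniform_bound[OF T(1)])
    fix t assume t: "t \<in> T"
    then have "t \<in> carrier G" using T by blast
    then have "d1 (psi t \<oplus>\<^bsub>C1\<^esub> \<ominus>\<^bsub>C1\<^esub> word_chain (W t)) = \<zero>\<^bsub>C0\<^esub>"
      using W[OF t] by (simp add: d1_add d1_uminus d1_psi d1_word_chain C0.M.r_neg)
    then show "\<exists>k\<ge>0. fillable (psi t \<oplus>\<^bsub>C1\<^esub> \<ominus>\<^bsub>C1\<^esub> word_chain (W t)) k"
      using W[OF t] \<open>t \<in> carrier G\<close> by (intro fillable_cycle) auto
  qed (rule fillable_mono)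
  then obtain k where k: "k \<ge> 0" "\<And>t. t \<in> T \<Longrightarrow> fillable (psi t \<oplus>\<^bsub>C1\<^esub> \<ominus>\<^bsub>C1\<^esub> word_chain (W t)) k" by blast
  have "\<exists>L\<ge>0. \<forall>t\<in>T. real (length (W t)) \<le> L"
    by (rule uniform_bound[OF T(1)]) (auto intro: exI[of _ "real (length _)"])
  then obtain L where L: "L \<ge> 0" "\<And>t. t \<in> T \<Longrightarrow> real (length (W t)) \<le> L" by blast
  \<comment> \<open>Stated for walks that need not be closed, so that the induction can remove the
    first edge.\<close>
  have step: "\<exists>ws. set ws \<subseteq> letters \<and> real (length ws) \<le> L * real (length xs) \<and> hd xs \<otimes> wprod ws = last xs \<and>
      fillable (walk_chain xs \<oplus>\<^bsub>C1\<^esub> \<ominus>\<^bsub>C1\<^esub> (gmon 1 (hd xs) \<odot>\<^bsub>C1\<^esub> word_chain ws)) (k * real (length xs))"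
    if "xs \<noteq> []" "set xs \<subseteq> carrier G" "successively (\<lambda>x y. inv x \<otimes> y \<in> T) xs" for xs
    using that
  proof (induction xs rule: walk_chain.induct)
    case (1 x y zs)
    let ?t = "inv x \<otimes> y" and ?xs = "y # zs"
    have t: "?t \<in> T" and xy: "x \<in> carrier G" "y \<in> carrier G" using 1 by auto
    obtain ws where ws: "set ws \<subseteq> letters" "real (length ws) \<le> L * real (length ?xs)" "y \<otimes> wprod ws = last ?xs"
      "fillable (walk_chain ?xs \<oplus>\<^bsub>C1\<^esub> \<ominus>\<^bsub>C1\<^esub> (gmon 1 y \<odot>\<^bsub>C1\<^esub> word_chain ws)) (k * real (length ?xs))"
      using 1 by auto
    let ?E = "edge x y" and ?w = "gmon 1 x \<odot>\<^bsub>C1\<^esub> word_chain (W ?t)" and ?Z = "walk_chain ?xs"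
      and ?v = "gmon 1 y \<odot>\<^bsub>C1\<^esub> word_chain ws"
    have cl: "?E \<in> carrier C1" "?w \<in> carrier C1" "?Z \<in> carrier C1" "?v \<in> carrier C1"
      using xy W[OF t] ws 1 by auto
    have xt: "x \<otimes> ?t = y" using xy by (rule cancel_inv)
    show ?case
    proof (intro exI[of _ "W ?t @ ws"] conjI)
      show "set (W ?t @ ws) \<subseteq> letters" using W[OF t] ws by simp
      show "real (length (W ?t @ ws)) \<le> L * real (length (x # y # zs))"
        using L(2)[OF t] ws(2) by (simp add: algebra_simps)
      show "hd (x # y # zs) \<otimes> wprod (W ?t @ ws) = last (x # y # zs)"
        using xy W[OF t] ws xt by (simp add: wprod_append) (metis G.inv_closed G.m_assoc G.m_closed wprod_closed xt)
      have "fillable (?E \<oplus>\<^bsub>C1\<^esub> \<ominus>\<^bsub>C1\<^esub> ?w) k"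
        using fillable_act[OF k(2)[OF t], of 1 x] xy W[OF t] by (simp add: C1.act_add C1.act_uminus edge_def)
      from fillable_add[OF this ws(4)]
      have "fillable ((?E \<oplus>\<^bsub>C1\<^esub> \<ominus>\<^bsub>C1\<^esub> ?w) \<oplus>\<^bsub>C1\<^esub> (?Z \<oplus>\<^bsub>C1\<^esub> \<ominus>\<^bsub>C1\<^esub> ?v)) (k + k * real (length ?xs))" .
      moreover have "(?E \<oplus>\<^bsub>C1\<^esub> \<ominus>\<^bsub>C1\<^esub> ?w) \<oplus>\<^bsub>C1\<^esub> (?Z \<oplus>\<^bsub>C1\<^esub> \<ominus>\<^bsub>C1\<^esub> ?v) = (?E \<oplus>\<^bsub>C1\<^esub> ?Z) \<oplus>\<^bsub>C1\<^esub> \<ominus>\<^bsub>C1\<^esub> (?w \<oplus>\<^bsub>C1\<^esub> ?v)"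
        using cl by (simp add: C1.M.minus_add C1.M.a_ac)
      moreover have "?w \<oplus>\<^bsub>C1\<^esub> ?v = gmon 1 x \<odot>\<^bsub>C1\<^esub> word_chain (W ?t @ ws)"
        using xy W[OF t] ws xt by (simp add: word_chain_append C1.act_add C1.act_act)
      ultimately show "fillable (walk_chain (x # y # zs) \<oplus>\<^bsub>C1\<^esub> \<ominus>\<^bsub>C1\<^esub> (gmon 1 (hd (x # y # zs)) \<odot>\<^bsub>C1\<^esub> word_chain (W ?t @ ws)))
          (k * real (length (x # y # zs)))"
        by (simp add: algebra_simps)
    qed
  next
    case ("2_2" x)
    then show ?case using L(1) k(1) fillable_mono[OF fillable_zero]
      by (intro exI[of _ "[]"]) (auto simp: C1.act_zero C1_minus_zero)
  qed simp
  show ?thesis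
  proof (intro exI[of _ "k + K * L"] conjI allI impI)
    show "0 \<le> k + K * L" using K L k by simp
    fix xs assume xs: "xs \<noteq> [] \<and> hd xs = last xs \<and> set xs \<subseteq> carrier G \<and> successively (\<lambda>x y. inv x \<otimes> y \<in> T) xs"
    then obtain ws where ws: "set ws \<subseteq> letters" "real (length ws) \<le> L * real (length xs)" "hd xs \<otimes> wprod ws = last xs"
      "fillable (walk_chain xs \<oplus>\<^bsub>C1\<^esub> \<ominus>\<^bsub>C1\<^esub> (gmon 1 (hd xs) \<odot>\<^bsub>C1\<^esub> word_chain ws)) (k * real (length xs))"
      using step by blast
    have hd: "hd xs \<in> carrier G" using xs hd_in_set by blast
    \<comment> \<open>Closedness enters here: the word represents the identity, so it can be
      filled.\<close>
    have "wprod ws = \<one>"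
      using ws(1,3) hd xs inv_mult_eq_iff[of "hd xs" "hd xs" "wprod ws"] by simp
    then have "fillable (gmon 1 (hd xs) \<odot>\<^bsub>C1\<^esub> word_chain ws) (K * real (length ws))"
      using fillable_act[OF K(2)[OF ws(1)], of 1 "hd xs"] hd by simp
    from fillable_add[OF ws(4) this]
    have "fillable (walk_chain xs) (k * real (length xs) + K * real (length ws))"
      using xs ws(1) hd by (simp add: C1.M.a_assoc C1.M.l_neg)
    moreover have "k * real (length xs) + K * real (length ws) \<le> (k + K * L) * real (length xs)"
      using mult_left_mono[OF ws(2) K(1)] by (simp add: algebra_simps)
    ultimately show "fillable (walk_chain xs) ((k + K * L) * real (length xs))" by (rule fillable_mono)
  qed
qed

end

section \<open>Decomposition of cycles into closed walks\<close>

context fp2_generated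
begin

lemma walk_chain_snoc:
  "xs \<noteq> [] \<Longrightarrow> set xs \<subseteq> carrier G \<Longrightarrow> y \<in> carrier G \<Longrightarrow>
    walk_chain (xs @ [y]) = walk_chain xs \<oplus>\<^bsub>C1\<^esub> edge (last xs) y"
proof (induction xs rule: walk_chain.induct)
  case (1 x y' zs)
  then have "last (y' # zs) \<in> carrier G" using last_in_set[of "y' # zs"] by (auto simp del: last.simps last_in_set)
  then show ?case using 1 by (simp add: C1.M.a_assoc)
qed auto

lemma walk_chain_upt:
  assumes "\<And>i. i \<le> k \<Longrightarrow> s i \<in> carrier G"
  shows "walk_chain (map s [0..<Suc k]) = (\<Oplus>\<^bsub>C1\<^esub>i\<in>{..<k}. edge (s i) (s (Suc i)))"
  using assms
proof (induction k)
  case (Suc k)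
  have "walk_chain (map s [0..<Suc (Suc k)]) = walk_chain (map s [0..<Suc k] @ [s (Suc k)])" by simp
  also have "\<dots> = walk_chain (map s [0..<Suc k]) \<oplus>\<^bsub>C1\<^esub> edge (last (map s [0..<Suc k])) (s (Suc k))"
    using Suc.prems by (intro walk_chain_snoc) (auto simp del: upt_Suc)
  also have "walk_chain (map s [0..<Suc k]) = (\<Oplus>\<^bsub>C1\<^esub>i\<in>{..<k}. edge (s i) (s (Suc i)))"
    using Suc by simp
  finally show ?case
    using Suc.prems by (simp add: lessThan_Suc C1.M.finsum_insert C1.M.a_comm C1.M.finsum_closed Pi_iff)
qed simp

text \<open>Following the flow from edge to edge eventually repeats an edge. Subtracting the least
  weight along the resulting cycle preserves conservation at the vertices and removes at least one
  edge. Nothing cancels: the weights of the cycles times their lengths add up to the total weight,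
  and so the costs add up as well.\<close>

lemma flow_filling:
  assumes K: "K \<ge> 0" "\<And>xs. xs \<noteq> [] \<Longrightarrow> hd xs = last xs \<Longrightarrow> set xs \<subseteq> carrier G \<Longrightarrow>
     successively (\<lambda>x y. inv x \<otimes> y \<in> T) xs \<Longrightarrow> fillable (walk_chain xs) (K * real (length xs))"
    and J: "finite J" and e: "\<And>j. j \<in> J \<Longrightarrow> src j \<in> carrier G \<and> tgt j \<in> carrier G \<and> inv (src j) \<otimes> tgt j \<in> T"
    and wt: "\<And>j. j \<in> J \<Longrightarrow> wt j > 0 \<and> complex_of_real (wt j) \<in> R"
    and bal: "\<And>v. (\<Sum>j\<in>J. wt j * of_bool (src j = v)) = (\<Sum>j\<in>J. wt j * of_bool (tgt j = v))"
  shows "fillable (\<Oplus>\<^bsub>C1\<^esub>j\<in>J. gmon (of_real (wt j)) \<one> \<odot>\<^bsub>C1\<^esub> edge (src j) (tgt j)) (2 * K * (\<Sum>j\<in>J. wt j))"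
  using J e wt bal
proof (induction "card J" arbitrary: J wt rule: less_induct)
  case less
  note e = less.prems(2) and wt = less.prems(3) and bal = less.prems(4)
  show ?case
  proof (cases "J = {}")
    case True
    then show ?thesis by (simp add: fillable_zero)
  next
    case False
    \<comment> \<open>Weight that enters the end of an edge has to leave it, so every edge has a
      successor in \<open>J\<close>.\<close>
    have "\<forall>j\<in>J. \<exists>j'\<in>J. src j' = tgt j"
    proof
      fix j assume j: "j \<in> J"
      have "0 < wt j * of_bool (tgt j = tgt j)" using wt j by simp
      also have "\<dots> \<le> (\<Sum>j'\<in>J. wt j' * of_bool (tgt j' = tgt j))"
        using wt less.prems(1) j by (intro member_le_sum) (auto simp: less_imp_le)
      also have "\<dots> = (\<Sum>j'\<in>J. wt j' * of_bool (src j' = tgt j))" by (rule bal[symmetric])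
      finally have "(\<Sum>j'\<in>J. wt j' * of_bool (src j' = tgt j)) \<noteq> 0" by simp
      then obtain j' where "j' \<in> J" "wt j' * of_bool (src j' = tgt j) \<noteq> 0" by (rule sum.not_neutral_contains_not_neutral)
      then show "\<exists>j'\<in>J. src j' = tgt j" by auto
    qed
    then obtain f where f: "\<And>j. j \<in> J \<Longrightarrow> f j \<in> J" "\<And>j. j \<in> J \<Longrightarrow> src (f j) = tgt j" by metis
    obtain j0 where "j0 \<in> J" using False by blast
    then obtain j k where j: "j \<in> J" and k: "k > 0" "(f ^^ k) j = j" and inj: "inj_on (\<lambda>i. (f ^^ i) j) {..<k}"
      using periodic_orbit[of J j0 f] less.prems(1) f(1) by blast
    define o' where "o' i = (f ^^ i) j" for i
    define Z where "Z = o' ` {..<k}"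
    have oJ: "o' i \<in> J" for i unfolding o'_def using j f(1) by (induction i) auto
    have osrc: "src (o' (Suc i)) = tgt (o' i)" for i using f(2)[OF oJ] by (simp add: o'_def)
    have inj: "inj_on o' {..<k}" using inj by (simp add: o'_def[abs_def])
    have Z: "finite Z" "Z \<subseteq> J" "Z \<noteq> {}" using oJ k by (auto simp: Z_def)
    have cardZ: "card Z = k" using inj by (simp add: Z_def card_image)
    \<comment> \<open>With the minimum, all weights stay nonnegative and in \<open>R\<close>, and
      the weight of the edge \<open>z\<close> below becomes 0.\<close>
    define a where "a = Min (wt ` Z)"
    have "a \<in> wt ` Z" unfolding a_def using Z by (intro Min_in) auto
    then obtain z where z: "z \<in> Z" "wt z = a" by auto
    have a: "a > 0" "complex_of_real a \<in> R" using wt z Z by auto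
    have a_le: "a \<le> wt i" if "i \<in> Z" for i unfolding a_def using Z that by (intro Min_le) auto
    define wt' where "wt' i = wt i - (if i \<in> Z then a else 0)" for i
    have wt'_nonneg: "wt' i \<ge> 0" if "i \<in> J" for i using wt[OF that] a_le[of i] by (auto simp: wt'_def)
    have wt'_R: "complex_of_real (wt' i) \<in> R" if "i \<in> J" for i
    proof -
      have "complex_of_real (wt i) + - complex_of_real a \<in> R"
        using wt[OF that] a(2) by (intro R_closed(3) R_closed(5)) auto
      then show ?thesis using wt[OF that] by (simp add: wt'_def)
    qed
    define J' where "J' = {i \<in> J. wt' i > 0}"
    have J'J: "J' \<subseteq> J" by (auto simp: J'_def)
    have zero: "wt' i = 0" if "i \<in> J - J'" for i using that wt'_nonneg[of i] by (auto simp: J'_def)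
    have "z \<notin> J'" using z by (simp add: J'_def wt'_def)
    then have "J' \<subset> J" using J'J z Z by auto
    then have card: "card J' < card J" using less.prems(1) by (simp add: psubset_card_mono)
    have sumJ': "(\<Sum>i\<in>J'. wt' i * h i) = (\<Sum>i\<in>J. wt i * h i) - a * (\<Sum>i\<in>Z. h i)" for h :: "_ \<Rightarrow> real"
    proof -
      have "(\<Sum>i\<in>J'. wt' i * h i) = (\<Sum>i\<in>J. wt' i * h i)"
        using less.prems(1) J'J zero by (intro sum.mono_neutral_left) auto
      also have "\<dots> = (\<Sum>i\<in>J. wt i * h i) - (\<Sum>i\<in>J. if i \<in> Z then a * h i else 0)"
        by (simp add: wt'_def sum_subtractf[symmetric] left_diff_distrib if_distrib[of "\<lambda>x. x * _"] cong: if_cong)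
      also have "(\<Sum>i\<in>J. if i \<in> Z then a * h i else 0) = (\<Sum>i\<in>Z. a * h i)"
        using less.prems(1) Z by (simp add: sum.inter_restrict[symmetric] Int_absorb1)
      finally show ?thesis by (simp add: sum_distrib_left)
    qed
    have cyc: "(\<Sum>i\<in>Z. of_bool (src i = v)) = (\<Sum>i\<in>Z. of_bool (tgt i = v) :: real)" for v
    proof -
      have "(\<Sum>i\<in>Z. of_bool (tgt i = v) :: real) = (\<Sum>i<k. of_bool (src (o' (Suc i)) = v))"
        unfolding Z_def by (simp add: sum.reindex[OF inj] osrc)
      moreover have "(\<Sum>i\<in>Z. of_bool (src i = v) :: real) = (\<Sum>i<k. of_bool (src (o' i) = v))"
        unfolding Z_def by (simp add: sum.reindex[OF inj])
      moreover have "(\<Sum>i<k. of_bool (src (o' (Suc i)) = v) - of_bool (src (o' i) = v) :: real) = 0"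
        unfolding sum_lessThan_telescope[of "\<lambda>i. of_bool (src (o' i) = v)"] using k by (simp add: o'_def)
      ultimately show ?thesis by (simp add: sum_subtractf)
    qed
    let ?q = "\<lambda>i. edge (src i) (tgt i)"
    have q: "?q i \<in> carrier C1" if "i \<in> J" for i using e[OF that] by simp
    have IH: "fillable (\<Oplus>\<^bsub>C1\<^esub>i\<in>J'. gmon (of_real (wt' i)) \<one> \<odot>\<^bsub>C1\<^esub> ?q i) (2 * K * (\<Sum>i\<in>J'. wt' i))"
    proof (rule less.hyps[OF card])
      show "finite J'" using less.prems(1) J'J by (rule rev_finite_subset)
      show "src i \<in> carrier G \<and> tgt i \<in> carrier G \<and> inv (src i) \<otimes> tgt i \<in> T" if "i \<in> J'" for i
        using e J'J that by blast
      show "wt' i > 0 \<and> complex_of_real (wt' i) \<in> R" if "i \<in> J'" for i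
        using that wt'_R by (auto simp: J'_def)
      show "(\<Sum>i\<in>J'. wt' i * of_bool (src i = v)) = (\<Sum>i\<in>J'. wt' i * of_bool (tgt i = v))" for v
        unfolding sumJ' bal cyc ..
    qed
    let ?xs = "map (\<lambda>i. src (o' i)) [0..<Suc k]"
    have xs: "fillable (walk_chain ?xs) (K * real (length ?xs))"
    proof (rule K(2))
      show "hd ?xs = last ?xs" using k by (simp add: hd_map last_map o'_def del: upt_Suc)
      show "set ?xs \<subseteq> carrier G" using e oJ by (auto simp del: upt_Suc)
      show "successively (\<lambda>x y. inv x \<otimes> y \<in> T) ?xs"
        unfolding successively_map successively_conv_nth using e[OF oJ] osrc by (auto simp del: upt_Suc)
    qed simp
    have chain: "walk_chain ?xs = (\<Oplus>\<^bsub>C1\<^esub>i\<in>Z. ?q i)"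
    proof -
      have "walk_chain ?xs = (\<Oplus>\<^bsub>C1\<^esub>i\<in>{..<k}. ?q (o' i))"
        using e[OF oJ] by (subst walk_chain_upt) (auto simp: osrc)
      also have "\<dots> = (\<Oplus>\<^bsub>C1\<^esub>i\<in>Z. ?q i)"
        unfolding Z_def using q[OF oJ] inj by (intro C1.M.finsum_reindex[symmetric]) auto
      finally show ?thesis .
    qed
    \<comment> \<open>A cycle of \<open>k\<close> edges is a list of \<open>k + 1\<close> vertices,
      and \<open>k + 1 \<le> 2 * k\<close>; this is the factor 2 in the conclusion.\<close>
    have "K * real (length ?xs) \<le> K * (2 * real k)"
      using K(1) k by (intro mult_left_mono) auto
    then have "fillable (\<Oplus>\<^bsub>C1\<^esub>i\<in>Z. ?q i) (K * (2 * real k))" using xs chain fillable_mono by simp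
    from fillable_act[OF this a(2), of \<one>]
    have cycle: "fillable (gmon (of_real a) \<one> \<odot>\<^bsub>C1\<^esub> (\<Oplus>\<^bsub>C1\<^esub>i\<in>Z. ?q i)) (a * (K * (2 * real k)))"
      using a(1) by simp
    let ?g = "\<lambda>i. gmon (of_real (wt' i)) \<one> \<odot>\<^bsub>C1\<^esub> ?q i"
    let ?h = "\<lambda>i. gmon (if i \<in> Z then of_real a else 0) \<one> \<odot>\<^bsub>C1\<^esub> ?q i"
    have gh: "?g i \<in> carrier C1" "?h i \<in> carrier C1" if "i \<in> J" for i using q wt'_R a(2) that by auto
    have "(\<Oplus>\<^bsub>C1\<^esub>i\<in>J. gmon (of_real (wt i)) \<one> \<odot>\<^bsub>C1\<^esub> ?q i) = (\<Oplus>\<^bsub>C1\<^esub>i\<in>J. ?g i \<oplus>\<^bsub>C1\<^esub> ?h i)"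
    proof (rule C1.M.finsum_cong'[OF refl])
      show "(\<lambda>i. ?g i \<oplus>\<^bsub>C1\<^esub> ?h i) \<in> J \<rightarrow> carrier C1" using gh by simp
      fix i assume i: "i \<in> J"
      have "of_real (wt i) = complex_of_real (wt' i) + (if i \<in> Z then of_real a else 0)" by (simp add: wt'_def)
      then show "gmon (of_real (wt i)) \<one> \<odot>\<^bsub>C1\<^esub> ?q i = ?g i \<oplus>\<^bsub>C1\<^esub> ?h i"
        using q[OF i] wt'_R[OF i] a(2) by (simp only:) (intro C1.act_add_scalar, auto)
    qed
    also have "\<dots> = (\<Oplus>\<^bsub>C1\<^esub>i\<in>J. ?g i) \<oplus>\<^bsub>C1\<^esub> (\<Oplus>\<^bsub>C1\<^esub>i\<in>J. ?h i)"
      using gh by (intro C1.M.finsum_addf) auto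
    also have "(\<Oplus>\<^bsub>C1\<^esub>i\<in>J. ?g i) = (\<Oplus>\<^bsub>C1\<^esub>i\<in>J'. ?g i)"
      using less.prems(1) J'J zero gh q
      by (intro C1.M.add.finprod_mono_neutral_cong_right) (auto simp: C1.act_zero_scalar)
    also have "(\<Oplus>\<^bsub>C1\<^esub>i\<in>J. ?h i) = (\<Oplus>\<^bsub>C1\<^esub>i\<in>Z. gmon (of_real a) \<one> \<odot>\<^bsub>C1\<^esub> ?q i)"
      using less.prems(1) Z gh q
      by (intro C1.M.add.finprod_mono_neutral_cong_right) (auto simp: C1.act_zero_scalar)
    also have "\<dots> = gmon (of_real a) \<one> \<odot>\<^bsub>C1\<^esub> (\<Oplus>\<^bsub>C1\<^esub>i\<in>Z. ?q i)"
      using Z a(2) q by (intro C1.smult_finsum[symmetric]) auto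
    finally have "(\<Oplus>\<^bsub>C1\<^esub>i\<in>J. gmon (of_real (wt i)) \<one> \<odot>\<^bsub>C1\<^esub> ?q i) =
      (\<Oplus>\<^bsub>C1\<^esub>i\<in>J'. ?g i) \<oplus>\<^bsub>C1\<^esub> gmon (of_real a) \<one> \<odot>\<^bsub>C1\<^esub> (\<Oplus>\<^bsub>C1\<^esub>i\<in>Z. ?q i)" .
    moreover have "2 * K * (\<Sum>i\<in>J'. wt' i) + a * (K * (2 * real k)) = 2 * K * (\<Sum>i\<in>J. wt i)"
    proof -
      have "(\<Sum>i\<in>J. wt i) = (\<Sum>i\<in>J'. wt' i) + a * real k" using sumJ'[of "\<lambda>_. 1"] cardZ by simp
      then show ?thesis by (simp only: algebra_simps)
    qed
    ultimately show ?thesis using fillable_add[OF IH cycle] by simp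
  qed
qed

text \<open>A triple \<open>(r, x, z)\<close> stands for \<open>r\<close> times the edge from \<open>x\<close> to \<open>z\<close>.\<close>

fun list_chain :: "(complex \<times> 'g \<times> 'g) list \<Rightarrow> 'm" where
  "list_chain [] = \<zero>\<^bsub>C1\<^esub>"
| "list_chain ((r, x, z) # L) = gmon r \<one> \<odot>\<^bsub>C1\<^esub> edge x z \<oplus>\<^bsub>C1\<^esub> list_chain L"

text \<open>The boundary is recorded through its pairing with functions on the group, which makes it
  directly comparable with \<open>phi \<circ> d1\<close>.\<close>

fun list_boundary :: "(complex \<times> 'g \<times> 'g) list \<Rightarrow> ('g \<Rightarrow> complex) \<Rightarrow> complex" where
  "list_boundary [] k = 0"
| "list_boundary ((r, x, z) # L) k = r * (k z - k x) + list_boundary L k"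

fun list_norm :: "(complex \<times> 'g \<times> 'g) list \<Rightarrow> real" where
  "list_norm [] = 0"
| "list_norm ((r, x, z) # L) = cmod r + list_norm L"

definition edges_in :: "'g set \<Rightarrow> (complex \<times> 'g \<times> 'g) list \<Rightarrow> bool" where
  "edges_in T L \<longleftrightarrow> (\<forall>(r, x, z) \<in> set L. r \<in> R \<and> x \<in> carrier G \<and> z \<in> carrier G \<and> inv x \<otimes> z \<in> T)"

lemma edges_in_simps [simp]:
  "edges_in T []"
  "edges_in T ((r, x, z) # L) \<longleftrightarrow> r \<in> R \<and> x \<in> carrier G \<and> z \<in> carrier G \<and> inv x \<otimes> z \<in> T \<and> edges_in T L"
  "edges_in T (L @ L') \<longleftrightarrow> edges_in T L \<and> edges_in T L'"
  by (simp_all add: edges_in_def ball_Un)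

lemma list_chain_closed [simp]: "edges_in T L \<Longrightarrow> list_chain L \<in> carrier C1"
  by (induction L rule: list_chain.induct) auto

lemma list_norm_nonneg: "list_norm L \<ge> 0"
  by (induction L rule: list_norm.induct) auto

lemma list_append:
  "edges_in T L \<Longrightarrow> edges_in T L' \<Longrightarrow> list_chain (L @ L') = list_chain L \<oplus>\<^bsub>C1\<^esub> list_chain L'"
  "list_boundary (L @ L') k = list_boundary L k + list_boundary L' k"
  "list_norm (L @ L') = list_norm L + list_norm L'"
  by (induction L rule: list_chain.induct) (auto simp: C1.M.a_assoc)

lemma list_sums:
  "edges_in T L \<Longrightarrow> list_chain L = (\<Oplus>\<^bsub>C1\<^esub>i\<in>{..<length L}. gmon (fst (L ! i)) \<one> \<odot>\<^bsub>C1\<^esub> edge (fst (snd (L ! i))) (snd (snd (L ! i))))"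
  "list_boundary L k = (\<Sum>i<length L. fst (L ! i) * (k (snd (snd (L ! i))) - k (fst (snd (L ! i)))))"
  "list_norm L = (\<Sum>i<length L. cmod (fst (L ! i)))"
proof (induction L rule: rev_induct)
  case (snoc p L)
  obtain r x z where p: "p = (r, x, z)" by (cases p)
  note app = list_append[where L = L and L' = "[p]"]
  show "list_boundary (L @ [p]) k = (\<Sum>i<length (L @ [p]). fst ((L @ [p]) ! i) * (k (snd (snd ((L @ [p]) ! i))) - k (fst (snd ((L @ [p]) ! i)))))"
    unfolding app(2) snoc by (simp add: p nth_append)
  show "list_norm (L @ [p]) = (\<Sum>i<length (L @ [p]). cmod (fst ((L @ [p]) ! i)))"
    unfolding app(3) snoc by (simp add: p nth_append)
  assume E: "edges_in T (L @ [p])"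
  let ?F = "\<lambda>L i. gmon (fst (L ! i)) \<one> \<odot>\<^bsub>C1\<^esub> edge (fst (snd (L ! i))) (snd (snd (L ! i)))"
  have cl: "?F L i \<in> carrier C1" if "i < length L" for i
  proof -
    obtain r' x' z' where "L ! i = (r', x', z')" by (cases "L ! i")
    moreover from this have "(r', x', z') \<in> set L" using nth_mem[OF that] by simp
    then have "r' \<in> R \<and> x' \<in> carrier G \<and> z' \<in> carrier G" using E unfolding edges_in_def by fastforce
    ultimately show ?thesis by simp
  qed
  have pcl: "gmon r \<one> \<odot>\<^bsub>C1\<^esub> edge x z \<in> carrier C1" using E by (simp add: p)
  have "(\<Oplus>\<^bsub>C1\<^esub>i\<in>{..<length (L @ [p])}. ?F (L @ [p]) i) = ?F (L @ [p]) (length L) \<oplus>\<^bsub>C1\<^esub> (\<Oplus>\<^bsub>C1\<^esub>i\<in>{..<length L}. ?F (L @ [p]) i)"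
    using cl pcl by (simp add: lessThan_Suc nth_append p C1.M.finsum_insert Pi_iff)
  also have "(\<Oplus>\<^bsub>C1\<^esub>i\<in>{..<length L}. ?F (L @ [p]) i) = (\<Oplus>\<^bsub>C1\<^esub>i\<in>{..<length L}. ?F L i)"
    using cl by (intro C1.M.finsum_cong') (auto simp: nth_append)
  also have "\<dots> = list_chain L" using snoc(1) E by simp
  finally have "(\<Oplus>\<^bsub>C1\<^esub>i\<in>{..<length (L @ [p])}. ?F (L @ [p]) i) = gmon r \<one> \<odot>\<^bsub>C1\<^esub> edge x z \<oplus>\<^bsub>C1\<^esub> list_chain L"
    by (simp only: p nth_append_length fst_conv snd_conv)
  also have "\<dots> = list_chain L \<oplus>\<^bsub>C1\<^esub> gmon r \<one> \<odot>\<^bsub>C1\<^esub> edge x z"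
    using E pcl list_chain_closed[of T L] by (intro C1.M.a_comm) auto
  also have "\<dots> = list_chain (L @ [p])"
    using E pcl app(1)[of T] by (simp add: p)
  finally show "list_chain (L @ [p]) = (\<Oplus>\<^bsub>C1\<^esub>i\<in>{..<length (L @ [p])}. ?F (L @ [p]) i)" ..
qed simp_all

text \<open>The positions in the list index the edges, so parallel edges are kept apart; those of
  weight 0 are dropped because the flow decomposition works with positive weights. Evaluated at the
  indicator function of \<open>v\<close>, the boundary is inflow minus outflow at
  \<open>v\<close>.\<close>

lemma list_flow_filling:
  assumes K: "K \<ge> 0" "\<And>xs. xs \<noteq> [] \<Longrightarrow> hd xs = last xs \<Longrightarrow> set xs \<subseteq> carrier G \<Longrightarrow>
     successively (\<lambda>x y. inv x \<otimes> y \<in> T) xs \<Longrightarrow> fillable (walk_chain xs) (K * real (length xs))"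
    and E: "edges_in T L" and pos: "\<And>r x z. (r, x, z) \<in> set L \<Longrightarrow> Im r = 0 \<and> Re r \<ge> 0"
    and bal: "\<And>v. list_boundary L (\<lambda>g. of_bool (g = v)) = 0"
  shows "fillable (list_chain L) (2 * K * list_norm L)"
proof -
  define wt where "wt i = Re (fst (L ! i))" for i
  define src where "src i = fst (snd (L ! i))" for i
  define tgt where "tgt i = snd (snd (L ! i))" for i
  define J where "J = {i. i < length L \<and> wt i > 0}"
  have entry: "fst (L ! i) = of_real (wt i)" "wt i \<ge> 0" "complex_of_real (wt i) \<in> R"
     "src i \<in> carrier G" "tgt i \<in> carrier G" "inv (src i) \<otimes> tgt i \<in> T" if "i < length L" for i
  proof -
    obtain r x z where rxz: "L ! i = (r, x, z)" by (cases "L ! i")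
    then have "(r, x, z) \<in> set L" using nth_mem[OF that] by simp
    then have "Im r = 0" "Re r \<ge> 0" "r \<in> R" "x \<in> carrier G" "z \<in> carrier G" "inv x \<otimes> z \<in> T"
      using pos[of r x z] E unfolding edges_in_def by fastforce+
    moreover from this have "r = of_real (Re r)" by (simp add: complex_eq_iff)
    ultimately show "fst (L ! i) = of_real (wt i)" "wt i \<ge> 0" "complex_of_real (wt i) \<in> R"
     "src i \<in> carrier G" "tgt i \<in> carrier G" "inv (src i) \<otimes> tgt i \<in> T"
      by (simp_all add: rxz wt_def src_def tgt_def)
  qed
  have J: "finite J" "J \<subseteq> {..<length L}" by (auto simp: J_def)
  have zero: "wt i = 0" if "i \<in> {..<length L} - J" for i using that entry(2)[of i] by (force simp: J_def)
  have restrict: "(\<Sum>i\<in>J. wt i * h i) = (\<Sum>i<length L. wt i * h i)" for h :: "nat \<Rightarrow> real"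
    using J zero by (intro sum.mono_neutral_left) auto
  have "list_chain L = (\<Oplus>\<^bsub>C1\<^esub>i\<in>{..<length L}. gmon (of_real (wt i)) \<one> \<odot>\<^bsub>C1\<^esub> edge (src i) (tgt i))"
    unfolding list_sums(1)[OF E] using entry
    by (intro C1.M.finsum_cong') (auto simp: src_def tgt_def)
  also have "\<dots> = (\<Oplus>\<^bsub>C1\<^esub>i\<in>J. gmon (of_real (wt i)) \<one> \<odot>\<^bsub>C1\<^esub> edge (src i) (tgt i))"
    using J zero entry
    by (intro C1.M.add.finprod_mono_neutral_cong_right) (auto simp: C1.act_zero_scalar)
  finally have chain: "list_chain L = (\<Oplus>\<^bsub>C1\<^esub>i\<in>J. gmon (of_real (wt i)) \<one> \<odot>\<^bsub>C1\<^esub> edge (src i) (tgt i))" .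
  have "list_norm L = (\<Sum>i\<in>J. wt i)"
  proof -
    have "list_norm L = (\<Sum>i<length L. wt i)"
      unfolding list_sums(3) using entry(1,2) by (intro sum.cong refl) simp
    then show ?thesis using restrict[of "\<lambda>_. 1"] by simp
  qed
  moreover have "fillable (\<Oplus>\<^bsub>C1\<^esub>i\<in>J. gmon (of_real (wt i)) \<one> \<odot>\<^bsub>C1\<^esub> edge (src i) (tgt i)) (2 * K * (\<Sum>i\<in>J. wt i))"
  proof (rule flow_filling[OF K(1) _ J(1)])
    show "fillable (walk_chain xs) (K * real (length xs))"
      if "xs \<noteq> []" "hd xs = last xs" "set xs \<subseteq> carrier G" "successively (\<lambda>x y. inv x \<otimes> y \<in> T) xs" for xs
      using K(2) that .
    show "src i \<in> carrier G \<and> tgt i \<in> carrier G \<and> inv (src i) \<otimes> tgt i \<in> T" if "i \<in> J" for i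
      using entry that J by auto
    show "wt i > 0 \<and> complex_of_real (wt i) \<in> R" if "i \<in> J" for i
      using entry that by (auto simp: J_def)
    fix v
    have "complex_of_real (\<Sum>i<length L. wt i * (of_bool (tgt i = v) - of_bool (src i = v))) = list_boundary L (\<lambda>g. of_bool (g = v))"
      unfolding list_sums(2) of_real_sum using entry(1) by (intro sum.cong) (auto simp: src_def tgt_def)
    then have "(\<Sum>i<length L. wt i * (of_bool (tgt i = v) - of_bool (src i = v))) = 0"
      using bal by (metis of_real_eq_0_iff)
    then show "(\<Sum>i\<in>J. wt i * of_bool (src i = v)) = (\<Sum>i\<in>J. wt i * of_bool (tgt i = v))"
      unfolding restrict by (simp add: right_diff_distrib sum_subtractf)
  qed
  ultimately show ?thesis using chain by simp
qed

end

section \<open>Linear filling of cycles\<close>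

lemma (in coeff_group) A_induct [consumes 1, case_names zero add]:
  assumes a: "a \<in> carrier A" and zero: "P (\<lambda>_. 0)"
    and add: "\<And>a r g. \<lbrakk>a \<in> carrier A; P a; r \<in> R; g \<in> carrier G\<rbrakk> \<Longrightarrow> P (a \<oplus>\<^bsub>A\<^esub> gmon r g)"
  shows "P a"
  using a
proof (induction "card {g. a g \<noteq> 0}" arbitrary: a)
  case 0
  then have "a = (\<lambda>_. 0)" by (auto simp: A_simps)
  then show ?case using zero by simp
next
  case (Suc n)
  then obtain g where g: "a g \<noteq> 0" by fastforce
  let ?b = "a(g := 0)"
  have fin: "finite {h. a h \<noteq> 0}" using fin_A Suc by blast
  have supp: "{h. ?b h \<noteq> 0} = {h. a h \<noteq> 0} - {g}" by auto
  have b: "?b \<in> carrier A" using Suc.prems fin R_closed(1) unfolding A_simps(1) supp by auto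
  have "n = card {h. ?b h \<noteq> 0}" unfolding supp using Suc.hyps(2) fin g by simp
  then have "P ?b" using b by (rule Suc.hyps(1))
  moreover have "a g \<in> R" "g \<in> carrier G" using Suc.prems g by (auto simp: A_simps)
  moreover have "a = ?b \<oplus>\<^bsub>A\<^esub> gmon (a g) g" by (auto simp: A_simps gmon_def)
  ultimately show ?case using add[OF b] by metis
qed

context fp2_generated
begin

text \<open>A star of edges from \<open>\<one>\<close> to the support of \<open>a\<close>, weighted
  by the coefficients. If \<open>a\<close> has augmentation 0, this is a 1-chain with boundary
  \<open>a \<odot> e0\<close>.\<close>

lemma list_of_group_ring:
  assumes "a \<in> carrier A"
  shows "\<exists>L. edges_in UNIV L \<and> pairing a (\<lambda>_. 1) \<in> R \<and>
    d1 (list_chain L) = a \<odot>\<^bsub>C0\<^esub> e0 \<oplus>\<^bsub>C0\<^esub> \<ominus>\<^bsub>C0\<^esub> (gmon (pairing a (\<lambda>_. 1)) \<one> \<odot>\<^bsub>C0\<^esub> e0) \<and>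
    (\<forall>k. list_boundary L k = pairing a k - pairing a (\<lambda>_. 1) * k \<one>)"
  using assms
proof (induction rule: A_induct)
  case zero
  show ?case
    using C0.act_zero_scalar[of e0 \<one>]
    by (intro exI[of _ "[]"]) (auto simp: pairing_zero d1_zero gmon_zero C0.M.r_neg)
next
  case (add a r g)
  then obtain L where L: "edges_in UNIV L" "pairing a (\<lambda>_. 1) \<in> R"
    "d1 (list_chain L) = a \<odot>\<^bsub>C0\<^esub> e0 \<oplus>\<^bsub>C0\<^esub> \<ominus>\<^bsub>C0\<^esub> (gmon (pairing a (\<lambda>_. 1)) \<one> \<odot>\<^bsub>C0\<^esub> e0)"
    "\<And>k. list_boundary L k = pairing a k - pairing a (\<lambda>_. 1) * k \<one>" by blast
  let ?s = "pairing a (\<lambda>_. 1)"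
  have s: "pairing (a \<oplus>\<^bsub>A\<^esub> gmon r g) k = pairing a k + r * k g" for k
    using add by (simp add: pairing_A_add pairing_mon)
  let ?x = "a \<odot>\<^bsub>C0\<^esub> e0" and ?y = "gmon ?s \<one> \<odot>\<^bsub>C0\<^esub> e0" and ?z = "gmon r g \<odot>\<^bsub>C0\<^esub> e0" and ?w = "gmon r \<one> \<odot>\<^bsub>C0\<^esub> e0"
  have cl: "?x \<in> carrier C0" "?y \<in> carrier C0" "?z \<in> carrier C0" "?w \<in> carrier C0"
    using add L by (auto simp: C0.smult_closed)
  have "d1 (list_chain ((r, \<one>, g) # L)) = (?z \<oplus>\<^bsub>C0\<^esub> \<ominus>\<^bsub>C0\<^esub> ?w) \<oplus>\<^bsub>C0\<^esub> (?x \<oplus>\<^bsub>C0\<^esub> \<ominus>\<^bsub>C0\<^esub> ?y)"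
    using add L list_chain_closed[OF L(1)]
    by (simp add: d1_add d1_smult d1_edge C0.act_add C0.act_act C0.act_uminus C0.act_one)
  also have "\<dots> = (?x \<oplus>\<^bsub>C0\<^esub> ?z) \<oplus>\<^bsub>C0\<^esub> \<ominus>\<^bsub>C0\<^esub> (?y \<oplus>\<^bsub>C0\<^esub> ?w)"
    using cl by (simp add: C0.M.minus_add C0.M.a_ac)
  also have "?x \<oplus>\<^bsub>C0\<^esub> ?z = (a \<oplus>\<^bsub>A\<^esub> gmon r g) \<odot>\<^bsub>C0\<^esub> e0" using add by (simp add: C0.smult_l_distr)
  also have "?y \<oplus>\<^bsub>C0\<^esub> ?w = gmon (?s + r) \<one> \<odot>\<^bsub>C0\<^esub> e0" using add L by (simp add: C0.act_add_scalar)
  finally show ?case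
    using add L R_closed by (intro exI[of _ "(r, \<one>, g) # L"]) (simp add: s algebra_simps)
qed

section \<open>Translating and orienting lists of weighted edges\<close>

definition scale_list :: "complex \<Rightarrow> 'g \<Rightarrow> (complex \<times> 'g \<times> 'g) list \<Rightarrow> (complex \<times> 'g \<times> 'g) list" where
  "scale_list r g L = map (\<lambda>(c, x, z). (r * c, g \<otimes> x, g \<otimes> z)) L"

lemma scale_list_simps [simp]:
  "scale_list r g [] = []"
  "scale_list r g ((c, x, z) # L) = (r * c, g \<otimes> x, g \<otimes> z) # scale_list r g L"
  by (simp_all add: scale_list_def)

lemma translate_inv: "\<lbrakk>g \<in> carrier G; x \<in> carrier G; z \<in> carrier G\<rbrakk> \<Longrightarrow> inv (g \<otimes> x) \<otimes> (g \<otimes> z) = inv x \<otimes> z"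
  by (simp add: G.inv_mult_group G.m_assoc) (simp add: G.m_assoc[symmetric])

lemma scale_list:
  assumes "r \<in> R" "g \<in> carrier G" "edges_in T L"
  shows "edges_in T (scale_list r g L)"
    and "list_chain (scale_list r g L) = gmon r g \<odot>\<^bsub>C1\<^esub> list_chain L"
    and "list_boundary (scale_list r g L) k = r * list_boundary L (\<lambda>h. k (g \<otimes> h))"
    and "list_norm (scale_list r g L) = cmod r * list_norm L"
proof -
  show "edges_in T (scale_list r g L)"
    using assms by (induction L rule: list_chain.induct) (auto simp: R_closed(4) translate_inv)
  show "list_boundary (scale_list r g L) k = r * list_boundary L (\<lambda>h. k (g \<otimes> h))"
    by (induction L rule: list_chain.induct) (auto simp: algebra_simps)
  show "list_norm (scale_list r g L) = cmod r * list_norm L"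
    by (induction L rule: list_chain.induct) (auto simp: algebra_simps norm_mult)
  show "list_chain (scale_list r g L) = gmon r g \<odot>\<^bsub>C1\<^esub> list_chain L"
    using assms
  proof (induction L rule: list_chain.induct)
    case (2 c x z L)
    then have cl: "edge x z \<in> carrier C1" "list_chain L \<in> carrier C1" by auto
    have "gmon (r * c) \<one> \<odot>\<^bsub>C1\<^esub> edge (g \<otimes> x) (g \<otimes> z) = gmon (r * c) \<one> \<odot>\<^bsub>C1\<^esub> (gmon 1 g \<odot>\<^bsub>C1\<^esub> edge x z)"
      using 2 by (simp add: edge_translate)
    also have "\<dots> = gmon r g \<odot>\<^bsub>C1\<^esub> (gmon c \<one> \<odot>\<^bsub>C1\<^esub> edge x z)"
      using 2 cl R_closed(4) by (simp add: C1.act_act)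
    finally show ?case using 2 cl by (simp add: C1.act_add)
  qed (simp add: C1.act_zero)
qed

text \<open>\<open>p\<close> will be the real or the imaginary part. An edge on which it is negative
  is reversed; by antisymmetry of \<open>edge\<close> the chain and its boundary remain those of the
  weight \<open>p c\<close>, while all weights become nonnegative.\<close>

definition orient :: "(complex \<Rightarrow> real) \<Rightarrow> (complex \<times> 'g \<times> 'g) list \<Rightarrow> (complex \<times> 'g \<times> 'g) list" where
  "orient p L = map (\<lambda>(c, x, z). if p c \<ge> 0 then (of_real (p c), x, z) else (of_real (- p c), z, x)) L"

lemma orient_simps [simp]:
  "orient p [] = []"
  "orient p ((c, x, z) # L) = (if p c \<ge> 0 then (of_real (p c), x, z) else (of_real (- p c), z, x)) # orient p L"
  by (simp_all add: orient_def)

lemma orient: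
  assumes p: "\<And>a b. p (a + b) = p a + p b" "\<And>a t. p (a * of_real t) = p a * t" "\<And>a. \<bar>p a\<bar> \<le> cmod a"
    and pR: "\<And>a. a \<in> R \<Longrightarrow> complex_of_real (p a) \<in> R"
    and T: "\<And>t. t \<in> T \<Longrightarrow> inv t \<in> T" and E: "edges_in T L"
  shows "edges_in T (orient p L)"
    and "(r, x, z) \<in> set (orient p L) \<Longrightarrow> Im r = 0 \<and> Re r \<ge> 0"
    and "list_boundary (orient p L) (\<lambda>g. of_real (k g)) = of_real (p (list_boundary L (\<lambda>g. of_real (k g))))"
    and "list_norm (orient p L) \<le> list_norm L"
proof -
  have neg: "- complex_of_real (p a) \<in> R" if "a \<in> R" for a using pR[OF that] R_closed(5) by blast
  have inv: "inv z \<otimes> x \<in> T" if "inv x \<otimes> z \<in> T" "x \<in> carrier G" "z \<in> carrier G" for x z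
    using T[OF that(1)] that by (simp add: G.inv_mult_group)
  show "edges_in T (orient p L)"
    using E by (induction L rule: list_chain.induct) (auto simp: pR neg inv)
  show "(r, x, z) \<in> set (orient p L) \<Longrightarrow> Im r = 0 \<and> Re r \<ge> 0"
    by (induction L rule: list_chain.induct) (auto split: if_splits)
  have p0: "p 0 = 0" using p(1)[of 0 0] by simp
  show "list_boundary (orient p L) (\<lambda>g. of_real (k g)) = of_real (p (list_boundary L (\<lambda>g. of_real (k g))))"
  proof (induction L rule: list_chain.induct)
    case (2 c x z L)
    have "p (c * (of_real (k z) - of_real (k x))) = p c * (k z - k x)"
      using p(2)[of c "k z - k x"] by simp
    then have "p (c * (of_real (k z) - of_real (k x)) + list_boundary L (\<lambda>g. of_real (k g))) =
        p c * (k z - k x) + p (list_boundary L (\<lambda>g. of_real (k g)))" by (simp only: p(1))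
    then show ?case using 2 by (cases "p c \<ge> 0") (simp_all, simp add: algebra_simps)
  qed (simp add: p0)
  show "list_norm (orient p L) \<le> list_norm L"
  proof (induction L rule: list_chain.induct)
    case (2 c x z L)
    then show ?case using p(3)[of c] by (simp; linarith)
  qed simp
qed

lemma orient_edge:
  assumes "of_real w \<in> R" "x \<in> carrier G" "z \<in> carrier G"
  shows "(if w \<ge> 0 then gmon (of_real w) \<one> \<odot>\<^bsub>C1\<^esub> edge x z else gmon (of_real (- w)) \<one> \<odot>\<^bsub>C1\<^esub> edge z x)
     = gmon (of_real w) \<one> \<odot>\<^bsub>C1\<^esub> edge x z"
proof -
  have "gmon (- of_real w) \<one> \<odot>\<^bsub>C1\<^esub> edge z x = gmon (- (- of_real w)) \<one> \<odot>\<^bsub>C1\<^esub> edge x z"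
    using assms R_closed(5)[OF assms(1)] unfolding edge_sym[OF assms(2,3)]
    by (subst C1.act_uminus_scalar) (auto simp: C1.act_uminus)
  then show ?thesis by simp
qed

text \<open>The imaginary unit where \<open>R\<close> contains it and 0 otherwise. Elements of all
  three rings thus split uniformly into a real part and \<open>\<iota>\<close> times an imaginary
  part, both in \<open>R\<close>.\<close>

definition \<iota> :: complex where
  "\<iota> = (if R = UNIV then \<i> else 0)"

lemma \<iota>: "\<iota> \<in> R" "cmod \<iota> \<le> 1" "a \<in> R \<Longrightarrow> a = of_real (Re a) + \<iota> * of_real (Im a)"
  "a \<in> R \<Longrightarrow> complex_of_real (Re a) \<in> R" "a \<in> R \<Longrightarrow> complex_of_real (Im a) \<in> R"
proof -
  show "\<iota> \<in> R" "cmod \<iota> \<le> 1" using R_closed by (auto simp: \<iota>_def)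
  have "R = UNIV \<or> (\<forall>a\<in>R. Im a = 0)"
    using R_cases by (auto elim!: Rats_cases Reals_cases simp flip: complex_of_real_of_rat)
  then have "R = UNIV \<or> a = of_real (Re a) \<and> Im a = 0" if "a \<in> R" using that by (auto simp: complex_eq_iff)
  note * = this
  show "a = of_real (Re a) + \<iota> * of_real (Im a)" if "a \<in> R"
    using *[OF that] by (auto simp: \<iota>_def complex_eq_iff)
  show "complex_of_real (Re a) \<in> R" if "a \<in> R"
    using *[OF that] that by (metis UNIV_I)
  show "complex_of_real (Im a) \<in> R" if "a \<in> R"
    using *[OF that] R_closed(1) by auto
qed

lemma list_chain_orient:
  assumes "edges_in T L" "\<And>t. t \<in> T \<Longrightarrow> inv t \<in> T"
  shows "list_chain L = list_chain (orient Re L) \<oplus>\<^bsub>C1\<^esub> gmon \<iota> \<one> \<odot>\<^bsub>C1\<^esub> list_chain (orient Im L)"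
  using assms(1)
proof (induction L rule: list_chain.induct)
  case 1
  show ?case by (simp add: C1.act_zero \<iota>)
next
  case (2 c x z L)
  then have c: "c \<in> R" "x \<in> carrier G" "z \<in> carrier G" and E: "edges_in T L" by auto
  note cR = \<iota>(4,5)[OF c(1)]
  have "edges_in T (orient Re L)" "edges_in T (orient Im L)"
    using E assms(2) \<iota> by (auto intro!: orient simp: abs_Re_le_cmod abs_Im_le_cmod)
  note EE = this[THEN list_chain_closed]
  let ?a = "gmon (of_real (Re c)) \<one> \<odot>\<^bsub>C1\<^esub> edge x z" and ?b = "gmon (of_real (Im c)) \<one> \<odot>\<^bsub>C1\<^esub> edge x z"
  have step: "list_chain (orient p ((c, x, z) # L)) = gmon (of_real (p c)) \<one> \<odot>\<^bsub>C1\<^esub> edge x z \<oplus>\<^bsub>C1\<^esub> list_chain (orient p L)"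
    if "of_real (p c) \<in> R" for p
    using orient_edge[OF that c(2,3)] by (auto split: if_splits)
  have "gmon c \<one> \<odot>\<^bsub>C1\<^esub> edge x z = gmon (of_real (Re c) + \<iota> * of_real (Im c)) \<one> \<odot>\<^bsub>C1\<^esub> edge x z"
    using \<iota>(3)[OF c(1)] by simp
  also have "\<dots> = ?a \<oplus>\<^bsub>C1\<^esub> gmon \<iota> \<one> \<odot>\<^bsub>C1\<^esub> ?b"
    using c cR \<iota>(1) R_closed(4) by (simp add: C1.act_add_scalar C1.act_act)
  finally have "list_chain ((c, x, z) # L) = (?a \<oplus>\<^bsub>C1\<^esub> gmon \<iota> \<one> \<odot>\<^bsub>C1\<^esub> ?b) \<oplus>\<^bsub>C1\<^esub>
      (list_chain (orient Re L) \<oplus>\<^bsub>C1\<^esub> gmon \<iota> \<one> \<odot>\<^bsub>C1\<^esub> list_chain (orient Im L))"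
    using 2 by simp
  also have "\<dots> = (?a \<oplus>\<^bsub>C1\<^esub> list_chain (orient Re L)) \<oplus>\<^bsub>C1\<^esub>
      gmon \<iota> \<one> \<odot>\<^bsub>C1\<^esub> (?b \<oplus>\<^bsub>C1\<^esub> list_chain (orient Im L))"
    using c cR \<iota>(1) EE by (simp add: C1.act_add C1.M.a_ac)
  finally show ?case unfolding step[of Re, OF cR(1)] step[of Im, OF cR(2)] .
qed

text \<open>Each \<open>y\<close> in \<open>\<Lambda>1\<close> is the sum of
  \<open>h (d1 y)\<close>, a boundary, and weighted Cayley edges with boundary
  \<open>phi (d1 y)\<close>. By linearity this extends to all chains with control of the norms. On a
  cycle the first summand vanishes and the edges form a flow, whose real and imaginary parts are
  filled by closed walks.\<close>

theorem linear_filling_of_four_point: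
  assumes four: "\<And>x y z w. \<lbrakk>x \<in> carrier G; y \<in> carrier G; z \<in> carrier G; w \<in> carrier G\<rbrakk> \<Longrightarrow>
      real (wdist w x + wdist y z) \<le> real (max (wdist w y + wdist x z) (wdist w z + wdist x y)) + D"
  shows "\<exists>K\<ge>0. linear_filling K"
proof -
  obtain h where h: "h \<in> left_module_hom A C0 C1"
    "\<And>m. m \<in> carrier C0 \<Longrightarrow> d1 (h m) = m \<oplus>\<^bsub>C0\<^esub> \<ominus>\<^bsub>C0\<^esub> (phi m \<odot>\<^bsub>C0\<^esub> e0)"
    using homotopy_exists by blast
  note hD = left_module_homD[OF h(1)]
  have h0: "h \<zero>\<^bsub>C0\<^esub> = \<zero>\<^bsub>C1\<^esub>"
    by (rule left_module_hom_zero[OF h(1) C0.M.abelian_group_axioms C1.M.abelian_group_axioms])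
  have "\<forall>y\<in>\<Lambda>1. \<exists>Lc. edges_in UNIV (fst Lc) \<and> snd Lc \<in> carrier C2 \<and>
      y = h (d1 y) \<oplus>\<^bsub>C1\<^esub> (d2 (snd Lc) \<oplus>\<^bsub>C1\<^esub> list_chain (fst Lc)) \<and>
      (\<forall>k. list_boundary (fst Lc) k = pairing (phi (d1 y)) k)"
  proof
    fix y assume y: "y \<in> \<Lambda>1"
    have aug: "pairing (phi (d1 y)) (\<lambda>_. 1) = 0" using y by (simp add: aug_phi \<epsilon>_d1)
    have a: "phi (d1 y) \<in> carrier A" using y phi_closed by simp
    obtain L where L: "edges_in UNIV L" "d1 (list_chain L) = phi (d1 y) \<odot>\<^bsub>C0\<^esub> e0 \<oplus>\<^bsub>C0\<^esub> \<ominus>\<^bsub>C0\<^esub> (gmon 0 \<one> \<odot>\<^bsub>C0\<^esub> e0)"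
      "\<forall>k. list_boundary L k = pairing (phi (d1 y)) k"
      using list_of_group_ring[OF a] unfolding aug by auto
    let ?p = "phi (d1 y) \<odot>\<^bsub>C0\<^esub> e0" and ?L = "list_chain L" and ?h = "h (d1 y)"
    have cl: "y \<in> carrier C1" "d1 y \<in> carrier C0" "?p \<in> carrier C0" "?L \<in> carrier C1" "?h \<in> carrier C1"
      using y a L(1) hD(1) by (auto simp: C0.smult_closed)
    have "\<ominus>\<^bsub>C0\<^esub> \<zero>\<^bsub>C0\<^esub> = \<zero>\<^bsub>C0\<^esub>" by (rule C0.M.minus_equality) simp_all
    then have dL: "d1 ?L = ?p" using L(2) cl C0.act_zero_scalar[of e0 \<one>] by simp
    \<comment> \<open>\<open>?h\<close> has the boundary of \<open>y\<close> except for
      \<open>?p\<close>, which is the boundary of \<open>?L\<close>; so the remainder is a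
      cycle.\<close>
    let ?r = "y \<oplus>\<^bsub>C1\<^esub> \<ominus>\<^bsub>C1\<^esub> (?h \<oplus>\<^bsub>C1\<^esub> ?L)"
    have "d1 (?h \<oplus>\<^bsub>C1\<^esub> ?L) = d1 y \<oplus>\<^bsub>C0\<^esub> (\<ominus>\<^bsub>C0\<^esub> ?p \<oplus>\<^bsub>C0\<^esub> ?p)"
      using cl by (simp add: d1_add h(2) dL C0.M.a_assoc)
    then have "d1 ?r = \<zero>\<^bsub>C0\<^esub>" using cl by (simp add: d1_add d1_uminus C0.M.l_neg C0.M.r_neg)
    then have "?r \<in> d2 ` carrier C2" unfolding exact1 using cl by simp
    then obtain c where c: "c \<in> carrier C2" "d2 c = ?r" by auto
    have "?h \<oplus>\<^bsub>C1\<^esub> (?r \<oplus>\<^bsub>C1\<^esub> ?L) = y \<oplus>\<^bsub>C1\<^esub> ((?h \<oplus>\<^bsub>C1\<^esub> ?L) \<oplus>\<^bsub>C1\<^esub> \<ominus>\<^bsub>C1\<^esub> (?h \<oplus>\<^bsub>C1\<^esub> ?L))"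
      using cl C1.M.a_closed[OF cl(5,4)] by (simp only: C1.M.a_ac C1.M.a_closed C1.M.a_inv_closed)
    then have "y = ?h \<oplus>\<^bsub>C1\<^esub> (d2 c \<oplus>\<^bsub>C1\<^esub> ?L)" using cl c by (simp add: C1.M.r_neg)
    then show "\<exists>Lc. edges_in UNIV (fst Lc) \<and> snd Lc \<in> carrier C2 \<and>
      y = h (d1 y) \<oplus>\<^bsub>C1\<^esub> (d2 (snd Lc) \<oplus>\<^bsub>C1\<^esub> list_chain (fst Lc)) \<and>
      (\<forall>k. list_boundary (fst Lc) k = pairing (phi (d1 y)) k)"
      using L c by (intro exI[of _ "(L, c)"]) simp
  qed
  from bchoice[OF this] obtain Lc where Lc: "\<forall>y\<in>\<Lambda>1. edges_in UNIV (fst (Lc y)) \<and> snd (Lc y) \<in> carrier C2 \<and>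
      y = h (d1 y) \<oplus>\<^bsub>C1\<^esub> (d2 (snd (Lc y)) \<oplus>\<^bsub>C1\<^esub> list_chain (fst (Lc y))) \<and>
      (\<forall>k. list_boundary (fst (Lc y)) k = pairing (phi (d1 y)) k)" ..
  define \<L> where "\<L> y = fst (Lc y)" for y
  define c where "c y = snd (Lc y)" for y
  have Ly: "edges_in UNIV (\<L> y)" "c y \<in> carrier C2" "\<And>k. list_boundary (\<L> y) k = pairing (phi (d1 y)) k"
    and y_eq: "h (d1 y) \<oplus>\<^bsub>C1\<^esub> (d2 (c y) \<oplus>\<^bsub>C1\<^esub> list_chain (\<L> y)) = y" if "y \<in> \<Lambda>1" for y
    using Lc that by (auto simp: \<L>_def c_def)
  define T0 where "T0 = (\<Union>y\<in>\<Lambda>1. (\<lambda>(r, x, z). inv x \<otimes> z) ` set (\<L> y))"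
  \<comment> \<open>Closed under inversion, because orienting a list reverses some of its
    edges.\<close>
  define T where "T = T0 \<union> m_inv G ` T0"
  have T0G: "T0 \<subseteq> carrier G"
    unfolding T0_def
  proof clarify
    fix y r x z assume "y \<in> \<Lambda>1" "(r, x, z) \<in> set (\<L> y)"
    then show "inv x \<otimes> z \<in> carrier G"
      using bspec[OF Ly(1)[unfolded edges_in_def], of y "(r, x, z)"] by simp
  qed
  then have TG: "T \<subseteq> carrier G" by (auto simp: T_def)
  have T_fin: "finite T" using basis1 by (simp add: T_def T0_def)
  have T_inv: "inv t \<in> T" if "t \<in> T" for t using that T0G by (auto simp: T_def subset_iff)
  have LT: "edges_in T (\<L> y)" if "y \<in> \<Lambda>1" for y
    unfolding edges_in_def
  proof clarify
    fix r x z assume rxz: "(r, x, z) \<in> set (\<L> y)"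
    then have "inv x \<otimes> z \<in> (\<lambda>(r, x, z). inv x \<otimes> z) ` set (\<L> y)" by (intro image_eqI) auto
    then have "inv x \<otimes> z \<in> T" unfolding T_def T0_def using that by blast
    then show "r \<in> R \<and> x \<in> carrier G \<and> z \<in> carrier G \<and> inv x \<otimes> z \<in> T"
      using bspec[OF Ly(1)[OF that, unfolded edges_in_def] rxz] by simp
  qed
  define B where "B = (\<Sum>y\<in>\<Lambda>1. list_norm (\<L> y) + C2.N (c y))"
  have B: "list_norm (\<L> y) \<le> B" "C2.N (c y) \<le> B" if "y \<in> \<Lambda>1" for y
  proof -
    have "list_norm (\<L> y) + C2.N (c y) \<le> B"
      unfolding B_def using basis1 that Ly(2) by (intro member_le_sum) (auto simp: list_norm_nonneg C2.N_nonneg)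
    then show "list_norm (\<L> y) \<le> B" "C2.N (c y) \<le> B"
      using list_norm_nonneg[of "\<L> y"] C2.N_nonneg[OF Ly(2)[OF that]] by linarith+
  qed
  have B0: "B \<ge> 0" unfolding B_def using Ly(2) by (intro sum_nonneg) (auto simp: list_norm_nonneg C2.N_nonneg)
  have decomp: "\<exists>L c. edges_in T L \<and> list_norm L \<le> B * C1.N b \<and> c \<in> carrier C2 \<and> C2.N c \<le> B * C1.N b \<and>
      b = h (d1 b) \<oplus>\<^bsub>C1\<^esub> (d2 c \<oplus>\<^bsub>C1\<^esub> list_chain L) \<and> (\<forall>k. list_boundary L k = pairing (phi (d1 b)) k)"
    if "b \<in> carrier C1" for b
    using that
  proof (induction rule: C1.l1_induct)
    case zero
    show ?case
      by (intro exI[of _ "[]"] exI[of _ "\<zero>\<^bsub>C2\<^esub>"]) (simp add: d1_zero d2_zero h0 phi_zero pairing_zero C2.N_zero)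
  next
    case (add m n r g y)
    then obtain L e where L: "edges_in T L" "list_norm L \<le> B * n" "e \<in> carrier C2" "C2.N e \<le> B * n"
      "m = h (d1 m) \<oplus>\<^bsub>C1\<^esub> (d2 e \<oplus>\<^bsub>C1\<^esub> list_chain L)" "\<And>k. list_boundary L k = pairing (phi (d1 m)) k" by blast
    note y = \<open>y \<in> \<Lambda>1\<close> and rg = \<open>r \<in> R\<close> \<open>g \<in> carrier G\<close> and m = \<open>m \<in> carrier C1\<close>
    note S = scale_list[OF rg LT[OF y]]
    let ?g = "gmon r g"
    let ?L' = "scale_list r g (\<L> y) @ L" and ?e' = "e \<oplus>\<^bsub>C2\<^esub> ?g \<odot>\<^bsub>C2\<^esub> c y"
    have a: "phi (d1 y) \<in> carrier A" using y phi_closed by simp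
    have cl: "h (d1 y) \<in> carrier C1" "h (d1 m) \<in> carrier C1" "d2 (c y) \<in> carrier C1" "d2 e \<in> carrier C1"
      "list_chain (\<L> y) \<in> carrier C1" "list_chain L \<in> carrier C1"
      using y m L(1,3) Ly(2)[OF y] hD(1) list_chain_closed[OF LT[OF y]] list_chain_closed[OF L(1)] by simp_all
    show ?case
    proof (intro exI[of _ ?L'] exI[of _ ?e'] conjI allI)
      show "edges_in T ?L'" using S L by simp
      have "cmod r * list_norm (\<L> y) \<le> cmod r * B" using B[OF y] by (intro mult_left_mono) auto
      then show "list_norm ?L' \<le> B * (n + cmod r)" using S L by (simp add: list_append(3) algebra_simps)
      show "?e' \<in> carrier C2" using L Ly(2)[OF y] rg by simp
      have "C2.N ?e' \<le> C2.N e + cmod r * C2.N (c y)"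
        using C2.N_add[of e "?g \<odot>\<^bsub>C2\<^esub> c y"] L Ly(2)[OF y] rg by (simp add: C2.N_act)
      also have "cmod r * C2.N (c y) \<le> cmod r * B" using B[OF y] by (intro mult_left_mono) auto
      finally show "C2.N ?e' \<le> B * (n + cmod r)" using L by (simp add: algebra_simps)
      show "list_boundary ?L' k = pairing (phi (d1 (m \<oplus>\<^bsub>C1\<^esub> ?g \<odot>\<^bsub>C1\<^esub> y))) k" for k
        using y m rg a L(6) Ly(3)[OF y] S(3)
        by (simp add: list_append(2) d1_add d1_smult phi_add phi_smult phi_closed pairing_A_add pairing_mon_mult
            C0.smult_closed C0.A.m_closed)
      have "h (d1 (m \<oplus>\<^bsub>C1\<^esub> ?g \<odot>\<^bsub>C1\<^esub> y)) = h (d1 m) \<oplus>\<^bsub>C1\<^esub> ?g \<odot>\<^bsub>C1\<^esub> h (d1 y)"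
        using y m rg hD(2,3) by (simp add: d1_add d1_smult)
      moreover have "d2 ?e' = d2 e \<oplus>\<^bsub>C1\<^esub> ?g \<odot>\<^bsub>C1\<^esub> d2 (c y)"
        using L Ly(2)[OF y] rg by (simp add: d2_add d2_smult)
      moreover have "list_chain ?L' = ?g \<odot>\<^bsub>C1\<^esub> list_chain (\<L> y) \<oplus>\<^bsub>C1\<^esub> list_chain L"
        using list_append(1)[OF S(1) L(1)] S(2) by simp
      moreover have "(h (d1 m) \<oplus>\<^bsub>C1\<^esub> ?g \<odot>\<^bsub>C1\<^esub> h (d1 y)) \<oplus>\<^bsub>C1\<^esub> ((d2 e \<oplus>\<^bsub>C1\<^esub> ?g \<odot>\<^bsub>C1\<^esub> d2 (c y)) \<oplus>\<^bsub>C1\<^esub>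
          (?g \<odot>\<^bsub>C1\<^esub> list_chain (\<L> y) \<oplus>\<^bsub>C1\<^esub> list_chain L)) =
        (h (d1 m) \<oplus>\<^bsub>C1\<^esub> (d2 e \<oplus>\<^bsub>C1\<^esub> list_chain L)) \<oplus>\<^bsub>C1\<^esub>
        (?g \<odot>\<^bsub>C1\<^esub> h (d1 y) \<oplus>\<^bsub>C1\<^esub> (?g \<odot>\<^bsub>C1\<^esub> d2 (c y) \<oplus>\<^bsub>C1\<^esub> ?g \<odot>\<^bsub>C1\<^esub> list_chain (\<L> y)))"
        using cl rg by (simp add: C1.M.a_ac)
      moreover have "?g \<odot>\<^bsub>C1\<^esub> h (d1 y) \<oplus>\<^bsub>C1\<^esub> (?g \<odot>\<^bsub>C1\<^esub> d2 (c y) \<oplus>\<^bsub>C1\<^esub> ?g \<odot>\<^bsub>C1\<^esub> list_chain (\<L> y)) = ?g \<odot>\<^bsub>C1\<^esub> y"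
        using cl rg y_eq[OF y] by (simp add: C1.act_add[symmetric])
      ultimately show "m \<oplus>\<^bsub>C1\<^esub> ?g \<odot>\<^bsub>C1\<^esub> y = h (d1 (m \<oplus>\<^bsub>C1\<^esub> ?g \<odot>\<^bsub>C1\<^esub> y)) \<oplus>\<^bsub>C1\<^esub> (d2 ?e' \<oplus>\<^bsub>C1\<^esub> list_chain ?L')"
        using L(5) by metis
    qed
  qed
  obtain K where K: "K \<ge> 0" "\<And>ws. set ws \<subseteq> letters \<Longrightarrow> wprod ws = \<one> \<Longrightarrow> fillable (word_chain ws) (K * real (length ws))"
    using Dehn_filling[of D] four by blast
  have "\<exists>K'\<ge>0. \<forall>xs. xs \<noteq> [] \<and> hd xs = last xs \<and> set xs \<subseteq> carrier G \<and>
     successively (\<lambda>x y. inv x \<otimes> y \<in> T) xs \<longrightarrow> fillable (walk_chain xs) (K' * real (length xs))"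
    by (rule walk_filling[OF K(1) _ T_fin TG]) (use K(2) in blast)
  then obtain K' where K': "K' \<ge> 0" "\<And>xs. xs \<noteq> [] \<Longrightarrow> hd xs = last xs \<Longrightarrow> set xs \<subseteq> carrier G \<Longrightarrow>
     successively (\<lambda>x y. inv x \<otimes> y \<in> T) xs \<Longrightarrow> fillable (walk_chain xs) (K' * real (length xs))"
    by blast
  \<comment> \<open>In the 4, one factor 2 comes from the flow decomposition and the other from the
    real and imaginary parts.\<close>
  have "linear_filling (B + 4 * K' * B)"
    unfolding linear_filling_def fillable_def[symmetric]
  proof (intro ballI impI)
    fix b assume b: "b \<in> carrier C1" "d1 b = \<zero>\<^bsub>C0\<^esub>"
    obtain L c where L: "edges_in T L" "list_norm L \<le> B * C1.N b" "c \<in> carrier C2" "C2.N c \<le> B * C1.N b"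
      "b = h (d1 b) \<oplus>\<^bsub>C1\<^esub> (d2 c \<oplus>\<^bsub>C1\<^esub> list_chain L)" "\<And>k. list_boundary L k = pairing (phi (d1 b)) k"
      using decomp[OF b(1)] by blast
    \<comment> \<open>For a cycle \<open>b\<close> the boundary functional of \<open>L\<close> is
      identically 0, so both oriented parts of \<open>L\<close> are balanced.\<close>
    have L0: "list_boundary L k = 0" for k using L(6) b by (simp add: phi_zero pairing_zero)
    have part: "fillable (list_chain (orient p L)) (2 * K' * (B * C1.N b))"
      if p: "\<And>a b. p (a + b) = p a + p b" "\<And>a t. p (a * of_real t) = p a * t" "\<And>a. \<bar>p a\<bar> \<le> cmod a"
        "\<And>a. a \<in> R \<Longrightarrow> complex_of_real (p a) \<in> R" for p
    proof -
      note O = orient[of p, OF p T_inv L(1)]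
      have "p 0 = 0" using p(1)[of 0 0] by simp
      then have "list_boundary (orient p L) (\<lambda>g. of_bool (g = v)) = 0" for v
      proof -
        have "(\<lambda>g. of_bool (g = v)) = (\<lambda>g. complex_of_real (of_bool (g = v)))" by auto
        then show ?thesis using O(3)[of "\<lambda>g. of_bool (g = v)"] L0 \<open>p 0 = 0\<close> by simp
      qed
      then have "fillable (list_chain (orient p L)) (2 * K' * list_norm (orient p L))"
        using O(1,2) by (intro list_flow_filling[OF K'(1) K'(2)]) auto
      moreover have "2 * K' * list_norm (orient p L) \<le> 2 * K' * (B * C1.N b)"
        using O(4) L(2) K'(1) by (intro mult_left_mono) auto
      ultimately show ?thesis by (rule fillable_mono)
    qed
    have re: "fillable (list_chain (orient Re L)) (2 * K' * (B * C1.N b))"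
      by (rule part) (auto simp: abs_Re_le_cmod \<iota>(4))
    have im: "fillable (list_chain (orient Im L)) (2 * K' * (B * C1.N b))"
      by (rule part) (auto simp: abs_Im_le_cmod \<iota>(5))
    have nn: "0 \<le> 2 * K' * (B * C1.N b)" using K'(1) B0 C1.N_nonneg[OF b(1)] by simp
    have "fillable (gmon \<iota> \<one> \<odot>\<^bsub>C1\<^esub> list_chain (orient Im L)) (1 * (2 * K' * (B * C1.N b)))"
      using mult_right_mono[OF \<iota>(2) nn] by (rule fillable_mono[OF fillable_act[OF im \<iota>(1) G.one_closed]])
    from fillable_add[OF re this]
    have "fillable (list_chain L) (4 * K' * (B * C1.N b))"
      using list_chain_orient[OF L(1) T_inv] by (simp add: mult_ac)
    moreover have "fillable (d2 c) (B * C1.N b)" unfolding fillable_def using L(3,4) by blast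
    moreover have "b = d2 c \<oplus>\<^bsub>C1\<^esub> list_chain L"
      using L(1,3,5) b h0 list_chain_closed[OF L(1)] by simp
    ultimately have "fillable b (B * C1.N b + 4 * K' * (B * C1.N b))"
      using fillable_add by metis
    then show "fillable b ((B + 4 * K' * B) * C1.N b)" by (simp add: algebra_simps)
  qed
  then show ?thesis using B0 K'(1) by (intro exI[of _ "B + 4 * K' * B"]) auto
qed

end

section \<open>The isoperimetric function\<close>

context fp2_complex
begin

definition fillnorm :: "'m \<Rightarrow> real" where
  "fillnorm b = Inf {C2.N c | c. c \<in> carrier C2 \<and> d2 c = b}"

lemma fillnorm_le: assumes "c \<in> carrier C2" "d2 c = b" shows "fillnorm b \<le> C2.N c"
  unfolding fillnorm_def
  by (rule cInf_lower) (use assms C2.N_nonneg in \<open>auto intro!: bdd_belowI[of _ 0]\<close>)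

lemma fillnorm_approx: assumes "b \<in> d2 ` carrier C2" "fillnorm b < F" shows "fillable b F"
proof -
  have "{C2.N c | c. c \<in> carrier C2 \<and> d2 c = b} \<noteq> {}" using assms(1) by auto
  from cInf_lessD[OF this] assms(2) show ?thesis
    unfolding fillnorm_def[symmetric] fillable_def by force
qed

text \<open>The coefficient ring contains the rational numbers, so that cycles can be rescaled to
  norm at most 1.\<close>

lemma linear_filling_of_bounded:
  assumes F: "\<And>b. b \<in> d2 ` carrier C2 \<Longrightarrow> C1.N b \<le> 1 \<Longrightarrow> fillnorm b \<le> F" and "F \<ge> 0"
  shows "linear_filling (2 * (F + 1))"
  unfolding linear_filling_def fillable_def[symmetric]
proof (intro ballI impI)
  fix b assume b: "b \<in> carrier C1" "d1 b = \<zero>\<^bsub>C0\<^esub>"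
  show "fillable b (2 * (F + 1) * C1.N b)"
  proof (cases "C1.N b = 0")
    case True
    have "C1.cf b x = C1.cf \<zero>\<^bsub>C1\<^esub> x" for x
    proof (cases "x \<in> \<Lambda>1")
      case x: True
      have "nrm1 (C1.cf b x) = 0"
        using True x basis1(1) unfolding C1.N_eq[OF b(1)] by (simp add: sum_nonneg_eq_0_iff nrm1_nonneg)
      then have "{g. C1.cf b x g \<noteq> 0} = {}"
        using fin_A[OF C1.cf_A[OF b(1)], of x] unfolding nrm1_def by (subst (asm) sum_nonneg_eq_0_iff) auto
      then show ?thesis by (auto simp: C1.cf_zero)
    qed (simp add: C1.cf_outside[OF b(1)] C1.cf_zero)
    then have "b = \<zero>\<^bsub>C1\<^esub>" using C1.cf_inj b by blast
    then show ?thesis using fillable_zero True by simp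
  next
    case False
    then have pos: "C1.N b > 0" using C1.N_nonneg[OF b(1)] by simp
    \<comment> \<open>A rational \<open>q\<close> and its inverse lie in \<open>R\<close> in all
      three cases. Scaling by \<open>inverse q\<close> brings the norm below 1, and the choice of
      \<open>q\<close> below twice the norm costs only a factor 2.\<close>
    obtain q where q: "q \<in> \<rat>" "C1.N b < q" "q < 2 * C1.N b"
      using Rats_dense_in_real[of "C1.N b" "2 * C1.N b"] pos by auto
    obtain p where p: "q = of_rat p" using q(1) by (auto elim: Rats_cases)
    have qR: "complex_of_real q \<in> R" "complex_of_real (inverse q) \<in> R"
      unfolding p of_rat_inverse[symmetric] complex_of_real_of_rat by (auto intro!: R_rat)
    define b' where "b' = gmon (of_real (inverse q)) \<one> \<odot>\<^bsub>C1\<^esub> b"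
    have b': "b' \<in> carrier C1" "d1 b' = \<zero>\<^bsub>C0\<^esub>" using b qR by (simp_all add: b'_def d1_smult C0.act_zero)
    have q0: "q > 0" using q pos by simp
    have "C1.N b' = inverse q * C1.N b" 
      unfolding b'_def C1.N_act[OF qR(2) G.one_closed b(1)] norm_of_real using q0 by simp
    also have "\<dots> \<le> 1" using q q0 by (simp add: field_simps)
    finally have "C1.N b' \<le> 1" .
    moreover have im: "b' \<in> d2 ` carrier C2" unfolding exact1 using b' by simp
    \<comment> \<open>The infimum need not be attained, hence \<open>F + 1\<close> in place of
      \<open>F\<close>.\<close>
    ultimately have "fillable b' (F + 1)" using F[of b'] by (intro fillnorm_approx) auto
    from fillable_act[OF this qR(1) G.one_closed]
    have "fillable (gmon (of_real q) \<one> \<odot>\<^bsub>C1\<^esub> b') (q * (F + 1))" using q0 by simp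
    moreover have "gmon (of_real q) \<one> \<odot>\<^bsub>C1\<^esub> b' = b"
      unfolding b'_def using b qR q0 by (subst C1.act_act) (auto simp: C1.act_one simp flip: of_real_mult)
    moreover have "q * (F + 1) \<le> 2 * (F + 1) * C1.N b"
      using mult_right_mono[of q "2 * C1.N b" "F + 1"] q \<open>F \<ge> 0\<close> by (simp add: algebra_simps)
    ultimately show ?thesis using fillable_mono by metis
  qed
qed

lemma fillnorm_bound:
  assumes "linear_filling K" "K \<ge> 0" "b \<in> d2 ` carrier C2" "C1.N b \<le> l"
  shows "fillnorm b \<le> K * l"
proof -
  have "b \<in> carrier C1" "d1 b = \<zero>\<^bsub>C0\<^esub>" using assms(3) unfolding exact1 by auto
  then obtain c where c: "c \<in> carrier C2" "d2 c = b" "C2.N c \<le> K * C1.N b"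
    using assms(1) unfolding linear_filling_def by blast
  then have "fillnorm b \<le> K * C1.N b" using fillnorm_le[OF c(1,2)] by simp
  also have "\<dots> \<le> K * l" using assms by (intro mult_left_mono) auto
  finally show ?thesis .
qed

text \<open>In one direction the resolution itself supplies the finite generating set; in the other,
  the set provided by hyperbolicity is used.\<close>

theorem linear_filling_iff_hyperbolic: "(\<exists>K\<ge>0. linear_filling K) \<longleftrightarrow> hyperbolic_group G"
proof
  assume "\<exists>K\<ge>0. linear_filling K"
  then obtain K where K: "linear_filling K" "K \<ge> 0" by blast
  interpret H: fp2_generated G R C0 C1 C2 d1 d2 \<epsilon> \<Lambda>1 \<Lambda>2 supp_gens
    by unfold_locales (rule supp_gens_subset generate_supp_gens finite_supp_gens)+
  show "hyperbolic_group G"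
    unfolding hyperbolic_group_def
    using G.group_axioms supp_gens_subset finite_supp_gens generate_supp_gens H.hyperbolic_of_linear_filling[OF K]
    by blast
next
  assume "hyperbolic_group G"
  then obtain S where S: "S \<subseteq> carrier G" "finite S" "generate G S = carrier G"
    "Gromov_hyperbolic_space (carrier G) (word_metric G S)"
    unfolding hyperbolic_group_def by blast
  interpret H: fp2_generated G R C0 C1 C2 d1 d2 \<epsilon> \<Lambda>1 \<Lambda>2 S
    by unfold_locales (rule S)+
  obtain D where "\<And>x y z w. \<lbrakk>x \<in> carrier G; y \<in> carrier G; z \<in> carrier G; w \<in> carrier G\<rbrakk> \<Longrightarrow>
      real (H.wdist w x + H.wdist y z) \<le> real (max (H.wdist w y + H.wdist x z) (H.wdist w z + H.wdist x y)) + D"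
    using S(4) unfolding H.hyperbolic_iff_four_point by blast
  then show "\<exists>K\<ge>0. linear_filling K" by (rule H.linear_filling_of_four_point)
qed

end

theorem corollary1p5:
  fixes G :: "('g, 'b) monoid_scheme"
    and Y :: "'x topology" and I :: "'i set" and dm :: "'i \<Rightarrow> nat"
    and char_map :: "'i \<Rightarrow> (nat \<Rightarrow> real) \<Rightarrow> 'x"
    and R :: "complex set"
    and C :: "nat \<Rightarrow> ('g \<Rightarrow> complex, 'm) module"
    and d :: "nat \<Rightarrow> 'm \<Rightarrow> 'm" and \<epsilon> :: "'m \<Rightarrow> complex"
    and \<Lambda>1 \<Lambda>2 :: "'m set"
  assumes "group G"
    and "finite_2dim_CW_complex Y I dm char_map" and "K_G_1 Y G"
    and "R = \<rat> \<or> R = \<real> \<or> R = UNIV"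
    and "one_admissible_resolution R G C d \<epsilon> \<Lambda>1 \<Lambda>2"
  shows "(\<forall>l\<ge>0. isoperimetric_function R G C d \<Lambda>1 \<Lambda>2 l < \<infinity>) \<longleftrightarrow> hyperbolic_group G"
proof -
  let ?A = "group_ring R G"
  have res: "projective_resolution ?A (trivial_module R) C d \<epsilon>"
    and bases: "finite \<Lambda>1" "free_basis ?A (C 1) \<Lambda>1" "finite \<Lambda>2" "free_basis ?A (C 2) \<Lambda>2"
    using assms(5) unfolding one_admissible_resolution_def by auto
  have d1: "d 1 \<in> left_module_hom ?A (C 1) (C 0)"
    and d2: "d 2 \<in> left_module_hom ?A (C 2) (C 1)"
    and exact1: "d 2 ` carrier (C 2) = module_kernel (C 1) (C 0) (d 1)"
    using res unfolding projective_resolution_def numeral_2_eq_2 One_nat_def by blast+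
  interpret fp2_complex G R "C 0" "C 1" "C 2" "d 1" "d 2" \<epsilon> \<Lambda>1 \<Lambda>2
  proof (intro fp2_complex.intro coeff_group.intro coeff_group_axioms.intro fp2_complex_axioms.intro
      assms(1,4) bases d1 d2)
    show "d 2 ` carrier (C 2) = {x \<in> carrier (C 1). d 1 x = \<zero>\<^bsub>C 0\<^esub>}"
      using exact1 by (simp add: module_kernel_def)
  qed (use res in \<open>auto simp: projective_resolution_def module_kernel_def trivial_module_def\<close>)
  have iso: "isoperimetric_function R G C d \<Lambda>1 \<Lambda>2 l =
      (SUP b \<in> {b \<in> d 2 ` carrier (C 2). C1.N b \<le> l}. ennreal (fillnorm b))" for l
    unfolding isoperimetric_function_def filling_norm_def fillnorm_def C1.N_def C2.N_def ..
  have "(\<forall>l\<ge>0. isoperimetric_function R G C d \<Lambda>1 \<Lambda>2 l < \<infinity>) \<longleftrightarrow> (\<exists>K\<ge>0. linear_filling K)"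
  proof
    assume "\<forall>l\<ge>0. isoperimetric_function R G C d \<Lambda>1 \<Lambda>2 l < \<infinity>"
    \<comment> \<open>By scaling, the value at 1 controls the filling of all cycles.\<close>
    then have "isoperimetric_function R G C d \<Lambda>1 \<Lambda>2 1 < \<infinity>" by simp
    then obtain F where F: "F \<ge> 0" "isoperimetric_function R G C d \<Lambda>1 \<Lambda>2 1 = ennreal F"
      by (cases "isoperimetric_function R G C d \<Lambda>1 \<Lambda>2 1") auto
    have "fillnorm b \<le> F" if "b \<in> d 2 ` carrier (C 2)" "C1.N b \<le> 1" for b
    proof -
      \<comment> \<open>\<open>ennreal\<close> truncates negative numbers; the real inequality is
        recovered because \<open>F\<close> is nonnegative.\<close>
      have "ennreal (fillnorm b) \<le> isoperimetric_function R G C d \<Lambda>1 \<Lambda>2 1"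
        unfolding iso using that by (intro SUP_upper) auto
      then show ?thesis using F by simp
    qed
    then have "linear_filling (2 * (F + 1))" using F(1) by (rule linear_filling_of_bounded)
    then show "\<exists>K\<ge>0. linear_filling K" using F(1) by (intro exI[of _ "2 * (F + 1)"]) auto
  next
    assume "\<exists>K\<ge>0. linear_filling K"
    then obtain K where K: "linear_filling K" "K \<ge> 0" by blast
    show "\<forall>l\<ge>0. isoperimetric_function R G C d \<Lambda>1 \<Lambda>2 l < \<infinity>"
    proof (intro allI impI)
      fix l :: real
      have "isoperimetric_function R G C d \<Lambda>1 \<Lambda>2 l \<le> ennreal (K * l)"
        unfolding iso using fillnorm_bound[OF K] by (intro SUP_least ennreal_leI) auto
      then show "isoperimetric_function R G C d \<Lambda>1 \<Lambda>2 l < \<infinity>"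
        by (simp add: le_less_trans)
    qed
  qed
  then show ?thesis using linear_filling_iff_hyperbolic by blast
qed

end
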